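(* Fix an integer $k\ge 1$. Let $H_k(z,u)=\sum z^{\text{size}}u^{\#\text{leaves}}$, summed over all closed lambda-terms with at most $k$ De Bruijn levels, and for $u$ in a neighbourhood of $1$ let $\rho_k(u)$ denote the dominant singularity (singularity of smallest modulus) of $z\mapsto H_k(z,u)$. Define $B(u)=\frac{\rho_k(1)}{\rho_k(u)}$. If $B''(1)+B'(1)-B'(1)^2\neq 0$, then the total number of leaves in a uniformly random closed lambda-term of size $n$ with at most $k$ De Bruijn levels is asymptotically normally distributed with asymptotic mean $\mu n$ and asymptotic variance $\sigma^2 n$, where $\mu=B'(1)$ and $\sigma^2=B''(1)+B'(1)-B'(1)^2$.
   Context: Lambda-terms are considered modulo $\alpha$-equivalence and represented by their skeleton, a rooted plane unary-binary tree (leaves = variables, unary nodes = abstractions, binary nodes = applications); size = total number of nodes. The De Bruijn level of a node is the number of unary nodes strictly above it on the path from the root (the root has level $0$). A closed lambda-term has at most $k$ De Bruijn levels if every node has level at most $k$. Such terms correspond bijectively to rooted plane unary-binary trees with all node levels $\le k$ in which each leaf at level $L$ (necessarily $L\ge1$) carries a label from $\{1,\dots,L\}$. Explicitly, $H_k(z,u)=\frac{1-\sqrt{R_{k+1,k}(z,u)}}{2z}$ with $R_{1,k}(z,u)=1-4kz^2u$ and $R_{i,k}(z,u)=1-4(k-i+1)z^2u-2z+2z\sqrt{R_{i-1,k}(z,u)}$ for $2\le i\le k+1$. The function $\rho_k(u)$ is analytic near $u=1$. *)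

theory Defs
  imports "HOL-Probability.Probability" "HOL-Complex_Analysis.Complex_Analysis"
begin

text \<open>
  Lambda-terms modulo alpha-equivalence in De Bruijn form: the plane unary-binary skeleton, with
  every leaf carrying the label \<open>i \<ge> 1\<close> saying that it is bound by the \<open>i\<close>-th abstraction met on
  the way up to the root.
\<close>

datatype lterm = Var nat | Lam lterm | App lterm lterm

fun term_size :: "lterm \<Rightarrow> nat" where
  "term_size (Var i) = 1"
| "term_size (Lam t) = term_size t + 1"
| "term_size (App s t) = term_size s + term_size t + 1"

fun leaves :: "lterm \<Rightarrow> nat" where
  "leaves (Var i) = 1"
| "leaves (Lam t) = leaves t"
| "leaves (App s t) = leaves s + leaves t"

text \<open>Here \<open>L\<close> is the De Bruijn level of the root of the term inside a surrounding term.\<close>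

fun closed_at :: "nat \<Rightarrow> lterm \<Rightarrow> bool" where
  "closed_at L (Var i) \<longleftrightarrow> i \<in> {1..L}"
| "closed_at L (Lam t) \<longleftrightarrow> closed_at (Suc L) t"
| "closed_at L (App s t) \<longleftrightarrow> closed_at L s \<and> closed_at L t"

text \<open>The largest De Bruijn level of a node; the root has level 0.\<close>

fun max_level :: "lterm \<Rightarrow> nat" where
  "max_level (Var i) = 0"
| "max_level (Lam t) = Suc (max_level t)"
| "max_level (App s t) = max (max_level s) (max_level t)"

definition closed_terms :: "nat \<Rightarrow> lterm set" where
  "closed_terms k = {t. closed_at 0 t \<and> max_level t \<le> k}"

text \<open>
  For fixed \<open>u\<close> only the germ of \<open>z \<mapsto> H k z u\<close> at \<open>0\<close> is meaningful: for complex \<open>u\<close> the double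
  series need not converge absolutely on the whole disc in which the power series in \<open>z\<close> does.
\<close>

definition H :: "nat \<Rightarrow> complex \<Rightarrow> complex \<Rightarrow> complex" where
  "H k z u = (\<Sum>\<^sub>\<infinity>t\<in>closed_terms k. z ^ term_size t * u ^ leaves t)"

text \<open>
  A singularity of smallest modulus of the analytic germ of \<open>h\<close> at \<open>0\<close>: the germ continues
  analytically to the open disc \<open>\<bar>z\<bar> < \<bar>z0\<bar>\<close>, but this continuation \<open>f\<close> cannot be continued
  to any neighbourhood of \<open>z0\<close>.
\<close>

definition dominant_singularity :: "(complex \<Rightarrow> complex) \<Rightarrow> complex \<Rightarrow> bool" where
  "dominant_singularity h z0 \<longleftrightarrow>
     (\<exists>f. f holomorphic_on ball 0 (norm z0) \<and> (\<forall>\<^sub>F z in nhds 0. f z = h z) \<and>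
       \<not> (\<exists>e>0. \<exists>g. g holomorphic_on ball z0 e \<and>
              (\<forall>z \<in> ball z0 e \<inter> ball 0 (norm z0). g z = f z)))"

text \<open>
  For the finitely many \<open>n\<close> for which there is no term of size \<open>n\<close> this is an unspecified
  distribution, which does not affect limits.
\<close>

definition random_term :: "nat \<Rightarrow> nat \<Rightarrow> lterm pmf" where
  "random_term k n = pmf_of_set {t \<in> closed_terms k. term_size t = n}"

text \<open>
  A sequence of random variables \<open>X\<close> on distributions \<open>p n\<close>, asymptotically normal with asymptotic
  mean \<open>\<mu> n\<close> and asymptotic variance \<open>\<sigma>\<^sup>2 n\<close>; the parameter \<open>v\<close> is \<open>\<sigma>\<^sup>2\<close>.  In the presence of the
  two moment asymptotics and \<open>v > 0\<close>, the weak limit below also holds when \<open>X\<close> is standardised by its exact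
  mean and variance.
\<close>

definition asymptotically_normal ::
    "(nat \<Rightarrow> 'a pmf) \<Rightarrow> ('a \<Rightarrow> real) \<Rightarrow> real \<Rightarrow> real \<Rightarrow> bool" where
  "asymptotically_normal p X \<mu> v \<longleftrightarrow>
     (\<lambda>n. measure_pmf.expectation (p n) X) \<sim>[sequentially] (\<lambda>n. \<mu> * real n) \<and>
     (\<lambda>n. measure_pmf.variance (p n) X) \<sim>[sequentially] (\<lambda>n. v * real n) \<and>
     weak_conv_m
       (\<lambda>n. distr (measure_pmf (p n)) borel (\<lambda>t. (X t - \<mu> * real n) / sqrt (v * real n)))
       std_normal_distribution"

end

theory Submission
  imports Defs
begin

text \<open>
  For real \<open>u\<close> near 1 all series involved have nonnegative coefficients, and the singularity at the
  radius of convergence arises because one of the radicands \<open>R\<^sub>i\<close> vanishes there.  Two consecutive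
  radicands may vanish simultaneously at \<open>u = 1\<close>, but then the radius of convergence is given by
  different equations for \<open>u < 1\<close> and for \<open>u > 1\<close>, contradicting the analyticity of \<open>\<rho>\<close>.  Hence exactly
  one radicand \<open>R\<^sub>J\<close> vanishes at \<open>\<rho>(u)\<close>, its zero is simple, and no other singularity lies on the circle.
  In the variable \<open>w = csqrt (1 - z / \<rho>(u))\<close> the generating function is then holomorphic and bounded on a
  fixed neighbourhood of the right lobe of the lemniscate \<open>\<bar>1 - w\<^sup>2\<bar> = 1\<close>, uniformly in complex \<open>u\<close> near 1,
  and Darboux's method yields
  \<open>[z\<^sup>n] H\<^sub>k(z, u) = \<rho>(u)\<^sup>-\<^sup>n a\<^sub>n (c(u) + o(1))\<close> with \<open>a\<^sub>n\<close> independent of \<open>u\<close>.  The moments and the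
  characteristic function of the number of leaves follow from such quasi-power asymptotics.
\<close>

text \<open>Positivity arguments work only for real \<open>u\<close>, whereas the limit law needs
  asymptotics that are uniform in complex \<open>u\<close>. Therefore the series is used for complex
  \<open>u\<close> only near 0, where it determines the coefficients. The sign and branch conditions
  are checked at \<open>u = 1\<close> on the closed disc, or on the compact \<open>lobe\<close>, and
  continuity carries them to complex \<open>u\<close>. The one fact about complex \<open>u\<close>
  that comes from the identity theorem is the equation \<open>rad k J (\<rho> u) u = 0\<close>.

  The lobe replaces a slit domain. In the variable \<open>w\<close> the function extends past the
  branch point, so dividing by powers of \<open>w\<close> and using Cauchy's inequality suffices,
  with no contour around a cut. The error is of order \<open>1 / n^2\<close>, against a main term of
  order \<open>n\<close> to the power -3/2.

  The index \<open>J\<close> is never computed. Besides its existence, what matters is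
  \<open>2 \<le> J\<close>: for \<open>J = 1\<close>, the deepest level, the radicand is even in
  \<open>z\<close> and vanishes at two opposite points of the circle.\<close>

definition terms :: "nat \<Rightarrow> nat \<Rightarrow> lterm set" where
  "terms k L = {t. closed_at L t \<and> L + max_level t \<le> k}"

definition terms_of_size :: "nat \<Rightarrow> nat \<Rightarrow> nat \<Rightarrow> lterm set" where
  "terms_of_size k L n = {t \<in> terms k L. term_size t = n}"

lemma term_size_pos: "term_size t > 0"
  by (induction t) auto

lemma leaves_pos: "leaves t > 0"
  by (induction t) auto

lemma terms_of_size_0 [simp]: "terms_of_size k L 0 = {}"
  using term_size_pos by (auto simp: terms_of_size_def)

lemma terms_of_size_beyond [simp]: "k < L \<Longrightarrow> terms_of_size k L n = {}"
  by (auto simp: terms_of_size_def terms_def)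

lemma terms_of_size_Suc:
  assumes "L \<le> k"
  shows "terms_of_size k L (Suc n) =
    (if n = 0 then Var ` {1..L} else {}) \<union> Lam ` terms_of_size k (Suc L) n \<union>
    (\<Union>m\<in>{..n}. (\<lambda>(s, t). App s t) ` (terms_of_size k L m \<times> terms_of_size k L (n - m)))"
    (is "?A = ?B")
proof (rule set_eqI)
  fix t show "t \<in> ?A \<longleftrightarrow> t \<in> ?B"
  proof (cases t)
    case (Var i)
    then show ?thesis using assms by (auto simp: terms_of_size_def terms_def)
  next
    case (Lam s)
    then show ?thesis by (auto simp: terms_of_size_def terms_def)
  next
    case (App s t)
    then show ?thesis by (auto simp: terms_of_size_def terms_def image_iff)
  qed
qed

lemma finite_terms_of_size [simp]: "finite (terms_of_size k L n)"
proof (induction n arbitrary: L rule: less_induct)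
  case (less n)
  show ?case
  proof (cases "n = 0 \<or> k < L")
    case False
    then obtain m where n: "n = Suc m" and L: "L \<le> k" by (cases n) auto
    show ?thesis
      unfolding n terms_of_size_Suc[OF L] using less[unfolded n]
      by (auto intro!: finite_imageI finite_cartesian_product)
  qed auto
qed

text \<open>Polymorphic because monotonicity and signs need real \<open>u\<close>, analyticity
  complex \<open>u\<close>.\<close>

definition term_poly :: "nat \<Rightarrow> nat \<Rightarrow> nat \<Rightarrow> 'a :: comm_semiring_1 \<Rightarrow> 'a" where
  "term_poly k L n u = (\<Sum>t\<in>terms_of_size k L n. u ^ leaves t)"

lemma term_poly_0 [simp]: "term_poly k L 0 u = 0"
  by (simp add: term_poly_def)

lemma term_poly_beyond [simp]: "k < L \<Longrightarrow> term_poly k L n u = 0"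
  by (simp add: term_poly_def)

lemma term_poly_Suc:
  assumes "L \<le> k"
  shows "term_poly k L (Suc n) u = (if n = 0 then of_nat L * u else 0) + term_poly k (Suc L) n u
           + (\<Sum>m\<le>n. term_poly k L m u * term_poly k L (n - m) u)"
proof -
  let ?V = "if n = 0 then Var ` {1..L} else {}"
  let ?B = "Lam ` terms_of_size k (Suc L) n"
  let ?C = "\<lambda>m. (\<lambda>(s, t). App s t) ` (terms_of_size k L m \<times> terms_of_size k L (n - m))"
  have "term_poly k L (Suc n) u = (\<Sum>t\<in>(?V \<union> ?B) \<union> (\<Union>m\<in>{..n}. ?C m). u ^ leaves t)"
    by (simp only: term_poly_def terms_of_size_Suc[OF assms])
  also have "\<dots> = (\<Sum>t\<in>?V. u ^ leaves t) + (\<Sum>t\<in>?B. u ^ leaves t) + (\<Sum>t\<in>(\<Union>m\<in>{..n}. ?C m). u ^ leaves t)"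
    by (subst sum.union_disjoint; (subst sum.union_disjoint)?) (auto split: if_splits)
  also have "(\<Sum>t\<in>?V. u ^ leaves t) = (if n = 0 then of_nat L * u else 0)"
    by (auto simp: sum.reindex inj_on_def)
  also have "(\<Sum>t\<in>?B. u ^ leaves t) = term_poly k (Suc L) n u"
    by (simp add: term_poly_def sum.reindex inj_on_def)
  also have "(\<Sum>t\<in>(\<Union>m\<in>{..n}. ?C m). u ^ leaves t) = (\<Sum>m\<le>n. \<Sum>t\<in>?C m. u ^ leaves t)"
  proof (rule sum.UNION_disjoint)
    show "\<forall>m\<in>{..n}. finite (?C m)" by auto
    show "\<forall>i\<in>{..n}. \<forall>j\<in>{..n}. i \<noteq> j \<longrightarrow> ?C i \<inter> ?C j = {}" by (auto simp: terms_of_size_def)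
  qed auto
  also have "\<dots> = (\<Sum>m\<le>n. term_poly k L m u * term_poly k L (n - m) u)"
    by (intro sum.cong refl, subst sum.reindex)
       (auto simp: inj_on_def term_poly_def sum_product sum.cartesian_product power_add
             intro!: sum.cong split: prod.splits)
  finally show ?thesis .
qed

lemma term_poly_nonneg: "u \<ge> 0 \<Longrightarrow> term_poly k L n (u :: real) \<ge> 0"
  by (auto simp: term_poly_def intro!: sum_nonneg)

lemma term_poly_mono: "0 \<le> u \<Longrightarrow> u \<le> v \<Longrightarrow> term_poly k L n u \<le> term_poly k L n (v :: real)"
  by (auto simp: term_poly_def intro!: sum_mono power_mono)

lemma of_real_term_poly: "of_real (term_poly k L n u) = term_poly k L n (of_real u :: complex)"
  by (simp add: term_poly_def)

text \<open>Putting an abstraction on top embeds level \<open>Suc L\<close> into level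
  \<open>L\<close>. This is how convergence is inherited by deeper levels.\<close>

lemma term_poly_le_Suc:
  assumes "L \<le> k" "u \<ge> 0"
  shows "term_poly k (Suc L) n u \<le> term_poly k L (Suc n) (u :: real)"
  unfolding term_poly_Suc[OF assms(1)] using assms(2)
  by (auto intro!: sum_nonneg mult_nonneg_nonneg term_poly_nonneg add_increasing)

text \<open>There is one application fewer than leaves, and each abstraction lies above some leaf,
  with at most \<open>max_level t\<close> of them above any given leaf. The resulting linear lower
  bound on the number of leaves makes the mean constant positive.\<close>

lemma size_le_leaves: "term_size t + 1 \<le> (max_level t + 2) * leaves t"
proof (induction t)
  case (Lam t)
  then show ?case using leaves_pos[of t] by simp
next
  case (App s t)
  have "(max_level s + 2) * leaves s \<le> (max_level (App s t) + 2) * leaves s"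
       "(max_level t + 2) * leaves t \<le> (max_level (App s t) + 2) * leaves t"
    by (auto intro!: mult_right_mono)
  then show ?case using App unfolding term_size.simps leaves.simps distrib_left by linarith
qed simp

lemma closed_terms_eq: "closed_terms k = terms k 0"
  by (simp add: closed_terms_def terms_def)

text \<open>With labels bounded by k, the weighted sums \<open>A\<^sub>n\<close> over the terms of size at most n
  satisfy \<open>A\<^sub>n\<^sub>+\<^sub>1 \<le> x (k y + A\<^sub>n + A\<^sub>n\<^sup>2)\<close>.\<close>

fun labels :: "lterm \<Rightarrow> nat set" where
  "labels (Var i) = {i}"
| "labels (Lam t) = labels t"
| "labels (App s t) = labels s \<union> labels t"

lemma labels_closed_at: "closed_at L t \<Longrightarrow> L + max_level t \<le> k \<Longrightarrow> labels t \<subseteq> {1..k}"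
  by (induction t arbitrary: L) fastforce+

text \<open>The hypothesis makes the bound 1 reproduce itself:
  \<open>x * (k * y + 1 + 1) \<le> 1\<close>. Bounding labels instead of tracking levels gives one
  family, closed under subterms, that contains the terms of all levels.\<close>

lemma small_terms_bound:
  fixes x y :: real
  assumes x: "0 \<le> x" and y: "0 \<le> y" and le: "x * (of_nat k * y + 2) \<le> 1"
  defines "A \<equiv> \<lambda>n. {t. labels t \<subseteq> {1..k} \<and> term_size t \<le> n}"
  shows "finite (A n) \<and> (\<Sum>t\<in>A n. x ^ term_size t * y ^ leaves t) \<le> 1"
proof (induction n)
  case 0
  have "A 0 = {}" using term_size_pos by (auto simp: A_def)
  then show ?case by simp
next
  case (Suc n)
  let ?w = "\<lambda>t. x ^ term_size t * y ^ leaves t"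
  let ?W = "Var ` {1..k} \<union> Lam ` A n \<union> (\<lambda>(s, t). App s t) ` (A n \<times> A n)"
  have fin: "finite (A n)" and S: "sum ?w (A n) \<le> 1" using Suc by auto
  have S0: "sum ?w (A n) \<ge> 0" using x y by (intro sum_nonneg) auto
  have sub: "A (Suc n) \<subseteq> ?W"
  proof
    fix t assume "t \<in> A (Suc n)"
    then show "t \<in> ?W"
      using term_size_pos by (cases t) (auto simp: A_def image_iff Suc_le_eq)
  qed
  have finW: "finite ?W" using fin by auto
  have "sum ?w (A (Suc n)) \<le> sum ?w ?W"
    using x y by (intro sum_mono2 finW sub) auto
  also have "\<dots> = sum ?w (Var ` {1..k}) + sum ?w (Lam ` A n) + sum ?w ((\<lambda>(s, t). App s t) ` (A n \<times> A n))"
    using fin by (subst sum.union_disjoint; (subst sum.union_disjoint)?) auto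
  also have "sum ?w (Var ` {1..k}) = x * (of_nat k * y)"
    by (subst sum.reindex) (auto simp: inj_on_def)
  also have "sum ?w (Lam ` A n) = x * sum ?w (A n)"
    by (subst sum.reindex) (auto simp: inj_on_def sum_distrib_left mult_ac)
  also have "sum ?w ((\<lambda>(s, t). App s t) ` (A n \<times> A n)) = x * (sum ?w (A n) * sum ?w (A n))"
    by (subst sum.reindex)
       (auto simp: inj_on_def sum_product sum_distrib_left sum.cartesian_product power_add mult_ac
             intro!: sum.cong split: prod.splits)
  also have "x * (of_nat k * y) + x * sum ?w (A n) + x * (sum ?w (A n) * sum ?w (A n)) \<le>
     x * (of_nat k * y) + x * 1 + x * (1 * 1)"
    using S S0 x by (intro add_mono mult_left_mono mult_mono) auto
  also have "\<dots> = x * (of_nat k * y + 2)" by (simp add: algebra_simps)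
  finally show ?case using le finite_subset[OF sub finW] by simp
qed

lemma summable_terms:
  fixes x y :: real
  assumes "0 \<le> x" "0 \<le> y" "x * (of_nat k * y + 2) \<le> 1"
  shows "(\<lambda>t. x ^ term_size t * y ^ leaves t) summable_on terms k L"
proof (rule nonneg_bdd_above_summable_on)
  show "bdd_above (sum (\<lambda>t. x ^ term_size t * y ^ leaves t) ` {F. F \<subseteq> terms k L \<and> finite F})"
  proof (rule bdd_aboveI2)
    fix F assume F: "F \<in> {F. F \<subseteq> terms k L \<and> finite F}"
    define n where "n = Max (insert 0 (term_size ` F))"
    have "F \<subseteq> {t. labels t \<subseteq> {1..k} \<and> term_size t \<le> n}"
      using F labels_closed_at unfolding n_def terms_def by (fastforce intro!: Max_ge)
    then have "sum (\<lambda>t. x ^ term_size t * y ^ leaves t) F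
        \<le> sum (\<lambda>t. x ^ term_size t * y ^ leaves t) {t. labels t \<subseteq> {1..k} \<and> term_size t \<le> n}"
      using small_terms_bound[OF assms, of n] assms by (intro sum_mono2) auto
    also have "\<dots> \<le> 1" using small_terms_bound[OF assms, of n] by blast
    finally show "sum (\<lambda>t. x ^ term_size t * y ^ leaves t) F \<le> 1" .
  qed
qed (use assms in auto)

text \<open>Absolute summability for small \<open>z\<close> permits grouping by size, which connects
  the unordered sum in \<open>H\<close> with a power series in \<open>z\<close>.\<close>

lemma terms_has_sum_term_poly:
  fixes z u :: complex
  assumes "norm z * (of_nat k * norm u + 2) \<le> 1"
  shows "((\<lambda>n. term_poly k L n u * z ^ n) has_sum (\<Sum>\<^sub>\<infinity>t\<in>terms k L. z ^ term_size t * u ^ leaves t)) UNIV"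
proof -
  let ?f = "\<lambda>t. z ^ term_size t * u ^ leaves t"
  have "(\<lambda>t. norm (?f t)) summable_on terms k L"
    using summable_terms[of "norm z" "norm u" k L] assms by (simp add: norm_mult norm_power)
  then have *: "?f summable_on terms k L" by (rule abs_summable_summable)
  have bij: "bij_betw snd (SIGMA n:UNIV. terms_of_size k L n) (terms k L)"
    by (auto simp: bij_betw_def inj_on_def terms_of_size_def image_iff)
  have "((\<lambda>(n, t). ?f t) has_sum infsum ?f (terms k L)) (SIGMA n:UNIV. terms_of_size k L n)"
    using has_sum_reindex_bij_betw[OF bij, of ?f] has_sum_infsum[OF *] by (simp add: case_prod_unfold)
  then have "((\<lambda>n. \<Sum>t\<in>terms_of_size k L n. ?f t) has_sum infsum ?f (terms k L)) UNIV"
    by (rule has_sum_SigmaD) (auto intro!: has_sum_finiteI)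
  moreover have "(\<Sum>t\<in>terms_of_size k L n. ?f t) = term_poly k L n u * z ^ n" for n
    unfolding term_poly_def sum_distrib_right by (rule sum.cong) (auto simp: terms_of_size_def)
  ultimately show ?thesis by simp
qed

section \<open>The generating function of each level as a formal power series in
  \<open>z\<close>\<close>

definition gf :: "nat \<Rightarrow> nat \<Rightarrow> complex \<Rightarrow> complex fps" where
  "gf k i u = Abs_fps (\<lambda>n. term_poly k (Suc k - i) n u)"

lemma gf_has_fps_expansion:
  "(\<lambda>z. \<Sum>\<^sub>\<infinity>t\<in>terms k (Suc k - i). z ^ term_size t * u ^ leaves t) has_fps_expansion gf k i u"
proof (rule has_fps_expansionI)
  define e where "e = 1 / (of_nat k * norm u + 2)"
  have e: "e > 0" unfolding e_def by (intro divide_pos_pos add_nonneg_pos) auto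
  have "eventually (\<lambda>z. z \<in> ball 0 e) (nhds (0::complex))"
    using e by (intro eventually_nhds_in_open) auto
  then show "eventually (\<lambda>z. (\<lambda>n. gf k i u $ n * z ^ n) sums
      (\<Sum>\<^sub>\<infinity>t\<in>terms k (Suc k - i). z ^ term_size t * u ^ leaves t)) (nhds 0)"
  proof eventually_elim
    case (elim z)
    then have "norm z * (of_nat k * norm u + 2) \<le> 1"
      unfolding e_def using pos_less_divide_eq[of "of_nat k * norm u + 2" "norm z" 1]
      by (simp add: add_nonneg_pos)
    from terms_has_sum_term_poly[OF this, of "Suc k - i"] show ?case
      by (simp add: gf_def has_sum_imp_sums)
  qed
qed

lemma H_has_fps_expansion: "(\<lambda>z. H k z u) has_fps_expansion gf k (Suc k) u"
  using gf_has_fps_expansion[where k = k and i = "Suc k"] by (simp add: H_def closed_terms_eq)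

text \<open>The formal square root of the radicand with index \<open>i\<close>. Indices count
  upwards from the empty level \<open>k + 1\<close>, so the recursion starts with the constant
  1.\<close>

definition sq :: "nat \<Rightarrow> nat \<Rightarrow> complex \<Rightarrow> complex fps" where
  "sq k i u = 1 - 2 * fps_X * gf k i u"

lemma gf_0 [simp]: "gf k 0 u = 0"
  by (simp add: gf_def fps_eq_iff)

lemma gf_Suc:
  assumes "i \<le> k"
  shows "gf k (Suc i) u = fps_X * (fps_const (of_nat (k - i) * u) * fps_X ^ 0 + gf k i u + gf k (Suc i) u ^ 2)"
proof (rule fps_ext)
  fix n
  have "Suc (k - i) = Suc k - i" using assms by simp
  then show "gf k (Suc i) u $ n =
     (fps_X * (fps_const (of_nat (k - i) * u) * fps_X ^ 0 + gf k i u + gf k (Suc i) u ^ 2)) $ n"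
    using term_poly_Suc[of "k - i" k "n - 1" u]
    by (cases "n = 0") (auto simp: gf_def power2_eq_square fps_X_mult_nth fps_mult_nth[of "Abs_fps _"] atLeast0AtMost)
qed

lemma sq_0 [simp]: "sq k 0 u = 1"
  by (simp add: sq_def)

text \<open>Completing the square in the quadratic equation \<open>gf_Suc\<close>.\<close>

lemma sq_Suc:
  assumes "i \<le> k"
  shows "sq k (Suc i) u ^ 2 = 1 - 4 * fps_const (of_nat (k - i) * u) * fps_X ^ 2 - 2 * fps_X + 2 * fps_X * sq k i u"
proof -
  have "sq k (Suc i) u ^ 2 = 1 - 4 * fps_X * (gf k (Suc i) u - fps_X * gf k (Suc i) u ^ 2)"
    by (simp add: sq_def power2_eq_square algebra_simps)
  also have "gf k (Suc i) u - fps_X * gf k (Suc i) u ^ 2 = fps_X * (fps_const (of_nat (k - i) * u) + gf k i u)"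
    using gf_Suc[OF assms, of u] by (simp add: algebra_simps)
  finally show ?thesis by (simp add: sq_def power2_eq_square algebra_simps)
qed

lemma sq_nth: "sq k i u $ n = (if n = 0 then 1 else - 2 * term_poly k (Suc k - i) (n - 1) u)"
  by (cases n) (simp_all add: sq_def gf_def mult.assoc fps_mult_numeral_left)

text \<open>Cauchy's inequality on circles of radius \<open>r < 1\<close>, followed by
  \<open>r\<close> tending to 1, since the bound is available only on the open disc.\<close>

lemma fps_nth_norm_le:
  fixes F :: "complex fps"
  assumes "f has_fps_expansion F" "f holomorphic_on ball 0 1" "\<And>z. z \<in> ball 0 1 \<Longrightarrow> norm (f z) \<le> M"
  shows "norm (F $ n) \<le> M"
proof -
  have *: "norm (F $ n) * r ^ n \<le> M" if r: "0 < r" "r < 1" for r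
  proof -
    have sub: "cball 0 r \<subseteq> ball (0::complex) 1" using r by auto
    have "norm ((deriv ^^ n) f 0) \<le> fact n * M / r ^ n"
    proof (rule Cauchy_inequality)
      show "f holomorphic_on ball 0 r" by (rule holomorphic_on_subset[OF assms(2)]) (use r in auto)
      show "continuous_on (cball 0 r) f"
        using assms(2) sub holomorphic_on_imp_continuous_on continuous_on_subset by blast
    qed (use r assms(3) in auto)
    then show ?thesis using r by (simp add: fps_nth_fps_expansion[OF assms(1)] norm_divide field_simps)
  qed
  have "((\<lambda>r. norm (F $ n) * r ^ n) \<longlongrightarrow> norm (F $ n) * 1 ^ n) (at_left (1::real))"
    by (intro tendsto_intros)
  moreover have "eventually (\<lambda>r. r \<in> {0<..<1}) (at_left (1::real))"
    by (rule eventually_at_leftI[of 0]) auto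
  then have "eventually (\<lambda>r. norm (F $ n) * r ^ n \<le> M) (at_left (1::real))"
    by eventually_elim (use * in auto)
  ultimately show ?thesis
    using tendsto_upperbound[of "\<lambda>r. norm (F $ n) * r ^ n" _ "at_left (1::real)" M] by simp
qed

section \<open>Coefficients of functions of the square root of 1 - x\<close>

text \<open>The closed right lobe of the lemniscate is the image of the closed unit disc under
  \<open>x \<mapsto> csqrt (1 - x)\<close>.\<close>

definition lobe :: "complex set" where
  "lobe = {w. Re w \<ge> 0 \<and> norm (1 - w\<^sup>2) \<le> 1}"

definition lobe_nhd :: "real \<Rightarrow> complex set" where
  "lobe_nhd d = {w. infdist w lobe < d}"

lemma zero_in_lobe [simp]: "0 \<in> lobe"
  by (simp add: lobe_def)

lemma norm_lobe_le: "w \<in> lobe \<Longrightarrow> norm w \<le> 2"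
proof -
  assume "w \<in> lobe"
  then have "norm (w\<^sup>2) \<le> 2" 
    using norm_triangle_ineq4[of 1 "1 - w\<^sup>2"] unfolding lobe_def by force
  then have "(norm w)\<^sup>2 \<le> 2\<^sup>2" by (simp add: norm_power)
  then show ?thesis by (rule power2_le_imp_le) simp
qed

lemma compact_lobe: "compact lobe"
proof -
  have "lobe = {w. 0 \<le> Re w} \<inter> {w. norm (1 - w\<^sup>2) \<le> 1}" by (auto simp: lobe_def)
  moreover have "closed \<dots>"
    by (intro closed_Int closed_Collect_le continuous_intros)
  moreover have "bounded lobe" using norm_lobe_le by (auto simp: bounded_iff)
  ultimately show ?thesis by (simp add: compact_eq_bounded_closed)
qed

lemma open_lobe_nhd [simp]: "open (lobe_nhd d)"
  unfolding lobe_nhd_def by (intro open_Collect_less continuous_intros)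

lemma lobe_nhd_mono: "d \<le> e \<Longrightarrow> lobe_nhd d \<subseteq> lobe_nhd e"
  by (auto simp: lobe_nhd_def)

lemma lobe_subset_nhd: "d > 0 \<Longrightarrow> lobe \<subseteq> lobe_nhd d"
  by (auto simp: lobe_nhd_def)

lemma cball_subset_lobe_nhd: "w \<in> lobe_nhd d \<Longrightarrow> cball w e \<subseteq> lobe_nhd (d + e)"
proof
  fix x assume w: "w \<in> lobe_nhd d" and x: "x \<in> cball w e"
  show "x \<in> lobe_nhd (d + e)"
    using w x infdist_triangle[of x lobe w] by (auto simp: lobe_nhd_def dist_commute)
qed

lemma norm_lobe_nhd_le: "w \<in> lobe_nhd d \<Longrightarrow> norm w \<le> 2 + d"
proof -
  assume w: "w \<in> lobe_nhd d"
  obtain v where v: "v \<in> lobe" "infdist w lobe = dist w v"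
    using infdist_attains_inf[OF compact_imp_closed[OF compact_lobe], of w] zero_in_lobe by blast
  then have "norm w \<le> norm v + d"
    using w norm_triangle_sub[of w v] by (auto simp: lobe_nhd_def dist_norm)
  then show ?thesis using norm_lobe_le[OF v(1)] by simp
qed

lemma one_minus_notin_nonpos: "norm (x::complex) < 1 \<Longrightarrow> 1 - x \<notin> \<real>\<^sub>\<le>\<^sub>0"
  using complex_Re_le_cmod[of x] by (auto simp: complex_nonpos_Reals_iff)

lemma csqrt_in_lobe: "norm x \<le> 1 \<Longrightarrow> csqrt (1 - x) \<in> lobe"
  unfolding lobe_def mem_Collect_eq power2_csqrt using Re_csqrt[of "1 - x"] by simp

text \<open>Where \<open>norm w \<ge> d/2\<close>, the divided difference is at most
  \<open>2 * M / (d/2)\<close>. The disc of radius \<open>d/2\<close> around 0 lies in the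
  neighbourhood, and the maximum principle carries the bound from its boundary inwards.\<close>

lemma lobe_divide:
  assumes d: "d > 0" and hol: "\<Phi> holomorphic_on lobe_nhd d" and bd: "\<And>w. w \<in> lobe_nhd d \<Longrightarrow> norm (\<Phi> w) \<le> M"
  obtains \<Psi> where "\<Psi> holomorphic_on lobe_nhd d" "\<And>w. \<Phi> w = \<Phi> 0 + w * \<Psi> w"
    "\<And>w. w \<in> lobe_nhd d \<Longrightarrow> norm (\<Psi> w) \<le> 4 * M / d" "\<Psi> 0 = deriv \<Phi> 0"
proof -
  define \<Psi> where "\<Psi> = (\<lambda>w. if w = 0 then deriv \<Phi> 0 else (\<Phi> w - \<Phi> 0) / (w - 0))"
  have 1: "\<Psi> holomorphic_on lobe_nhd d"
    unfolding \<Psi>_def by (rule pole_lemma_open[OF hol]) simp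
  have 0: "0 \<in> lobe_nhd d" using lobe_subset_nhd[OF d] by auto
  have M: "M \<ge> 0" using bd[OF 0] norm_ge_zero order.trans by blast
  have far: "norm (\<Psi> w) \<le> 4 * M / d" if "w \<in> lobe_nhd d" "norm w \<ge> d / 2" for w
  proof -
    have "norm (\<Phi> w - \<Phi> 0) \<le> M + M"
      using bd[OF 0] bd[OF that(1)] norm_triangle_ineq4[of "\<Phi> w" "\<Phi> 0"] by linarith
    moreover have "w \<noteq> 0" using that d by auto
    ultimately have "norm (\<Psi> w) \<le> (M + M) / (d / 2)"
      unfolding \<Psi>_def if_not_P[OF \<open>w \<noteq> 0\<close>] norm_divide using that d M by (intro frac_le) auto
    then show ?thesis by simp
  qed
  have near: "cball 0 (d/2) \<subseteq> lobe_nhd d"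
  proof -
    have "0 \<in> lobe_nhd (d/2)" using lobe_subset_nhd[of "d/2"] d zero_in_lobe by auto
    from cball_subset_lobe_nhd[OF this, of "d/2"] show ?thesis by simp
  qed
  have "norm (\<Psi> w) \<le> 4 * M / d" if "w \<in> lobe_nhd d" for w
  proof (cases "norm w \<ge> d / 2")
    case False
    show ?thesis
    proof (rule maximum_modulus_frontier[of \<Psi> "cball 0 (d/2)"])
      show "\<Psi> holomorphic_on interior (cball 0 (d/2))"
        by (rule holomorphic_on_subset[OF 1]) (use near in auto)
      show "continuous_on (closure (cball 0 (d/2))) \<Psi>"
        using holomorphic_on_imp_continuous_on[OF 1] near continuous_on_subset by auto
      show "norm (\<Psi> z) \<le> 4 * M / d" if "z \<in> frontier (cball 0 (d/2))" for z
        using that near d by (intro far) auto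
    qed (use False in auto)
  qed (use far that in auto)
  moreover have "\<Phi> w = \<Phi> 0 + w * \<Psi> w" for w
    by (auto simp: \<Psi>_def)
  moreover have "\<Psi> 0 = deriv \<Phi> 0" by (simp add: \<Psi>_def)
  ultimately show ?thesis using 1 by (intro that[of \<Psi>])
qed

text \<open>Two divisions by \<open>w\<close> cost \<open>4 / d\<close> each. The second factor
  combines \<open>norm w \<le> 2 + d\<close> with Cauchy's bound \<open>2 / d\<close> for the
  derivative of the quotient, halved by the chain rule.\<close>

definition step_const :: "real \<Rightarrow> real" where
  "step_const d = (4 / d)\<^sup>2 * (1 + (2 + d) / d)"

lemma step_const_nonneg: "d > 0 \<Longrightarrow> step_const d \<ge> 0"
  by (simp add: step_const_def)

text \<open>Differentiating away the terms of order at most 2 in \<open>w = csqrt (1 - x)\<close> leaves a function of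
  the same kind, so the estimate can be iterated.\<close>

lemma lobe_step:
  assumes d: "d > 0" and hol: "\<Phi> holomorphic_on lobe_nhd d" and bd: "\<And>w. w \<in> lobe_nhd d \<Longrightarrow> norm (\<Phi> w) \<le> M"
  obtains \<Theta> where "\<Theta> holomorphic_on lobe_nhd (d/2)"
    "\<And>w. w \<in> lobe_nhd (d/2) \<Longrightarrow> norm (\<Theta> w) \<le> step_const d * M"
    "\<And>x. norm x < 1 \<Longrightarrow> ((\<lambda>x. \<Phi> (csqrt (1 - x)) - deriv \<Phi> 0 * csqrt (1 - x))
        has_field_derivative \<Theta> (csqrt (1 - x))) (at x)"
proof -
  obtain \<Phi>1 where \<Phi>1: "\<Phi>1 holomorphic_on lobe_nhd d" "\<And>w. \<Phi> w = \<Phi> 0 + w * \<Phi>1 w"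
    "\<And>w. w \<in> lobe_nhd d \<Longrightarrow> norm (\<Phi>1 w) \<le> 4 * M / d" "\<Phi>1 0 = deriv \<Phi> 0"
    by (rule lobe_divide[OF d hol bd]) (assumption | rule that)+
  obtain \<Psi> where \<Psi>: "\<Psi> holomorphic_on lobe_nhd d" "\<And>w. \<Phi>1 w = \<Phi>1 0 + w * \<Psi> w"
    "\<And>w. w \<in> lobe_nhd d \<Longrightarrow> norm (\<Psi> w) \<le> 4 * (4 * M / d) / d"
    by (rule lobe_divide[OF d \<Phi>1(1) \<Phi>1(3)]) (assumption | rule that)+
  define N where "N = (4 / d)\<^sup>2 * M"
  have N: "norm (\<Psi> w) \<le> N" if "w \<in> lobe_nhd d" for w
    using \<Psi>(3)[OF that] d by (simp add: N_def power2_eq_square)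
  have sub: "lobe_nhd (d/2) \<subseteq> lobe_nhd d" using d by (intro lobe_nhd_mono) auto
  \<comment> \<open>Without its linear term, the function is
    \<open>\<Phi> 0 + (1 - x) * \<Psi> w\<close>. In its derivative the factor
    \<open>1 - x = w^2\<close> cancels the pole of \<open>dw/dx = -1 / (2 * w)\<close>, so no
    singularity at \<open>w = 0\<close> remains.\<close>
  define \<Theta> where "\<Theta> = (\<lambda>w. - (\<Psi> w + w * deriv \<Psi> w / 2))"
  show ?thesis
  proof (rule that[of \<Theta>])
    show "\<Theta> holomorphic_on lobe_nhd (d/2)"
      unfolding \<Theta>_def using holomorphic_on_subset[OF \<Psi>(1) sub]
      by (intro holomorphic_intros holomorphic_deriv) auto
    fix w assume w: "w \<in> lobe_nhd (d/2)"
    have sub': "cball w (d/2) \<subseteq> lobe_nhd d" using cball_subset_lobe_nhd[OF w, of "d/2"] by simp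
    have "norm ((deriv ^^ 1) \<Psi> w) \<le> fact 1 * N / (d/2) ^ 1"
    proof (rule Cauchy_inequality)
      show "\<Psi> holomorphic_on ball w (d/2)"
        using \<Psi>(1) by (rule holomorphic_on_subset) (use sub' in auto)
      show "continuous_on (cball w (d/2)) \<Psi>"
        using holomorphic_on_imp_continuous_on[OF \<Psi>(1)] sub' continuous_on_subset by blast
      show "norm (\<Psi> x) \<le> N" if "norm (w - x) = d / 2" for x
        using that sub' by (intro N) (auto simp: dist_norm)
    qed (use d in auto)
    then have D: "norm (deriv \<Psi> w) \<le> 2 * N / d" by (simp add: mult.commute)
    have "norm (\<Theta> w) \<le> norm (\<Psi> w) + norm (w * deriv \<Psi> w / 2)"
      unfolding \<Theta>_def norm_minus_cancel by (rule norm_triangle_ineq)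
    also have "norm (w * deriv \<Psi> w / 2) = norm w * norm (deriv \<Psi> w) / 2"
      by (simp add: norm_mult norm_divide)
    also have "norm w * norm (deriv \<Psi> w) \<le> (2 + d) * (2 * N / d)"
      using norm_lobe_nhd_le[of w d] w sub d D by (intro mult_mono) auto
    also have "norm (\<Psi> w) \<le> N" using N w sub by auto
    also have "N + (2 + d) * (2 * N / d) / 2 = step_const d * M"
      using d by (simp add: N_def step_const_def field_simps)
    finally show "norm (\<Theta> w) \<le> step_const d * M" by simp
  next
    fix x :: complex assume x: "norm x < 1"
    define w where "w = csqrt (1 - x)"
    have nz: "1 - x \<notin> \<real>\<^sub>\<le>\<^sub>0" using one_minus_notin_nonpos[OF x] .
    then have w0: "w \<noteq> 0" by (auto simp: w_def)
    have w: "w \<in> lobe_nhd d" using csqrt_in_lobe[of x] x lobe_subset_nhd[OF d] by (auto simp: w_def)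
    have D: "(\<Psi> has_field_derivative deriv \<Psi> w) (at w)"
      using \<Psi>(1) w by (intro holomorphic_derivI) auto
    have W: "((\<lambda>x. csqrt (1 - x)) has_field_derivative - (inverse (2 * w))) (at x)"
      unfolding w_def using nz by (auto intro!: derivative_eq_intros simp: field_simps)
    have "((\<lambda>x. \<Phi> 0 + (1 - x) * \<Psi> (csqrt (1 - x))) has_field_derivative
            (- 1) * \<Psi> w + (deriv \<Psi> w * (- inverse (2 * w))) * (1 - x)) (at x)"
      by (rule derivative_eq_intros DERIV_chain'[OF W, unfolded w_def[symmetric]] D refl | simp add: w_def)+
    also have "(- 1) * \<Psi> w + (deriv \<Psi> w * (- inverse (2 * w))) * (1 - x) = \<Theta> w"
    proof -
      have "1 - x = w\<^sup>2" by (simp add: w_def)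
      then show ?thesis unfolding \<Theta>_def \<open>1 - x = w\<^sup>2\<close> using w0 by (simp add: field_simps power2_eq_square)
    qed
    also have "(\<lambda>x. \<Phi> 0 + (1 - x) * \<Psi> (csqrt (1 - x))) = (\<lambda>x. \<Phi> (csqrt (1 - x)) - deriv \<Phi> 0 * csqrt (1 - x))"
    proof
      fix x
      have "(1 - x) * \<Psi> (csqrt (1 - x)) = csqrt (1 - x) * (csqrt (1 - x) * \<Psi> (csqrt (1 - x)))"
        by (simp flip: mult.assoc power2_eq_square)
      then show "\<Phi> 0 + (1 - x) * \<Psi> (csqrt (1 - x)) = \<Phi> (csqrt (1 - x)) - deriv \<Phi> 0 * csqrt (1 - x)"
        using \<Phi>1(2)[of "csqrt (1 - x)"] \<Psi>(2)[of "csqrt (1 - x)"] \<Phi>1(4) by (simp add: algebra_simps)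
    qed
    finally show "((\<lambda>x. \<Phi> (csqrt (1 - x)) - deriv \<Phi> 0 * csqrt (1 - x))
        has_field_derivative \<Theta> (csqrt (1 - x))) (at x)" by (simp add: w_def)
  qed
qed

lemma lobe_comp_holomorphic:
  assumes "d > 0" "\<Phi> holomorphic_on lobe_nhd d"
  shows "(\<lambda>x. \<Phi> (csqrt (1 - x))) holomorphic_on ball 0 1"
proof -
  have "(\<Phi> \<circ> (\<lambda>x. csqrt (1 - x))) holomorphic_on ball 0 1"
  proof (rule holomorphic_on_compose_gen[OF _ assms(2)])
    show "(\<lambda>x. csqrt (1 - x)) holomorphic_on ball 0 1"
      by (intro holomorphic_on_csqrt' holomorphic_intros) (use one_minus_notin_nonpos in auto)
    show "(\<lambda>x. csqrt (1 - x)) ` ball 0 1 \<subseteq> lobe_nhd d"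
      using csqrt_in_lobe lobe_subset_nhd[OF assms(1)] by (force simp: less_imp_le)
  qed
  then show ?thesis by (simp add: o_def)
qed

definition csqrt_fps :: "complex fps" where
  "csqrt_fps = fps_expansion (\<lambda>x. csqrt (1 - x)) 0"

lemma csqrt_fps: "(\<lambda>x. csqrt (1 - x)) has_fps_expansion csqrt_fps"
  unfolding csqrt_fps_def
  by (intro analytic_at_imp_has_fps_expansion_0 analytic_intros) auto

text \<open>Coefficient comparison in the differential equation
  \<open>2 * (1 - x) * f' + f = 0\<close> of \<open>f = csqrt (1 - x)\<close>.\<close>

lemma csqrt_fps_Suc: "csqrt_fps $ Suc n = (of_nat n - 1/2) / of_nat (Suc n) * csqrt_fps $ n"
proof -
  have "(\<lambda>x. csqrt (1 - x) * csqrt (1 - x)) has_fps_expansion csqrt_fps * csqrt_fps"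
    by (intro fps_expansion_intros csqrt_fps)
  moreover have "(\<lambda>x. csqrt (1 - x) * csqrt (1 - x)) has_fps_expansion 1 - fps_X"
    by (auto intro!: fps_expansion_intros simp flip: power2_eq_square)
  ultimately have sq: "csqrt_fps * csqrt_fps = 1 - fps_X"
    using fps_expansion_unique_complex by blast
  have nz: "csqrt_fps \<noteq> 0"
  proof
    assume "csqrt_fps = 0"
    then have "(1 - fps_X :: complex fps) $ 0 = 0" using sq by simp
    then show False by simp
  qed
  have "2 * csqrt_fps * fps_deriv csqrt_fps = -1"
    using arg_cong[OF sq, of fps_deriv] by (simp add: algebra_simps)
  then have "csqrt_fps * (2 * (1 - fps_X) * fps_deriv csqrt_fps + csqrt_fps) = 0"
  proof -
    have "csqrt_fps * (2 * (1 - fps_X) * fps_deriv csqrt_fps + csqrt_fps) =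
       (1 - fps_X) * (2 * csqrt_fps * fps_deriv csqrt_fps) + csqrt_fps * csqrt_fps"
      by (simp add: algebra_simps)
    then show ?thesis
      unfolding sq \<open>2 * csqrt_fps * fps_deriv csqrt_fps = -1\<close> by simp
  qed
  then have "2 * (1 - fps_X) * fps_deriv csqrt_fps + csqrt_fps = 0"
    using nz by simp
  then have "(2 * (fps_deriv csqrt_fps - fps_X * fps_deriv csqrt_fps) + csqrt_fps) $ n = 0"
    by (simp add: algebra_simps)
  then have "2 * (of_nat (Suc n) * csqrt_fps $ Suc n - of_nat n * csqrt_fps $ n) + csqrt_fps $ n = 0"
    unfolding fps_add_nth fps_mult_numeral_left fps_sub_nth fps_X_mult_nth by (cases n) auto
  then show ?thesis by (simp add: field_simps del: of_nat_Suc)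
qed

lemma csqrt_fps_0 [simp]: "csqrt_fps $ 0 = 1"
  using fps_nth_fps_expansion[OF csqrt_fps, of 0] by simp

lemma norm_csqrt_fps_Suc:
  "n > 0 \<Longrightarrow> norm (csqrt_fps $ Suc n) = (real n - 1/2) / real (Suc n) * norm (csqrt_fps $ n)"
proof -
  assume "n > 0"
  have "norm (of_nat n - 1/2 :: complex) = norm (of_real (real n - 1/2) :: complex)" by simp
  also have "\<dots> = real n - 1/2" using \<open>n > 0\<close> unfolding norm_of_real by simp
  finally show ?thesis unfolding csqrt_fps_Suc norm_mult norm_divide norm_of_nat by simp
qed

lemma norm_csqrt_fps_le: "n > 0 \<Longrightarrow> norm (csqrt_fps $ n) \<le> 1 / real n"
proof (induction n rule: nat_induct_non_zero)
  case 1
  then show ?case by (simp add: csqrt_fps_Suc)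
next
  case (Suc n)
  have "norm (csqrt_fps $ Suc n) \<le> (real n - 1/2) / real (Suc n) * (1 / real n)"
    unfolding norm_csqrt_fps_Suc[OF Suc(1)] using Suc by (intro mult_left_mono) auto
  also have "\<dots> = (real n - 1/2) / real n * (1 / real (Suc n))" by simp
  also have "\<dots> \<le> 1 * (1 / real (Suc n))" using Suc(1) by (intro mult_right_mono) auto
  also have "\<dots> = 1 / real (Suc n)" by simp
  finally show ?case .
qed

text \<open>The left-hand side is nondecreasing in \<open>n\<close>, because
  \<open>(n - 1/2)^2 \<ge> n * (n - 1)\<close>, and it equals 1/16 at \<open>n = 2\<close>. This
  gives the lower bound of order \<open>n\<close> to the power -3/2 without Stirling's
  formula.\<close>

lemma norm_csqrt_fps_ge: "n \<ge> 2 \<Longrightarrow> norm (csqrt_fps $ n) ^ 2 * (real n ^ 2 * (real n - 1)) \<ge> 1 / 16"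
proof (induction n rule: dec_induct)
  case base
  have "norm (csqrt_fps $ 2) = 1/8" 
    using norm_csqrt_fps_Suc[of 1] by (simp add: csqrt_fps_Suc numeral_2_eq_2)
  then show ?case by (simp only:) (simp add: power2_eq_square)
next
  case (step n)
  define y where "y = norm (csqrt_fps $ n) ^ 2"
  have "norm (csqrt_fps $ Suc n) ^ 2 * (real (Suc n) ^ 2 * (real (Suc n) - 1)) = (real n - 1/2)\<^sup>2 * real n * y"
    using step(1) unfolding y_def
    by (subst norm_csqrt_fps_Suc) (auto simp: power_mult_distrib power_divide)
  also have "\<dots> \<ge> (real n * (real n - 1)) * real n * y"
    by (intro mult_right_mono) (auto simp: y_def power2_eq_square algebra_simps)
  also have "(real n * (real n - 1)) * real n * y = y * (real n ^ 2 * (real n - 1))"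
    by (simp add: power2_eq_square)
  finally show ?case using step by (simp add: y_def)
qed

text \<open>One differentiation gains a factor \<open>1 / n\<close> over the Cauchy bound. The
  removed linear term contributes at most \<open>4 * M / d\<close> times
  \<open>1 / n\<close>.\<close>

lemma lobe_coeff_first:
  fixes F :: "complex fps"
  assumes d: "d > 0" and hol: "\<Phi> holomorphic_on lobe_nhd d" and bd: "\<And>w. w \<in> lobe_nhd d \<Longrightarrow> norm (\<Phi> w) \<le> M"
    and F: "(\<lambda>x. \<Phi> (csqrt (1 - x))) has_fps_expansion F" and n: "n > 0"
  shows "norm (F $ n) \<le> (step_const d + 4 / d) * M / real n"
proof -
  obtain \<Theta> where \<Theta>: "\<Theta> holomorphic_on lobe_nhd (d/2)"
    "\<And>w. w \<in> lobe_nhd (d/2) \<Longrightarrow> norm (\<Theta> w) \<le> step_const d * M"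
    "\<And>x. norm x < 1 \<Longrightarrow> ((\<lambda>x. \<Phi> (csqrt (1 - x)) - deriv \<Phi> 0 * csqrt (1 - x))
        has_field_derivative \<Theta> (csqrt (1 - x))) (at x)"
    using lobe_step[OF d hol bd] by metis
  let ?E = "\<lambda>x. \<Phi> (csqrt (1 - x)) - deriv \<Phi> 0 * csqrt (1 - x)"
  let ?G = "F - fps_const (deriv \<Phi> 0) * csqrt_fps"
  obtain m where m: "n = Suc m" using n by (cases n) auto
  have "deriv ?E has_fps_expansion fps_deriv ?G"
    by (intro fps_expansion_intros F csqrt_fps)
  moreover have "deriv ?E x = \<Theta> (csqrt (1 - x))" if "x \<in> ball 0 1" for x
    using \<Theta>(3)[of x] that by (intro DERIV_imp_deriv) auto
  ultimately have exp: "(\<lambda>x. \<Theta> (csqrt (1 - x))) has_fps_expansion fps_deriv ?G"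
    by (subst has_fps_expansion_cong[OF _ refl, of _ "deriv ?E"])
       (auto intro!: eventually_mono[OF eventually_nhds_in_open[of "ball 0 1"]])
  have "norm (fps_deriv ?G $ m) \<le> step_const d * M"
    using d by (intro fps_nth_norm_le[OF exp lobe_comp_holomorphic[OF _ \<Theta>(1)]])
       (auto intro!: \<Theta>(2) csqrt_in_lobe lobe_subset_nhd[THEN subsetD])
  moreover have "fps_deriv ?G $ m = of_nat n * (F $ n - deriv \<Phi> 0 * csqrt_fps $ n)"
    by (simp add: m algebra_simps)
  ultimately have 1: "norm (F $ n - deriv \<Phi> 0 * csqrt_fps $ n) \<le> step_const d * M / real n"
    using n by (simp add: norm_mult pos_le_divide_eq mult.commute del: fps_deriv_nth fps_sub_nth)
  obtain \<Psi> where \<Psi>: "\<And>w. w \<in> lobe_nhd d \<Longrightarrow> norm (\<Psi> w) \<le> 4 * M / d" "\<Psi> 0 = deriv \<Phi> 0"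
    by (rule lobe_divide[OF d hol bd]) (assumption | rule that)+
  have "norm (deriv \<Phi> 0) \<le> 4 * M / d"
    using \<Psi>(1)[of 0] \<Psi>(2) lobe_subset_nhd[OF d] zero_in_lobe by force
  then have "norm (deriv \<Phi> 0 * csqrt_fps $ n) \<le> 4 * M / d * (1 / real n)"
    unfolding norm_mult using norm_csqrt_fps_le[OF n] by (intro mult_mono) (auto intro: order.trans[OF norm_ge_zero])
  with 1 have "norm (F $ n) \<le> step_const d * M / real n + 4 * M / d * (1 / real n)"
    using norm_triangle_ineq[of "F $ n - deriv \<Phi> 0 * csqrt_fps $ n" "deriv \<Phi> 0 * csqrt_fps $ n"] by simp
  then show ?thesis by (simp add: algebra_simps add_divide_distrib)
qed

text \<open>The derivative of the remainder is again a bounded function of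
  \<open>csqrt (1 - x)\<close>, on the neighbourhood of width \<open>d/2\<close>. The first-order
  bound applies to it and yields a second factor \<open>1 / n\<close>, enough to beat the
  coefficients of the square root.\<close>

lemma lobe_coeff:
  fixes F :: "complex fps"
  assumes d: "d > 0" and hol: "\<Phi> holomorphic_on lobe_nhd d" and bd: "\<And>w. w \<in> lobe_nhd d \<Longrightarrow> norm (\<Phi> w) \<le> M"
    and F: "(\<lambda>x. \<Phi> (csqrt (1 - x))) has_fps_expansion F" and n: "n \<ge> 2"
  shows "norm (F $ n - deriv \<Phi> 0 * csqrt_fps $ n) \<le>
    2 * (step_const (d/2) + 8 / d) * step_const d * M / real n ^ 2"
proof -
  obtain \<Theta> where \<Theta>: "\<Theta> holomorphic_on lobe_nhd (d/2)"
    "\<And>w. w \<in> lobe_nhd (d/2) \<Longrightarrow> norm (\<Theta> w) \<le> step_const d * M"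
    "\<And>x. norm x < 1 \<Longrightarrow> ((\<lambda>x. \<Phi> (csqrt (1 - x)) - deriv \<Phi> 0 * csqrt (1 - x))
        has_field_derivative \<Theta> (csqrt (1 - x))) (at x)"
    using lobe_step[OF d hol bd] by metis
  let ?E = "\<lambda>x. \<Phi> (csqrt (1 - x)) - deriv \<Phi> 0 * csqrt (1 - x)"
  let ?G = "F - fps_const (deriv \<Phi> 0) * csqrt_fps"
  obtain m where m: "n = Suc m" "m > 0" using n by (cases n) auto
  have "deriv ?E has_fps_expansion fps_deriv ?G"
    by (intro fps_expansion_intros F csqrt_fps)
  moreover have "deriv ?E x = \<Theta> (csqrt (1 - x))" if "x \<in> ball 0 1" for x
    using \<Theta>(3)[of x] that by (intro DERIV_imp_deriv) auto
  ultimately have exp: "(\<lambda>x. \<Theta> (csqrt (1 - x))) has_fps_expansion fps_deriv ?G"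
    by (subst has_fps_expansion_cong[OF _ refl, of _ "deriv ?E"])
       (auto intro!: eventually_mono[OF eventually_nhds_in_open[of "ball 0 1"]])
  define K where "K = (step_const (d/2) + 8 / d) * (step_const d * M)"
  have "norm (fps_deriv ?G $ m) \<le> K / real m"
    using lobe_coeff_first[OF _ \<Theta>(1,2) exp m(2)] d by (simp add: K_def)
  moreover have "fps_deriv ?G $ m = of_nat n * (F $ n - deriv \<Phi> 0 * csqrt_fps $ n)"
    by (simp add: m algebra_simps)
  ultimately have 1: "norm (F $ n - deriv \<Phi> 0 * csqrt_fps $ n) * real n \<le> K / real m"
    by (simp add: norm_mult mult.commute)
  have "0 \<le> K / real m" using 1 by (rule order.trans[rotated]) auto
  then have K: "K \<ge> 0" using m by (simp add: zero_le_divide_iff)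
  have "norm (F $ n - deriv \<Phi> 0 * csqrt_fps $ n) \<le> K / real m / real n"
    using 1 m by (simp add: field_simps del: of_nat_Suc)
  also have "\<dots> \<le> K * (2 / real n) / real n"
  proof (intro divide_right_mono)
    have "1 / real m \<le> 2 / real n" using m by (simp add: divide_simps)
    from mult_left_mono[OF this K] show "K / real m \<le> K * (2 / real n)" by simp
  qed simp
  finally show ?thesis by (simp add: K_def power2_eq_square mult_ac)
qed

section \<open>The radicands\<close>

text \<open>The radicand \<open>R\<^sub>i\<^sub>,\<^sub>k\<close>, with \<open>R\<^sub>0\<^sub>,\<^sub>k = 1\<close>; the index \<open>i\<close> belongs to De Bruijn level \<open>k + 1 - i\<close>.\<close>

fun rad :: "nat \<Rightarrow> nat \<Rightarrow> complex \<Rightarrow> complex \<Rightarrow> complex" where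
  "rad k 0 z u = 1"
| "rad k (Suc i) z u = 1 - 4 * of_nat (k - i) * z\<^sup>2 * u - 2 * z + 2 * z * csqrt (rad k i z u)"

text \<open>In HOL \<open>sqrt\<close> is an odd function, so this follows the complex recursion
  only while the preceding radicands are nonnegative. Where it matters, this is proved
  first.\<close>

fun rrad :: "nat \<Rightarrow> nat \<Rightarrow> real \<Rightarrow> real \<Rightarrow> real" where
  "rrad k 0 x y = 1"
| "rrad k (Suc i) x y = 1 - 4 * of_nat (k - i) * x\<^sup>2 * y - 2 * x + 2 * x * sqrt (rrad k i x y)"

text \<open>Within its disc of convergence this is the branch of the square root of \<open>rad k i z u\<close> with value 1
  at 0.\<close>

definition sig :: "nat \<Rightarrow> nat \<Rightarrow> 'a \<Rightarrow> 'a \<Rightarrow> 'a :: {real_normed_field, banach}" where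
  "sig k i u z = 1 - 2 * z * (\<Sum>n. term_poly k (Suc k - i) n u * z ^ n)"

lemma sig_0 [simp]: "sig k 0 u z = 1"
  by (simp add: sig_def)

text \<open>Proved for values by a Cauchy product, and not read off from \<open>sq_Suc\<close>,
  because it is also needed on the boundary circle.\<close>

lemma sig_Suc:
  fixes u z :: "'a :: {real_normed_field, banach}"
  assumes i: "i \<le> k"
    and s1: "summable (\<lambda>n. norm (term_poly k (Suc k - i) n u * z ^ n))"
    and s2: "summable (\<lambda>n. norm (term_poly k (k - i) n u * z ^ n))"
  shows "sig k (Suc i) u z ^ 2 = 1 - 4 * of_nat (k - i) * z\<^sup>2 * u - 2 * z + 2 * z * sig k i u z"
proof -
  define a where "a = (\<lambda>n. term_poly k (Suc k - i) n u * z ^ n)"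
  define b where "b = (\<lambda>n. term_poly k (k - i) n u * z ^ n)"
  have Sk: "Suc (k - i) = Suc k - i" using i by simp
  have "(\<lambda>n. (if n = 0 then of_nat (k - i) * u else 0) + a n + (\<Sum>m\<le>n. b m * b (n - m))) sums
        (of_nat (k - i) * u + suminf a + suminf b * suminf b)"
    using s1 s2
    by (intro sums_add Cauchy_product_sums summable_sums summable_norm_cancel[of a])
       (use sums_single[of 0 "\<lambda>_. of_nat (k - i) * u"] in \<open>auto simp: eq_commute[of 0] a_def b_def\<close>)
  from sums_mult[OF this, of z]
  have "(\<lambda>n. z * ((if n = 0 then of_nat (k - i) * u else 0) + a n + (\<Sum>m\<le>n. b m * b (n - m)))) sums
        (z * (of_nat (k - i) * u + suminf a + suminf b * suminf b))" .
  also have "(\<lambda>n. z * ((if n = 0 then of_nat (k - i) * u else 0) + a n + (\<Sum>m\<le>n. b m * b (n - m)))) = (\<lambda>n. b (Suc n))"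
  proof
    fix n
    have "(\<Sum>m\<le>n. b m * b (n - m)) = z ^ n * (\<Sum>m\<le>n. term_poly k (k - i) m u * term_poly k (k - i) (n - m) u)"
      unfolding sum_distrib_left b_def
      by (intro sum.cong) (auto simp: mult_ac simp flip: power_add)
    then show "z * ((if n = 0 then of_nat (k - i) * u else 0) + a n + (\<Sum>m\<le>n. b m * b (n - m))) = b (Suc n)"
      by (simp add: b_def a_def term_poly_Suc Sk algebra_simps)
  qed
  finally have "b sums (z * (of_nat (k - i) * u + suminf a + suminf b * suminf b) + b 0)"
    by (rule sums_Suc)
  then have G: "suminf b = z * (of_nat (k - i) * u + suminf a + suminf b * suminf b)"
    by (simp add: sums_iff b_def)
  have "sig k (Suc i) u z ^ 2 = 1 - 4 * z * (suminf b - z * suminf b * suminf b)"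
    unfolding sig_def diff_Suc_Suc b_def[symmetric] by (simp add: power2_eq_square algebra_simps)
  also have "suminf b - z * suminf b * suminf b = z * (of_nat (k - i) * u + suminf a)"
    by (subst (1) G) (simp add: algebra_simps)
  finally have "sig k (Suc i) u z ^ 2 = 1 - 4 * z * (z * (of_nat (k - i) * u + suminf a))" .
  then show ?thesis
    unfolding sig_def[of k i] a_def[symmetric] by (simp add: power2_eq_square algebra_simps)
qed

section \<open>Positive real \<open>u\<close>: the closed disc of convergence\<close>

locale positive_radius =
  fixes k :: nat and u r :: real
  assumes u_pos: "u > 0" and r_pos: "r > 0"
    and conv: "fps_conv_radius (sq k (Suc k) (of_real u)) = ereal r"
begin

definition p :: "nat \<Rightarrow> nat \<Rightarrow> real" where
  "p i n = term_poly k (Suc k - i) n u"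

lemma p_nonneg: "p i n \<ge> 0"
  using u_pos by (auto simp: p_def intro!: term_poly_nonneg)

lemma p_0 [simp]: "p 0 n = 0"
  by (simp add: p_def)

lemma sig_eq: "sig k i u x = 1 - 2 * x * (\<Sum>n. p i n * x ^ n)"
  by (simp add: sig_def p_def)

text \<open>Only the outermost series has a known radius. Downward induction on \<open>i\<close>
  compares each coefficient with the next one of the enclosing level.\<close>

lemma summable_lt:
  assumes "i \<le> Suc k" "0 \<le> x" "x < r"
  shows "summable (\<lambda>n. p i n * x ^ n)"
proof (cases "x = 0")
  case True
  then show ?thesis by (auto intro!: summable_finite[of "{0}"])
next
  case False
  with assms have x: "x > 0" by simp
  show ?thesis using assms(1)
  proof (induction i rule: inc_induct)
    case base
    have "summable (\<lambda>n. sq k (Suc k) (of_real u) $ n * of_real x ^ n)"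
      using assms by (intro summable_fps) (simp add: conv)
    then have "summable (\<lambda>n. sq k (Suc k) (of_real u) $ Suc n * of_real x ^ Suc n)"
      by (subst summable_Suc_iff)
    also have "(\<lambda>n. sq k (Suc k) (of_real u) $ Suc n * of_real x ^ Suc n) =
        (\<lambda>n. of_real ((- 2 * x) * (p (Suc k) n * x ^ n)))"
      by (auto simp: sq_nth p_def simp flip: of_real_term_poly)
    finally have "summable (\<lambda>n. (- 2 * x) * (p (Suc k) n * x ^ n))"
      by (subst (asm) summable_of_real_iff)
    then show ?case using x by (subst (asm) summable_cmult_iff) auto
  next
    case (step i)
    have Sk: "Suc (k - i) = Suc k - i" using step by simp
    have "summable (\<lambda>n. p (Suc i) (Suc n) * x ^ Suc n)"
      using step(3) by (subst summable_Suc_iff)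
    then have "summable (\<lambda>n. p (Suc i) (Suc n) * x ^ Suc n * inverse x)"
      by (rule summable_mult2)
    then show ?case
    proof (rule summable_comparison_test'[where N = 0])
      fix n
      have "p i n \<le> p (Suc i) (Suc n)"
        using term_poly_le_Suc[of "k - i" k u n] u_pos by (simp add: p_def Sk)
      then have "p i n * x ^ n \<le> p (Suc i) (Suc n) * x ^ n" using x by (intro mult_right_mono) auto
      also have "\<dots> = p (Suc i) (Suc n) * x ^ Suc n * inverse x" using x by simp
      finally show "norm (p i n * x ^ n) \<le> p (Suc i) (Suc n) * x ^ Suc n * inverse x"
        using x p_nonneg[of i n] by simp
    qed
  qed
qed

lemma sig_Suc_real:
  assumes "i \<le> k" "summable (\<lambda>n. p i n * x ^ n)" "summable (\<lambda>n. p (Suc i) n * x ^ n)" "0 \<le> x"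
  shows "sig k (Suc i) u x ^ 2 = 1 - 4 * of_nat (k - i) * x\<^sup>2 * u - 2 * x + 2 * x * sig k i u x"
proof (rule sig_Suc[OF assms(1)])
  have *: "norm (p i n * x ^ n) = p i n * x ^ n" for i n
    using p_nonneg[of i n] assms(4) by simp
  show "summable (\<lambda>n. norm (term_poly k (Suc k - i) n u * x ^ n))"
    "summable (\<lambda>n. norm (term_poly k (k - i) n u * x ^ n))"
    using *[of i] *[of "Suc i"] assms(2,3) unfolding p_def diff_Suc_Suc by simp_all
qed

text \<open>If the decreasing function \<open>sig\<close> were negative at \<open>x\<close>, its square would increase afterwards,
  whereas the radicand is nonincreasing.\<close>

lemma sig_nonneg_lt:
  assumes i: "i \<le> Suc k" and x: "0 \<le> x" "x < r"
  shows "sig k i u x \<ge> 0"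
proof (rule ccontr)
  assume neg: "\<not> sig k i u x \<ge> 0"
  then obtain j where j: "i = Suc j" "j \<le> k" using i by (cases i) auto
  define g where "g = (\<lambda>i x. \<Sum>n. p i n * x ^ n)"
  have s: "sig k i u x = 1 - 2 * x * g i x" for i x by (simp add: g_def sig_eq)
  define y where "y = (x + r) / 2"
  have y: "x < y" "y < r" using x by (auto simp: y_def)
  have mono: "g i x \<le> g i y" if "i \<le> Suc k" for i
    unfolding g_def using that x y
    by (intro suminf_le summable_lt mult_left_mono power_mono p_nonneg) auto
  have g0: "g i x \<ge> 0" if "i \<le> Suc k" for i
    unfolding g_def using that x p_nonneg by (intro suminf_nonneg summable_lt) auto
  have x0: "x > 0" using x neg by (cases "x = 0") (auto simp: s)
  have gpos: "g i x > 0" using neg g0[OF i] by (cases "g i x = 0") (auto simp: s)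
  have "x * g i x < y * g i y"
    using y gpos mono[OF i] x0 by (intro mult_less_le_imp_less) auto
  then have "sig k i u y < sig k i u x" by (simp add: s)
  with neg have "sig k i u x ^ 2 < sig k i u y ^ 2"
    using power_strict_mono[of "- sig k i u x" "- sig k i u y" 2] by simp
  moreover have "sig k i u y ^ 2 \<le> sig k i u x ^ 2"
  proof -
    have R: "sig k i u z ^ 2 = 1 - 4 * z\<^sup>2 * (of_nat (k - j) * u + g j z)" if "0 \<le> z" "z < r" for z
      unfolding j(1)
    proof (subst sig_Suc_real)
      show "summable (\<lambda>n. p j n * z ^ n)" "summable (\<lambda>n. p (Suc j) n * z ^ n)"
        using that j by (auto intro!: summable_lt)
    qed (use that j in \<open>auto simp: s power2_eq_square algebra_simps\<close>)
    have "x\<^sup>2 * (of_nat (k - j) * u + g j x) \<le> y\<^sup>2 * (of_nat (k - j) * u + g j y)"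
      using x y mono[of j] g0[of j] j u_pos by (intro mult_mono power_mono add_left_mono add_nonneg_nonneg) auto
    then show ?thesis using x y by (subst (1 2) R) auto
  qed
  ultimately show False by simp
qed

text \<open>Nonnegativity of \<open>sig\<close> inside the disc bounds all partial sums, and a
  finite sum passes to the limit \<open>r\<close>. Thus all series converge at the radius
  itself.\<close>

lemma partial_sum_le:
  assumes i: "i \<le> Suc k"
  shows "2 * r * (\<Sum>n<N. p i n * r ^ n) \<le> 1"
proof -
  have *: "2 * x * (\<Sum>n<N. p i n * x ^ n) \<le> 1" if x: "0 < x" "x < r" for x
  proof -
    have "(\<Sum>n<N. p i n * x ^ n) \<le> (\<Sum>n. p i n * x ^ n)"
      using i x p_nonneg by (intro sum_le_suminf summable_lt) auto
    then have "2 * x * (\<Sum>n<N. p i n * x ^ n) \<le> 2 * x * (\<Sum>n. p i n * x ^ n)"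
      using x by (intro mult_left_mono) auto
    also have "\<dots> \<le> 1" using sig_nonneg_lt[OF i, of x] x by (simp add: sig_eq)
    finally show ?thesis .
  qed
  have "((\<lambda>x. 2 * x * (\<Sum>n<N. p i n * x ^ n)) \<longlongrightarrow> 2 * r * (\<Sum>n<N. p i n * r ^ n)) (at_left r)"
    by (intro tendsto_intros)
  moreover have "eventually (\<lambda>x. x \<in> {0<..<r}) (at_left r)"
    by (rule eventually_at_leftI[of 0]) (use r_pos in auto)
  then have "eventually (\<lambda>x. 2 * x * (\<Sum>n<N. p i n * x ^ n) \<le> 1) (at_left r)"
    by eventually_elim (use * in auto)
  ultimately show ?thesis
    by (rule tendsto_upperbound) simp
qed

lemma summable_r: "i \<le> Suc k \<Longrightarrow> summable (\<lambda>n. p i n * r ^ n)"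
  using partial_sum_le[of i] r_pos p_nonneg
  by (intro summableI_nonneg_bounded[of _ "1 / (2 * r)"]) (auto simp: field_simps)

lemma sig_nonneg_r: "i \<le> Suc k \<Longrightarrow> sig k i u r \<ge> 0"
proof -
  assume i: "i \<le> Suc k"
  have "(\<Sum>n. p i n * r ^ n) \<le> 1 / (2 * r)"
    using partial_sum_le[OF i] r_pos by (intro suminf_le_const summable_r i) (auto simp: field_simps)
  then show ?thesis using r_pos by (simp add: sig_eq field_simps)
qed

lemma sig_le_1: "i \<le> Suc k \<Longrightarrow> sig k i u r \<le> 1"
  using r_pos p_nonneg by (auto simp: sig_eq intro!: mult_nonneg_nonneg suminf_nonneg summable_r)

lemma sqrt_rrad: "i \<le> Suc k \<Longrightarrow> sqrt (rrad k i r u) = sig k i u r"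
proof (induction i)
  case (Suc i)
  have "rrad k (Suc i) r u = sig k (Suc i) u r ^ 2"
    using Suc r_pos by (subst sig_Suc_real) (auto intro!: summable_r)
  then show ?case using sig_nonneg_r[OF Suc.prems] by simp
qed simp

lemma rrad_eq: "i \<le> Suc k \<Longrightarrow> rrad k i r u = sig k i u r ^ 2"
proof (cases i)
  case (Suc j)
  assume "i \<le> Suc k"
  with Suc show ?thesis using r_pos by (auto simp: sqrt_rrad sig_Suc_real summable_r)
qed simp

lemma rrad_nonneg: "i \<le> Suc k \<Longrightarrow> rrad k i r u \<ge> 0"
  by (simp add: rrad_eq)

lemma norm_p: "norm (term_poly k (Suc k - i) n (complex_of_real u) * z ^ n) = p i n * norm z ^ n"
  using p_nonneg[of i n] by (simp add: norm_mult norm_power p_def flip: of_real_term_poly)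

lemma summable_disc:
  assumes "i \<le> Suc k" "norm z \<le> r"
  shows "summable (\<lambda>n. norm (term_poly k (Suc k - i) n (complex_of_real u) * z ^ n))"
  using assms p_nonneg r_pos unfolding norm_p
  by (intro summable_comparison_test'[OF summable_r[OF assms(1)], of 0])
     (auto simp: abs_mult intro!: mult_left_mono power_mono)

text \<open>All coefficients of \<open>1 - sig\<close> are nonnegative, so its modulus is largest at
  the positive point \<open>r\<close>.\<close>

lemma norm_one_minus_sig:
  fixes z :: complex
  assumes "i \<le> Suc k" "norm z \<le> r"
  shows "norm (1 - sig k i (of_real u) z) \<le> 1 - sig k i u r"
proof -
  have "norm (\<Sum>n. term_poly k (Suc k - i) n (complex_of_real u) * z ^ n) \<le> (\<Sum>n. p i n * r ^ n)"
  proof (rule order.trans[OF summable_norm[OF summable_disc[OF assms]]])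
    show "(\<Sum>n. norm (term_poly k (Suc k - i) n (complex_of_real u) * z ^ n)) \<le> (\<Sum>n. p i n * r ^ n)"
      using assms p_nonneg
      by (intro suminf_le summable_disc summable_r) (auto simp: norm_p intro!: mult_left_mono power_mono)
  qed
  then show ?thesis
    using assms r_pos unfolding sig_def[of k i "of_real u"] sig_eq by (auto simp: norm_mult intro!: mult_mono)
qed

lemma sig_Suc_complex:
  assumes "i \<le> k" "norm z \<le> r"
  shows "sig k (Suc i) (complex_of_real u) z ^ 2 =
    1 - 4 * of_nat (k - i) * z\<^sup>2 * of_real u - 2 * z + 2 * z * sig k i (of_real u) z"
  using summable_disc[of i z] summable_disc[of "Suc i" z] assms by (intro sig_Suc) auto

text \<open>The closed disc of radius 1 around 1 meets the closed left half-plane only in 0. Hence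
  \<open>sig\<close> is the principal root of its square on the whole closed disc.\<close>

lemma Re_sig: 
  assumes "i \<le> Suc k" "norm z \<le> r"
  shows "Re (sig k i (of_real u) z) > 0 \<or> sig k i (complex_of_real u) z = 0"
proof -
  define s where "s = sig k i (complex_of_real u) z"
  have "norm (1 - s) \<le> 1"
    using norm_one_minus_sig[OF assms] sig_nonneg_r[OF assms(1)] by (simp add: s_def)
  then have "(1 - Re s)\<^sup>2 + (Im s)\<^sup>2 \<le> 1" by (simp add: cmod_def power2_eq_square)
  then have "2 * Re s \<ge> (Re s)\<^sup>2 + (Im s)\<^sup>2" by (simp add: power2_eq_square algebra_simps)
  then have "Re s > 0 \<or> s = 0"
    by (smt (verit) complex_eq_iff sum_power2_gt_zero_iff zero_complex.sel)
  then show ?thesis by (simp add: s_def)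
qed

lemma csqrt_rad:
  assumes "i \<le> Suc k" "norm z \<le> r"
  shows "csqrt (rad k i z (of_real u)) = sig k i (of_real u) z"
  using assms(1)
proof (induction i)
  case (Suc i)
  have "rad k (Suc i) z (of_real u) = sig k (Suc i) (of_real u) z ^ 2"
    using Suc assms by (subst sig_Suc_complex) auto
  then show ?case using Re_sig[OF Suc.prems assms(2)] by (auto intro!: csqrt_unique)
qed simp

lemma rad_eq:
  assumes "i \<le> Suc k" "norm z \<le> r"
  shows "rad k i z (of_real u) = sig k i (of_real u) z ^ 2"
  using csqrt_rad[OF assms] power2_csqrt by metis

text \<open>The positivity argument again, now for the radicand itself, whose real part must be
  controlled later.\<close>

lemma norm_one_minus_rad:
  assumes "i \<le> Suc k" "norm z \<le> r"
  shows "norm (1 - rad k i z (of_real u)) \<le> 1 - rrad k i r u"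
proof (cases i)
  case (Suc j)
  have "1 - rad k i z (of_real u) = 4 * of_nat (k - j) * z\<^sup>2 * of_real u + 2 * z * (1 - sig k j (of_real u) z)"
    using Suc assms by (simp add: csqrt_rad algebra_simps)
  also have "norm \<dots> \<le> norm (4 * of_nat (k - j) * z\<^sup>2 * of_real u) + norm (2 * z * (1 - sig k j (of_real u) z))"
    by (rule norm_triangle_ineq)
  also have "\<dots> \<le> 4 * of_nat (k - j) * r\<^sup>2 * u + 2 * r * (1 - sig k j u r)"
  proof (rule add_mono)
    show "norm (4 * of_nat (k - j) * z\<^sup>2 * of_real u) \<le> 4 * of_nat (k - j) * r\<^sup>2 * u"
      using assms u_pos by (auto simp: norm_mult norm_power intro!: mult_mono power_mono)
    show "norm (2 * z * (1 - sig k j (of_real u) z)) \<le> 2 * r * (1 - sig k j u r)"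
      using assms Suc norm_one_minus_sig[of j z] r_pos by (auto simp: norm_mult intro!: mult_mono)
  qed
  also have "\<dots> = 1 - rrad k i r u"
    using Suc assms by (simp add: sqrt_rrad algebra_simps)
  finally show ?thesis .
qed simp

end

lemma analytic_on_rad:
  assumes "\<And>j. j < i \<Longrightarrow> rad k j (f x) (g x) \<notin> \<real>\<^sub>\<le>\<^sub>0" "f analytic_on {x}" "g analytic_on {x}"
  shows "(\<lambda>x. rad k i (f x) (g x)) analytic_on {x}"
  using assms(1)
proof (induction i)
  case (Suc i)
  then show ?case unfolding rad.simps using assms(2,3) by (intro analytic_intros) auto
qed auto

lemma analytic_on_cball_imp_holomorphic_on_ball:
  assumes "f analytic_on cball (a :: complex) r" "r \<ge> 0"
  obtains R where "R > r" "f holomorphic_on ball a R"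
proof -
  obtain S where S: "open S" "cball a r \<subseteq> S" "f holomorphic_on S"
    using assms(1) analytic_on_holomorphic by auto
  obtain d where d: "d > 0" "(\<Union>x\<in>cball a r. ball x d) \<subseteq> S"
    using compact_subset_open_imp_ball_epsilon_subset[OF compact_cball S(1,2)] by auto
  have "ball a (r + d) \<subseteq> S"
  proof
    fix x assume x: "x \<in> ball a (r + d)"
    show "x \<in> S"
    proof (cases "dist a x \<le> r")
      case False
      define y where "y = a + of_real (r / dist a x) * (x - a)"
      have "x \<noteq> a" using False assms(2) by auto
      have "norm (y - a) = r" using assms(2) \<open>x \<noteq> a\<close> by (simp add: y_def norm_mult norm_divide dist_norm norm_minus_commute)
      have "x - y = of_real (1 - r / dist a x) * (x - a)" by (simp add: y_def algebra_simps)
      then have "norm (x - y) = \<bar>1 - r / dist a x\<bar> * norm (x - a)" by (simp only: norm_mult norm_of_real)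
      also have "\<dots> = (1 - r / dist a x) * norm (x - a)"
      proof -
        have "r / dist a x \<le> 1" using False assms(2) by (simp add: divide_le_eq_1)
        then show ?thesis by simp
      qed
      also have "\<dots> = dist a x - r" using \<open>x \<noteq> a\<close> by (simp add: left_diff_distrib dist_norm norm_minus_commute)
      also have "\<dots> < d" using x by simp
      finally have "x \<in> ball y d" by (simp add: dist_norm norm_minus_commute)
      moreover have "y \<in> cball a r" using \<open>norm (y - a) = r\<close> by (simp add: dist_norm norm_minus_commute)
      ultimately show ?thesis using d(2) by blast
    qed (use S in auto)
  qed
  then show ?thesis using d S(3) by (intro that[of "r + d"]) (auto intro: holomorphic_on_subset)
qed

context positive_radius
begin

lemma sq_eval:
  assumes "norm z < r" 
  shows "eval_fps (sq k (Suc k) (of_real u)) z = sig k (Suc k) (of_real u) z"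
proof -
  have "(\<lambda>n. sq k (Suc k) (of_real u) $ Suc n * z ^ Suc n) sums (sig k (Suc k) (of_real u) z - 1)"
  proof -
    have "(\<lambda>n. term_poly k (Suc k - Suc k) n (complex_of_real u) * z ^ n) sums
       (\<Sum>n. term_poly k (Suc k - Suc k) n (complex_of_real u) * z ^ n)"
      by (rule summable_sums, rule summable_norm_cancel, rule summable_disc) (use assms in simp_all)
    from sums_mult[OF this, of "- 2 * z"] show ?thesis by (simp add: sig_def sq_nth mult_ac)
  qed
  from sums_Suc[OF this] show ?thesis by (simp add: eval_fps_def sums_iff sq_nth)
qed

lemma rad_notin_nonpos:
  assumes "i \<le> Suc k" "norm z \<le> r" "sig k i (complex_of_real u) z \<noteq> 0"
  shows "rad k i z (of_real u) \<notin> \<real>\<^sub>\<le>\<^sub>0"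
proof -
  have "Re (csqrt (rad k i z (of_real u))) > 0"
    using Re_sig[OF assms(1,2)] assms csqrt_rad by auto
  then show ?thesis by (metis Re_csqrt csqrt_of_real_nonpos complex_nonpos_Reals_iff less_irrefl Re_i_times Im_complex_of_real neg_0_equal_iff_equal)
qed

lemma sig_disc_nonzero:
  assumes "i \<le> Suc k" "norm z \<le> r" "sig k i u r \<noteq> 0"
  shows "sig k i (complex_of_real u) z \<noteq> 0"
  using norm_one_minus_sig[OF assms(1,2)] sig_nonneg_r[OF assms(1)] assms(3) by auto

text \<open>If all radicands were nonzero at \<open>r\<close>, they would avoid the branch cut on
  the closed disc. The outermost root would then be analytic there, hence on a larger disc, against
  the choice of \<open>r\<close>.\<close>

lemma exists_zero: "\<exists>i. 1 \<le> i \<and> i \<le> Suc k \<and> rrad k i r u = 0"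
proof (rule ccontr)
  assume *: "\<not> ?thesis"
  then have nz: "sig k i u r \<noteq> 0" if "i \<le> Suc k" for i
    using that rrad_eq[OF that] by (cases i) auto
  have "(\<lambda>z. csqrt (rad k (Suc k) z (of_real u))) analytic_on {z}" if "z \<in> cball 0 r" for z
  proof -
    have "rad k i z (of_real u) \<notin> \<real>\<^sub>\<le>\<^sub>0" if "i \<le> Suc k" for i
      using that \<open>z \<in> cball 0 r\<close> rad_notin_nonpos[of i z] sig_disc_nonzero[of i z] nz by simp
    then show ?thesis
      by (intro analytic_on_csqrt' analytic_on_rad analytic_intros) (auto simp del: rad.simps)
  qed
  then have "(\<lambda>z. csqrt (rad k (Suc k) z (of_real u))) analytic_on cball 0 r"
    by (subst analytic_on_analytic_at) blast
  then obtain R where R: "R > r" "(\<lambda>z. csqrt (rad k (Suc k) z (of_real u))) holomorphic_on ball 0 R"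
    using r_pos by (elim analytic_on_cball_imp_holomorphic_on_ball) auto
  have "eventually (\<lambda>z. z \<in> ball 0 r) (nhds (0::complex))"
    using r_pos by (intro eventually_nhds_in_open) auto
  then have "eventually (\<lambda>z. eval_fps (sq k (Suc k) (of_real u)) z = csqrt (rad k (Suc k) z (of_real u))) (nhds 0)"
    by eventually_elim (simp add: sq_eval csqrt_rad del: rad.simps)
  then have "(\<lambda>z. csqrt (rad k (Suc k) z (of_real u))) has_fps_expansion sq k (Suc k) (of_real u)"
    using r_pos conv by (simp add: has_fps_expansion_def del: rad.simps)
  then have "fps_conv_radius (sq k (Suc k) (of_real u)) \<ge> ereal R"
    by (rule holomorphic_on_imp_fps_conv_radius_ge) (use R in simp)
  then show False using R(1) conv by simp
qed

end

section \<open>Location of the dominant singularity\<close>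

text \<open>Passing from \<open>H\<close> to \<open>1 - 2 * z * H\<close> changes no singularity
  away from 0. If the radius exceeded \<open>norm z0\<close>, the series itself would extend the
  function to \<open>z0\<close>.\<close>

lemma dominant_singularity_not_extendable:
  assumes dom: "dominant_singularity (\<lambda>z. H k z u) z0" 
  shows "z0 \<noteq> 0" "fps_conv_radius (sq k (Suc k) u) = ereal (norm z0)"
    "\<And>F e. e > 0 \<Longrightarrow> F holomorphic_on ball z0 e \<Longrightarrow>
      (\<And>z. z \<in> ball z0 e \<Longrightarrow> norm z < norm z0 \<Longrightarrow> F z = eval_fps (sq k (Suc k) u) z) \<Longrightarrow> False"
proof -
  obtain f where f: "f holomorphic_on ball 0 (norm z0)" "eventually (\<lambda>z. f z = H k z u) (nhds 0)"
    and ne: "\<And>e g. e > 0 \<Longrightarrow> g holomorphic_on ball z0 e \<Longrightarrow> 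
      (\<And>z. z \<in> ball z0 e \<Longrightarrow> norm z < norm z0 \<Longrightarrow> g z = f z) \<Longrightarrow> False"
    using dom unfolding dominant_singularity_def by fastforce
  show nz: "z0 \<noteq> 0"
  proof
    assume "z0 = 0"
    \<comment> \<open>For \<open>z0 = 0\<close> the ball of radius 0 is empty, so any function
      counts as an extension.\<close>
    then show False using ne[of 1 "\<lambda>_. 0"] by auto
  qed
  have "f has_fps_expansion gf k (Suc k) u"
    using H_has_fps_expansion[of k u] has_fps_expansion_cong[OF f(2) refl] by blast
  then have exp: "(\<lambda>z. 1 - 2 * z * f z) has_fps_expansion sq k (Suc k) u"
    unfolding sq_def by (intro fps_expansion_intros)
  have hol: "(\<lambda>z. 1 - 2 * z * f z) holomorphic_on ball 0 (norm z0)"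
    by (intro holomorphic_intros f)
  have eval: "eval_fps (sq k (Suc k) u) z = 1 - 2 * z * f z" if "norm z < norm z0" for z
    using has_fps_expansion_imp_eval_fps_eq[OF exp that hol] .
  show ext: False if "e > 0" "F holomorphic_on ball z0 e"
    and eq: "\<And>z. z \<in> ball z0 e \<Longrightarrow> norm z < norm z0 \<Longrightarrow> F z = eval_fps (sq k (Suc k) u) z" for F e
  proof (rule ne)
    let ?e = "min e (norm z0)"
    have z0: "z \<noteq> 0" if "z \<in> ball z0 ?e" for z using that by (auto simp: dist_norm)
    show "?e > 0" using that nz by simp
    show "(\<lambda>z. (1 - F z) / (2 * z)) holomorphic_on ball z0 ?e"
      using z0 by (intro holomorphic_intros holomorphic_on_subset[OF that(2)]) auto
    show "(1 - F z) / (2 * z) = f z" if "z \<in> ball z0 ?e" "norm z < norm z0" for z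
      using eq[of z] eval[OF that(2)] z0[OF that(1)] that by simp
  qed
  have "fps_conv_radius (sq k (Suc k) u) \<ge> ereal (norm z0)"
    using exp by (rule holomorphic_on_imp_fps_conv_radius_ge) (use hol in simp)
  moreover have "\<not> ereal (norm z0) < fps_conv_radius (sq k (Suc k) u)"
  proof
    assume "ereal (norm z0) < fps_conv_radius (sq k (Suc k) u)"
    then obtain R where R: "norm z0 < R" "ereal R < fps_conv_radius (sq k (Suc k) u)"
      using ereal_dense2 less_ereal.simps(1) by blast
    have sub: "ball z0 (R - norm z0) \<subseteq> eball 0 (fps_conv_radius (sq k (Suc k) u))"
    proof
      fix z assume "z \<in> ball z0 (R - norm z0)"
      then have "norm z < R" using norm_triangle_sub[of z z0] by (auto simp: dist_norm norm_minus_commute)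
      then have "ereal (norm z) < ereal R" by simp
      also note R(2)
      finally show "z \<in> eball 0 (fps_conv_radius (sq k (Suc k) u))" by simp
    qed
    show False
      by (rule ext[of "R - norm z0" "eval_fps (sq k (Suc k) u)"])
         (use R sub in \<open>auto intro!: holomorphic_on_eval_fps\<close>)
  qed
  ultimately show "fps_conv_radius (sq k (Suc k) u) = ereal (norm z0)" by (simp add: antisym not_less)
qed

lemma positive_radiusI:
  assumes "dominant_singularity (\<lambda>z. H k z (of_real u)) z0" "u > 0"
  shows "positive_radius k u (norm z0)"
  using dominant_singularity_not_extendable[OF assms(1)] assms(2) by unfold_locales auto

lemma term_poly_pos: "t \<in> terms_of_size k L n \<Longrightarrow> u > 0 \<Longrightarrow> term_poly k L n (u :: real) > 0"
  unfolding term_poly_def by (rule sum_pos2[of _ t]) auto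

context positive_radius
begin

lemma sig_zero_at_dominant_singularity:
  assumes dom: "dominant_singularity (\<lambda>z. H k z (of_real u)) z0" and z0: "norm z0 = r"
  shows "\<exists>i\<le>Suc k. sig k i (of_real u) z0 = 0"
proof (rule ccontr)
  assume *: "\<not> ?thesis"
  then have "rad k i z0 (of_real u) \<notin> \<real>\<^sub>\<le>\<^sub>0" if "i \<le> Suc k" for i
    using rad_notin_nonpos[of i z0] that z0 by auto
  then have "(\<lambda>z. csqrt (rad k (Suc k) z (of_real u))) analytic_on {z0}"
    by (intro analytic_on_csqrt' analytic_on_rad analytic_intros) (auto simp del: rad.simps)
  then obtain e where e: "e > 0" "(\<lambda>z. csqrt (rad k (Suc k) z (of_real u))) holomorphic_on ball z0 e"
    unfolding analytic_on_def by blast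
  show False
  proof (rule dominant_singularity_not_extendable(3)[OF dom e])
    fix z :: complex assume "norm z < norm z0"
    then show "csqrt (rad k (Suc k) z (of_real u)) = eval_fps (sq k (Suc k) (of_real u)) z"
      using z0 by (simp add: sq_eval csqrt_rad del: rad.simps)
  qed
qed

text \<open>Since \<open>R_J = 0\<close>, its root drops out of \<open>R_(J+1) \<ge> 0\<close>.
  Higher radicands have a strictly smaller subtracted coefficient \<open>k - i\<close>, hence are
  positive. So only the radicand right after \<open>R_J\<close> can vanish along with it.\<close>

lemma rrad_pos_above:
  assumes J: "rrad k J r u = 0" "Suc J \<le> i" "i \<le> k"
  shows "rrad k (Suc i) r u > 0"
proof -
  have "0 \<le> rrad k (Suc J) r u" using assms by (intro rrad_nonneg) auto
  also have "\<dots> = 1 - 4 * of_nat (k - J) * r\<^sup>2 * u - 2 * r" using J by simp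
  also have "\<dots> < 1 - 4 * of_nat (k - i) * r\<^sup>2 * u - 2 * r"
  proof -
    have "k - i < k - J" using assms by simp
    then show ?thesis using r_pos u_pos by (simp add: mult.assoc)
  qed
  also have "\<dots> \<le> rrad k (Suc i) r u" using r_pos rrad_nonneg[of i] assms by simp
  finally show ?thesis .
qed

lemma rad_of_real: "i \<le> Suc k \<Longrightarrow> rad k i (of_real r) (of_real u) = of_real (rrad k i r u)"
proof (induction i)
  case (Suc i)
  then show ?case using rrad_nonneg[of i] by (simp add: csqrt_of_real)
qed simp

text \<open>A zero on the circle forces \<open>z ^ (n + 1) = r ^ (n + 1)\<close> for every size n that occurs; the sizes
  2 and 4 do.\<close>

lemma sig_zero_unique:
  assumes J: "2 \<le> J" "J \<le> Suc k" and zero: "sig k J u r = 0"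
    and z: "norm z \<le> r" "sig k J (complex_of_real u) z = 0"
  shows "z = of_real r"
proof -
  \<comment> \<open>\<open>2 \<le> J\<close> leaves room for one abstraction. At the deepest level
    all sizes are odd, and \<open>- r\<close> would be a zero as well.\<close>
  define L where "L = Suc k - J"
  have L: "Suc L \<le> k" using J by (auto simp: L_def)
  have pos: "p J 2 > 0" "p J 4 > 0"
    using term_poly_pos[of "Lam (Var 1)" k L 2 u] term_poly_pos[of "Lam (App (Var 1) (Var 1))" k L 4 u] L u_pos
    by (auto simp: p_def L_def[symmetric] terms_of_size_def terms_def)
  have "(\<lambda>n. p J n * r ^ n) sums (1 / (2 * r))"
    using summable_r[OF J(2)] zero r_pos by (simp add: sig_eq sums_iff field_simps)
  from sums_mult[OF this, of r] have 1: "(\<lambda>n. p J n * r ^ Suc n) sums (1 / 2)"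
    using r_pos by (simp add: mult_ac)
  have z0: "z \<noteq> 0" using z(2) by (auto simp: sig_def)
  have "(\<lambda>n. term_poly k (Suc k - J) n (complex_of_real u) * z ^ n) sums (1 / (2 * z))"
    using summable_norm_cancel[OF summable_disc[OF J(2) z(1)]] z(2) z0 by (simp add: sig_def sums_iff field_simps)
  from sums_mult[OF this, of z] have "(\<lambda>n. of_real (p J n) * z ^ Suc n) sums (1 / 2)"
    using z0 by (simp add: mult_ac p_def flip: of_real_term_poly)
  from sums_Re[OF this] have 2: "(\<lambda>n. p J n * Re (z ^ Suc n)) sums (1 / 2)" by (simp del: power_Suc)
  have le: "Re (z ^ n) \<le> r ^ n" for n
  proof -
    have "Re (z ^ n) \<le> norm (z ^ n)" by (rule complex_Re_le_cmod)
    also have "\<dots> \<le> r ^ n" using z by (simp add: norm_power power_mono)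
    finally show ?thesis .
  qed
  have "(\<lambda>n. p J n * (r ^ Suc n - Re (z ^ Suc n))) sums 0"
    using sums_diff[OF 1 2] by (simp add: algebra_simps)
  then have *: "p J n * (r ^ Suc n - Re (z ^ Suc n)) = 0" for n
    using suminf_eq_zero_iff[of "\<lambda>n. p J n * (r ^ Suc n - Re (z ^ Suc n))"] p_nonneg le[of "Suc _"]
    by (auto simp: sums_iff simp del: power_Suc)
  have pow: "z ^ Suc n = of_real r ^ Suc n" if "p J n > 0" for n
  proof -
    have Re: "Re (z ^ Suc n) = r ^ Suc n" using *[of n] that by simp
    have "norm (z ^ Suc n) \<le> r ^ Suc n" using z by (simp only: norm_power) (intro power_mono, auto)
    then have "(Re (z ^ Suc n))\<^sup>2 + (Im (z ^ Suc n))\<^sup>2 \<le> (r ^ Suc n)\<^sup>2"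
      using r_pos by (simp only: cmod_power2[symmetric]) (intro power_mono, auto)
    then have "Im (z ^ Suc n) = 0" by (simp only: Re) simp
    with Re show ?thesis by (simp only: complex_eq_iff of_real_power[symmetric] Re_complex_of_real Im_complex_of_real)
  qed
  have 3: "z ^ 3 = of_real r ^ 3" and 5: "z ^ 5 = of_real r ^ 5"
    using pow[OF pos(1)] pow[OF pos(2)] by (simp_all only: eval_nat_numeral)
  have "z ^ 3 * z ^ 3 = z * z ^ 5" by (simp flip: power_add power_Suc)
  then have "of_real r * of_real r ^ 5 = z * of_real r ^ 5"
    unfolding 3 5 by (simp flip: power_add power_Suc)
  then show ?thesis using r_pos by simp
qed

text \<open>Vanishing of \<open>R_1\<close> means \<open>4 * k * r^2 = 1\<close>, so
  \<open>r \<le> 1/2\<close>, while \<open>R_2\<close> becomes \<open>2 * r * (2 * r - 1)\<close>.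
  This excludes \<open>J = 1\<close> once \<open>R_J\<close> is known to be the only vanishing
  radicand.\<close>

lemma first_radicand:
  assumes "u = 1" "rrad k 1 r u = 0" "1 \<le> k"
  shows "rrad k 2 r u \<le> 0"
proof (rule ccontr)
  assume neg: "\<not> ?thesis"
  have R1: "4 * real k * r\<^sup>2 = 1" using assms by simp
  have "rrad k 2 r u = 1 - 4 * real (k - 1) * r\<^sup>2 - 2 * r"
    using assms by (simp add: numeral_2_eq_2)
  also have "real (k - 1) = real k - 1" using assms by simp
  also have "1 - 4 * (real k - 1) * r\<^sup>2 - 2 * r = 2 * r * (2 * r - 1)"
    using R1 by (simp add: algebra_simps power2_eq_square)
  finally have "rrad k 2 r u = 2 * r * (2 * r - 1)" .
  moreover note neg
  ultimately have "2 * r > 1" using r_pos by (simp add: zero_less_mult_iff not_le)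
  then have "1 < (2 * r)\<^sup>2" by (rule one_less_power) simp
  also have "\<dots> = 4 * 1 * r\<^sup>2" by (simp add: power2_eq_square)
  also have "\<dots> \<le> 4 * real k * r\<^sup>2" using assms by (intro mult_right_mono) auto
  finally show False using R1 by simp
qed

end

section \<open>Comparison of radii and radicands for different real weights\<close>

lemma radius_antimono:
  assumes "positive_radius k u r" "positive_radius k u' r'" "u \<le> u'"
  shows "r' \<le> r"
proof -
  interpret A: positive_radius k u r by fact
  interpret B: positive_radius k u' r' by fact
  have "summable (\<lambda>n. A.p (Suc k) n * r' ^ n)"
  proof (rule summable_comparison_test'[OF B.summable_r[of "Suc k"], of 0])
    show "norm (A.p (Suc k) n * r' ^ n) \<le> B.p (Suc k) n * r' ^ n" for n
      using B.r_pos A.u_pos assms(3) A.p_nonneg[of "Suc k" n] term_poly_mono[of u u' k 0 n]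
      by (auto simp: A.p_def B.p_def intro!: mult_right_mono)
  qed simp
  then have "summable (\<lambda>n. of_real ((- 2 * r') * (A.p (Suc k) n * r' ^ n)) :: complex)"
    by (subst summable_of_real_iff) (rule summable_mult)
  also have "(\<lambda>n. of_real ((- 2 * r') * (A.p (Suc k) n * r' ^ n))) =
      (\<lambda>n. sq k (Suc k) (of_real u) $ Suc n * of_real r' ^ Suc n)"
    by (auto simp: sq_nth A.p_def simp flip: of_real_term_poly)
  finally have "summable (\<lambda>n. sq k (Suc k) (of_real u) $ n * of_real r' ^ n)"
    by (subst (asm) summable_Suc_iff)
  then have "fps_conv_radius (sq k (Suc k) (of_real u)) \<ge> ereal (norm (complex_of_real r'))"
    unfolding fps_conv_radius_def by (rule conv_radius_geI)
  then show ?thesis using A.conv B.r_pos by simp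
qed

text \<open>With \<open>v = 4 * z^2 * y\<close>, the radicand is
  \<open>1 - (k - i) * v - 2 * z\<close> plus a term increasing in the previous radicand. The loss
  \<open>2 * (z' - z)\<close> is covered by \<open>(k - J) * (v - v')\<close>, and the surplus
  \<open>J - i > 0\<close> makes the increase strict at every step.\<close>

lemma rrad_compare:
  assumes J: "J \<le> k" and z: "0 < z" "z \<le> z'" 
    and v: "4 * z'\<^sup>2 * y' < 4 * z\<^sup>2 * y"
    and le: "2 * (z' - z) \<le> of_nat (k - J) * (4 * z\<^sup>2 * y - 4 * z'\<^sup>2 * y')"
    and nonneg: "\<And>i. i < J \<Longrightarrow> 0 \<le> rrad k i z y"
  shows "i \<le> J \<Longrightarrow> rrad k i z y \<le> rrad k i z' y' \<and> (1 \<le> i \<longrightarrow> rrad k i z y < rrad k i z' y')"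
proof (induction i)
  case (Suc i)
  define v v' where "v = 4 * z\<^sup>2 * y" and "v' = 4 * z'\<^sup>2 * y'"
  have "of_nat (k - i) * (v - v') = of_nat (k - J) * (v - v') + of_nat (J - i) * (v - v')"
    using J Suc.prems by (simp add: of_nat_diff algebra_simps)
  moreover have "of_nat (J - i) * (v - v') > 0" using v Suc.prems by (simp add: v_def v'_def)
  ultimately have 1: "2 * (z' - z) < of_nat (k - i) * (v - v')"
    using le unfolding v_def[symmetric] v'_def[symmetric] by linarith
  have 2: "2 * z * sqrt (rrad k i z y) \<le> 2 * z' * sqrt (rrad k i z' y')"
    using Suc nonneg[of i] z by (intro mult_mono) auto
  have "rrad k (Suc i) z y = 1 - of_nat (k - i) * v - 2 * z + 2 * z * sqrt (rrad k i z y)"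
    "rrad k (Suc i) z' y' = 1 - of_nat (k - i) * v' - 2 * z' + 2 * z' * sqrt (rrad k i z' y')"
    by (simp_all add: v_def v'_def)
  then have "rrad k (Suc i) z y < rrad k (Suc i) z' y'" using 1 2 by (simp only: right_diff_distrib)
  then show ?case by simp
qed simp

lemma analytic_zero_cases:
  fixes f :: "complex \<Rightarrow> complex"
  assumes "f analytic_on {a}"
  shows "eventually (\<lambda>z. f z = 0) (at a) \<or> eventually (\<lambda>z. f z \<noteq> 0) (at a)"
  using non_zero_neighbour[OF isolated_singularity_at_analytic[OF assms] not_essential_analytic[OF assms]]
  by (auto simp: frequently_def)

lemma eventually_at_of_real:
  assumes "eventually P (at (of_real x :: complex))"
  shows "eventually (\<lambda>y. P (of_real y)) (at (x :: real))"
proof -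
  have "filterlim complex_of_real (at (of_real x)) (at x)"
    by (rule filterlim_atI) (auto intro!: tendsto_intros simp: eventually_at_filter)
  with assms show ?thesis by (simp add: filterlim_iff)
qed

lemma eventually_nhds_of_real:
  assumes "eventually P (nhds (of_real x :: complex))"
  shows "eventually (\<lambda>y. P (of_real y)) (nhds (x :: real))"
proof -
  have "filterlim complex_of_real (nhds (of_real x)) (nhds x)"
    by (intro tendsto_intros filterlim_ident)
  with assms show ?thesis by (simp add: filterlim_iff)
qed

lemma isCont_rrad [continuous_intros]:
  "isCont f x \<Longrightarrow> isCont g x \<Longrightarrow> isCont (\<lambda>x. rrad k i (f x) (g x)) x"
  by (induction i) (auto intro!: continuous_intros)

lemma analytic_on_reflect:
  assumes "f analytic_on {of_real x}"
  shows "(\<lambda>z. cnj (f (cnj z))) analytic_on {of_real x}"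
proof -
  obtain e where e: "e > 0" "f holomorphic_on ball (of_real x) e"
    using assms by (auto simp: analytic_on_def)
  have "cnj ` ball (of_real x) e \<subseteq> ball (of_real x) e"
  proof
    fix z assume "z \<in> cnj ` ball (of_real x) e"
    then obtain w where "z = cnj w" "dist (of_real x) w < e" by auto
    then show "z \<in> ball (of_real x) e"
      using complex_mod_cnj[of "of_real x - w"] by (simp add: dist_norm)
  qed
  then have "cnj \<circ> f \<circ> cnj holomorphic_on ball (of_real x) e"
    by (intro holomorphic_on_compose_cnj_cnj holomorphic_on_subset[OF e(2)]) auto
  then show ?thesis using e(1) by (auto simp: analytic_on_def o_def)
qed


text \<open>If two consecutive radicands vanished simultaneously at \<open>u = 1\<close>, the dominant singularity would be
  governed by different radicands on the two sides of 1, and \<open>\<rho>\<close> would not be analytic there.\<close>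

lemma not_simultaneous:
  fixes \<rho> :: "complex \<Rightarrow> complex"
  assumes dom: "\<forall>\<^sub>F u in nhds 1. dominant_singularity (\<lambda>z. H k z u) (\<rho> u)" and an: "\<rho> analytic_on {1}"
    and J: "1 \<le> J" "J \<le> k" and z1: "rrad k J (norm (\<rho> 1)) 1 = 0" and z2: "rrad k (Suc J) (norm (\<rho> 1)) 1 = 0"
    and pos: "\<And>i. i \<le> Suc k \<Longrightarrow> i \<noteq> J \<Longrightarrow> i \<noteq> Suc J \<Longrightarrow> rrad k i (norm (\<rho> 1)) 1 > 0"
    and near: "\<forall>\<^sub>F y in nhds (1::real). \<forall>i\<le>Suc k. i \<noteq> J \<and> i \<noteq> Suc J \<longrightarrow> rrad k i (norm (\<rho> (of_real y))) y > 0"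
  shows False
proof -
  define R where "R = (\<lambda>y::real. norm (\<rho> (of_real y)))"
  have "\<forall>\<^sub>F y in nhds (1::real). dominant_singularity (\<lambda>z. H k z (of_real y)) (\<rho> (of_real y))"
    using eventually_nhds_of_real[of _ 1] dom by simp
  moreover have "\<forall>\<^sub>F y in nhds (1::real). y > 0"
    by (rule eventually_nhds_in_open[of "{0<..}", simplified]) auto
  ultimately have rad: "\<forall>\<^sub>F y in nhds (1::real). positive_radius k y (R y)"
    by eventually_elim (use positive_radiusI in \<open>auto simp: R_def\<close>)
  interpret one: positive_radius k 1 "R 1"
    using eventually_nhds_x_imp_x[OF rad] .
  \<comment> \<open>So far \<open>\<rho> u\<close> need not be the positive point of its circle.
    Reflection gives an analytic function whose values at real arguments are the radii.\<close>
  define \<rho>' where "\<rho>' = (\<lambda>u. csqrt (\<rho> u * cnj (\<rho> (cnj u))))"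
  have \<rho>'_real: "\<rho>' (of_real y) = of_real (R y)" for y
    by (simp add: \<rho>'_def R_def complex_norm_square[symmetric] csqrt_of_real flip: of_real_power)
  have an': "\<rho>' analytic_on {1}"
  proof -
    have "\<rho> 1 * cnj (\<rho> (cnj 1)) = of_real ((R 1)\<^sup>2)"
      by (simp add: R_def complex_norm_square[symmetric])
    then have "\<rho> 1 * cnj (\<rho> (cnj 1)) \<notin> \<real>\<^sub>\<le>\<^sub>0" using one.r_pos
      by (simp only:) (simp add: complex_nonpos_Reals_iff)
    then show ?thesis
      unfolding \<rho>'_def using an analytic_on_reflect[of \<rho> 1] by (intro analytic_intros) auto
  qed
  define T where "T = (\<lambda>u. rad k J (\<rho>' u) u)"
  have "rad k j (\<rho>' 1) 1 \<notin> \<real>\<^sub>\<le>\<^sub>0" if "j < J" for j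
    using one.rad_of_real[of j] pos[of j] that J \<rho>'_real[of 1] by (simp add: R_def)
  then have "T analytic_on {1}"
    unfolding T_def by (intro analytic_on_rad an' analytic_intros)
  \<comment> \<open>By isolation of zeros, \<open>R_J\<close> vanishes at the radius for all real
    \<open>y\<close> near 1 or for none except possibly 1. The first alternative fails on the left
    of 1, the second on the right.\<close>
  then have cases: "eventually (\<lambda>y. T (of_real y) = 0) (at (1::real)) \<or> eventually (\<lambda>y. T (of_real y) \<noteq> 0) (at (1::real))"
    using analytic_zero_cases[of T 1] eventually_at_of_real[of _ 1] by auto
  have good: "\<forall>\<^sub>F y in nhds (1::real). positive_radius k y (R y) \<and> T (of_real y) = of_real (rrad k J (R y) y)
     \<and> (rrad k J (R y) y = 0 \<or> rrad k (Suc J) (R y) y = 0)"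
    using rad near
  proof eventually_elim
    case (elim y)
    then interpret y: positive_radius k y "R y" by simp
    have "T (of_real y) = of_real (rrad k J (R y) y)"
      using J unfolding T_def \<rho>'_real by (intro y.rad_of_real) auto
    moreover have "rrad k J (R y) y = 0 \<or> rrad k (Suc J) (R y) y = 0"
    proof -
      obtain i where "i \<le> Suc k" "rrad k i (R y) y = 0" using y.exists_zero by blast
      then show ?thesis using elim(2) unfolding R_def by (cases "i = J \<or> i = Suc J") auto
    qed
    ultimately show ?case using elim by simp
  qed
  have D1: "4 * real (k - J) * (R 1)\<^sup>2 = 1 - 2 * R 1"
    using z1 z2 by (simp add: R_def)
  have small: "\<forall>\<^sub>F y in nhds (1::real). y \<in> {0<..}"
    by (rule eventually_nhds_in_open) auto
  from cases show False
  proof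
    \<comment> \<open>For \<open>y < 1\<close> the radius does not decrease, and
      \<open>R_(J+1) \<ge> 0\<close> supplies the hypothesis of \<open>rrad_compare\<close>. It
      forces \<open>R_J\<close> to be larger at \<open>y\<close> than at 1, but both values are
      0.\<close>
    assume *: "eventually (\<lambda>y. T (of_real y) = 0) (at (1::real))"
    have "eventually (\<lambda>y. y < 1 \<and> T (of_real y) = 0 \<and> positive_radius k y (R y) \<and> 
        T (of_real y) = of_real (rrad k J (R y) y)) (at_left (1::real))"
      using eventually_at_leftI[of 0 1 "\<lambda>y::real. y < 1"] filter_leD[OF at_le[OF subset_UNIV] *]
        filter_leD[OF at_within_le_nhds good]
      by (auto simp: eventually_conj_iff)
    then obtain y where y: "y < 1" "rrad k J (R y) y = 0" "positive_radius k y (R y)"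
      using eventually_happens[of _ "at_left (1::real)"] by fastforce
    interpret y: positive_radius k y "R y" by fact
    have le: "R 1 \<le> R y"
      using radius_antimono[OF y.positive_radius_axioms one.positive_radius_axioms] y(1) by simp
    have "0 \<le> rrad k (Suc J) (R y) y" using J by (intro y.rrad_nonneg) auto
    then have D: "4 * real (k - J) * (R y)\<^sup>2 * y \<le> 1 - 2 * R y" using y(2) by simp
    have v: "4 * (R y)\<^sup>2 * y < 4 * (R 1)\<^sup>2 * 1"
    proof (cases "R y = R 1")
      case True
      then show ?thesis using y(1) one.r_pos by simp
    next
      case False
      then have "real (k - J) * (4 * (R y)\<^sup>2 * y) < real (k - J) * (4 * (R 1)\<^sup>2 * 1)"
      proof -
        have "real (k - J) * (4 * (R y)\<^sup>2 * y) = 4 * real (k - J) * (R y)\<^sup>2 * y"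
          "real (k - J) * (4 * (R 1)\<^sup>2 * 1) = 4 * real (k - J) * (R 1)\<^sup>2" by (simp_all only: mult_ac mult_1_right)
        then show ?thesis using D D1 le False by linarith
      qed
      then show ?thesis by (rule mult_left_less_imp_less) simp
    qed
    have "rrad k J (R 1) 1 < rrad k J (R y) y"
      using rrad_compare[OF J(2) one.r_pos le v, of J] D D1 J one.rrad_nonneg
      by (simp add: algebra_simps)
    then show False using y(2) z1 by (simp add: R_def)
  next
    \<comment> \<open>For \<open>y > 1\<close> the zero must belong to \<open>R_(J+1)\<close>. The
      comparison, now with 1 in the role of the primed arguments, makes \<open>R_J\<close> negative
      at \<open>y\<close>.\<close>
    assume *: "eventually (\<lambda>y. T (of_real y) \<noteq> 0) (at (1::real))"
    have "eventually (\<lambda>y. y > 1 \<and> T (of_real y) \<noteq> 0 \<and> positive_radius k y (R y) \<and> 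
        T (of_real y) = of_real (rrad k J (R y) y) \<and> (rrad k J (R y) y = 0 \<or> rrad k (Suc J) (R y) y = 0)) (at_right (1::real))"
      using eventually_at_rightI[of 1 2 "\<lambda>y::real. y > 1"] filter_leD[OF at_le[OF subset_UNIV] *]
        filter_leD[OF at_within_le_nhds good]
      by (auto simp: eventually_conj_iff)
    then obtain y where y: "y > 1" "rrad k J (R y) y \<noteq> 0" "rrad k (Suc J) (R y) y = 0" "positive_radius k y (R y)"
      using eventually_happens[of _ "at_right (1::real)"] by fastforce
    interpret y: positive_radius k y "R y" by fact
    have le: "R y \<le> R 1"
      using radius_antimono[OF one.positive_radius_axioms y.positive_radius_axioms] y(1) by simp
    have "rrad k J (R y) y > 0" using y.rrad_nonneg[of J] y(2) J by simp
    then have "2 * R y * sqrt (rrad k J (R y) y) > 0" using y.r_pos by simp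
    then have D: "4 * real (k - J) * (R y)\<^sup>2 * y > 1 - 2 * R y" using y(3) by simp
    have "real (k - J) * (4 * (R 1)\<^sup>2 * 1) < real (k - J) * (4 * (R y)\<^sup>2 * y)"
    proof -
      have "real (k - J) * (4 * (R y)\<^sup>2 * y) = 4 * real (k - J) * (R y)\<^sup>2 * y"
        "real (k - J) * (4 * (R 1)\<^sup>2 * 1) = 4 * real (k - J) * (R 1)\<^sup>2" by (simp_all only: mult_ac mult_1_right)
      then show ?thesis using D D1 le by linarith
    qed
    then have v: "4 * (R 1)\<^sup>2 * 1 < 4 * (R y)\<^sup>2 * y" by (rule mult_left_less_imp_less) simp
    have "rrad k J (R y) y < rrad k J (R 1) 1"
      using rrad_compare[OF J(2) y.r_pos le v, of J] D D1 J y.rrad_nonneg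
      by (simp add: algebra_simps)
    then show False using y.rrad_nonneg[of J] z1 J by (simp add: R_def)
  qed
qed

lemma dominant_location:
  fixes \<rho> :: "complex \<Rightarrow> complex"
  assumes k: "k \<ge> 1" and dom: "\<forall>\<^sub>F u in nhds 1. dominant_singularity (\<lambda>z. H k z u) (\<rho> u)"
    and an: "\<rho> analytic_on {1}"
  obtains J r where "2 \<le> J" "J \<le> Suc k" "positive_radius k 1 r" "\<rho> 1 = of_real r" "rrad k J r 1 = 0"
    "\<And>i. i \<le> Suc k \<Longrightarrow> i \<noteq> J \<Longrightarrow> rrad k i r 1 > 0" "\<forall>\<^sub>F u in nhds 1. rad k J (\<rho> u) u = 0"
proof -
  define R where "R = (\<lambda>y::real. norm (\<rho> (of_real y)))"
  have domr: "\<forall>\<^sub>F y in nhds (1::real). dominant_singularity (\<lambda>z. H k z (of_real y)) (\<rho> (of_real y))"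
    using eventually_nhds_of_real[of _ 1] dom by simp
  have "\<forall>\<^sub>F y in nhds (1::real). y > 0"
    by (rule eventually_nhds_in_open[of "{0<..}", simplified]) auto
  with domr have rad: "\<forall>\<^sub>F y in nhds (1::real). positive_radius k y (R y)"
    by eventually_elim (use positive_radiusI in \<open>auto simp: R_def\<close>)
  interpret one: positive_radius k 1 "R 1"
    using eventually_nhds_x_imp_x[OF rad] .
  have R1: "R 1 = norm (\<rho> 1)" by (simp add: R_def)
  have "isCont \<rho> (of_real 1)" using analytic_at_imp_isCont[OF an] by simp
  then have "((\<lambda>y. \<rho> (complex_of_real y)) \<longlongrightarrow> \<rho> (of_real 1)) (at 1)"
    by (rule isCont_tendsto_compose) (rule tendsto_of_real, rule tendsto_ident_at)
  then have "isCont (\<lambda>y. \<rho> (complex_of_real y)) 1" by (simp add: isCont_def)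
  then have contR: "isCont R 1" unfolding R_def by (intro continuous_intros)
  \<comment> \<open>Minimality gives positivity below \<open>J\<close>, and
    \<open>rrad_pos_above\<close> gives it beyond \<open>Suc J\<close>; \<open>Suc J\<close> itself
    is settled by \<open>not_simultaneous\<close>.\<close>
  define J where "J = (LEAST i. 1 \<le> i \<and> i \<le> Suc k \<and> rrad k i (R 1) 1 = 0)"
  have J: "1 \<le> J" "J \<le> Suc k" "rrad k J (R 1) 1 = 0"
    using LeastI_ex[OF one.exists_zero] unfolding J_def by auto
  have pos: "rrad k i (R 1) 1 > 0" if i: "i \<le> Suc k" "i \<noteq> J" "i \<noteq> Suc J" for i
  proof (cases "i < J")
    case True
    then have "\<not> (1 \<le> i \<and> i \<le> Suc k \<and> rrad k i (R 1) 1 = 0)" unfolding J_def by (rule not_less_Least)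
    then show ?thesis using one.rrad_nonneg[OF i(1)] i(1) by (cases i) auto
  next
    case False
    then show ?thesis using one.rrad_pos_above[OF J(3), of "i - 1"] i by (cases i) auto
  qed
  have near: "\<forall>\<^sub>F y in nhds (1::real). \<forall>i\<in>{i. i \<le> Suc k \<and> rrad k i (R 1) 1 > 0}. rrad k i (R y) y > 0"
  proof (rule eventually_ball_finite)
    show "\<forall>i\<in>{i. i \<le> Suc k \<and> rrad k i (R 1) 1 > 0}. \<forall>\<^sub>F y in nhds (1::real). rrad k i (R y) y > 0"
    proof
      fix i assume i: "i \<in> {i. i \<le> Suc k \<and> rrad k i (R 1) 1 > 0}"
      have "isCont (\<lambda>y. rrad k i (R y) y) 1" by (intro isCont_rrad contR continuous_intros)
      then have "((\<lambda>y. rrad k i (R y) y) \<longlongrightarrow> rrad k i (R 1) 1) (nhds 1)"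
        using tendsto_at_iff_tendsto_nhds[of "\<lambda>y. rrad k i (R y) y" 1] by (simp only: isCont_def)
      then show "\<forall>\<^sub>F y in nhds (1::real). rrad k i (R y) y > 0" by (rule order_tendstoD) (use i in auto)
    qed
  qed auto
  have SJ: "rrad k (Suc J) (R 1) 1 > 0" if "J \<le> k"
  proof (rule ccontr)
    assume "\<not> ?thesis"
    then have z2: "rrad k (Suc J) (R 1) 1 = 0" using one.rrad_nonneg[of "Suc J"] that by simp
    have "\<forall>\<^sub>F y in nhds (1::real). \<forall>i\<le>Suc k. i \<noteq> J \<and> i \<noteq> Suc J \<longrightarrow> rrad k i (norm (\<rho> (of_real y))) y > 0"
      using near by eventually_elim (use pos in \<open>auto simp: R_def\<close>)
    with not_simultaneous[OF dom an J(1) that] J(3) z2 pos show False unfolding R1 by blast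
  qed
  have pos': "rrad k i (R 1) 1 > 0" if i: "i \<le> Suc k" "i \<noteq> J" for i
    using pos[of i] SJ i by (cases "i = Suc J") auto
  have J2: "2 \<le> J"
  proof (rule ccontr)
    assume "\<not> ?thesis"
    then have "J = 1" using J by simp
    then show False using one.first_radicand J k pos'[of 2] by simp
  qed
  have "\<forall>\<^sub>F y in nhds (1::real). \<rho> (of_real y) = of_real (R y) \<and> rad k J (\<rho> (of_real y)) (of_real y) = 0"
    using domr rad near
  proof eventually_elim
    case (elim y)
    interpret y: positive_radius k y "R y" by (rule elim)
    have nz: "sig k i y (R y) \<noteq> 0" if "i \<le> Suc k" "i \<noteq> J" for i
      using y.rrad_eq[of i] elim(3) pos'[of i] that by auto
    have zero: "rrad k J (R y) y = 0"
    proof -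
      obtain i where "i \<le> Suc k" "rrad k i (R y) y = 0" using y.exists_zero by blast
      then show ?thesis using nz[of i] y.rrad_eq[of i] by (cases "i = J") auto
    qed
    obtain i where i: "i \<le> Suc k" "sig k i (of_real y) (\<rho> (of_real y)) = 0"
      using y.sig_zero_at_dominant_singularity[OF elim(1)] by (auto simp: R_def)
    then have "i = J" using y.sig_disc_nonzero[of i "\<rho> (of_real y)"] nz[of i] by (auto simp: R_def)
    \<comment> \<open>Now that the vanishing index is known to be \<open>J\<close> and at least 2,
      uniqueness of the zero on the circle makes \<open>\<rho>\<close> positive at real arguments
      near 1.\<close>
    then have "\<rho> (of_real y) = of_real (R y)"
      using i zero y.rrad_eq[of J] J by (intro y.sig_zero_unique[OF J2 J(2)]) (auto simp: R_def)
    then show ?case using y.rad_of_real[OF J(2)] zero by simp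
  qed
  note real = this
  have \<rho>1: "\<rho> 1 = of_real (R 1)" using eventually_nhds_x_imp_x[OF real] by simp
  have "rad k j (\<rho> 1) 1 \<notin> \<real>\<^sub>\<le>\<^sub>0" if "j < J" for j
    using one.rad_of_real[of j] pos'[of j] that J by (simp add: \<rho>1)
  then have "(\<lambda>u. rad k J (\<rho> u) u) analytic_on {1}"
    by (intro analytic_on_rad an analytic_intros)
  \<comment> \<open>The real zeros accumulate at 1, so the analytic function cannot have an isolated
    zero there and vanishes for complex \<open>u\<close> as well.\<close>
  moreover have "\<not> eventually (\<lambda>u. rad k J (\<rho> u) u \<noteq> 0) (at 1)"
  proof
    assume "eventually (\<lambda>u. rad k J (\<rho> u) u \<noteq> 0) (at 1)"
    then have "eventually (\<lambda>y. rad k J (\<rho> (of_real y)) (of_real y) \<noteq> 0) (at (1::real))"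
      using eventually_at_of_real[of _ 1] by simp
    moreover have "eventually (\<lambda>y. rad k J (\<rho> (of_real y)) (of_real y) = 0) (at (1::real))"
      using filter_leD[OF at_within_le_nhds real] by (rule eventually_mono) blast
    ultimately have "eventually (\<lambda>y. False) (at (1::real))" by eventually_elim simp
    then show False by simp
  qed
  ultimately have "eventually (\<lambda>u. rad k J (\<rho> u) u = 0) (at 1)"
    using analytic_zero_cases by blast
  moreover have "rad k J (\<rho> 1) 1 = 0" using conjunct2[OF eventually_nhds_x_imp_x[OF real]] by (simp only: of_real_1)
  ultimately have "eventually (\<lambda>u. rad k J (\<rho> u) u = 0) (nhds 1)"
    by (auto simp: eventually_at_filter elim!: eventually_mono)
  then show ?thesis using that[OF J2 J(2) one.positive_radius_axioms \<rho>1 J(3) pos'] by blast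
qed

section \<open>Uniformisation at the dominant singularity\<close>

text \<open>The first coordinate is \<open>w\<close>, the second is \<open>u\<close>. Joint
  continuity yields bounds uniform in \<open>u\<close>, and differentiability in \<open>w\<close>
  alone suffices for the coefficient estimates. Quantifying over a neighbourhood makes the condition
  open.\<close>

definition slice_holomorphic :: "(complex \<times> complex \<Rightarrow> complex) \<Rightarrow> complex \<times> complex \<Rightarrow> bool" where
  "slice_holomorphic f p \<longleftrightarrow> (\<forall>\<^sub>F q in nhds p. isCont f q \<and> (\<lambda>w. f (w, snd q)) field_differentiable at (fst q))"

lemma slice_holomorphic_isCont: "slice_holomorphic f p \<Longrightarrow> isCont f p"
  unfolding slice_holomorphic_def by (drule eventually_nhds_x_imp_x) simp

lemma slice_holomorphic_differentiable: "slice_holomorphic f p \<Longrightarrow> (\<lambda>w. f (w, snd p)) field_differentiable at (fst p)"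
  unfolding slice_holomorphic_def by (drule eventually_nhds_x_imp_x) simp

lemma slice_holomorphic_const: "slice_holomorphic (\<lambda>q. c) p"
  by (simp add: slice_holomorphic_def)

lemma slice_holomorphic_fst: "slice_holomorphic (\<lambda>q. fst q) p"
  unfolding slice_holomorphic_def by (auto intro!: always_eventually continuous_intros)

lemma slice_holomorphic_snd:
  assumes "g analytic_on {snd p}"
  shows "slice_holomorphic (\<lambda>q. g (snd q)) p"
proof -
  obtain S where S: "open S" "snd p \<in> S" "g holomorphic_on S"
    using assms by (auto simp: analytic_at)
  have "filterlim snd (nhds (snd p)) (nhds p)"
    by (intro tendsto_intros filterlim_ident)
  then have "\<forall>\<^sub>F q in nhds p. snd q \<in> S"
    using S by (intro eventually_compose_filterlim[OF eventually_nhds_in_open]) 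
  then show ?thesis unfolding slice_holomorphic_def
  proof eventually_elim
    case (elim q)
    then have "isCont g (snd q)"
      using S holomorphic_on_imp_continuous_on continuous_on_eq_continuous_at by blast
    have "isCont (\<lambda>q. g (snd q)) q"
      by (rule continuous_at_compose[of q snd g, unfolded o_def]) (simp_all add: \<open>isCont g (snd q)\<close> isCont_snd)
    then show ?case by simp
  qed
qed

lemma slice_holomorphic_add:
  assumes "slice_holomorphic f p" "slice_holomorphic g p"
  shows "slice_holomorphic (\<lambda>q. f q + g q) p"
  using assms unfolding slice_holomorphic_def by eventually_elim (auto intro!: continuous_intros derivative_intros)

lemma slice_holomorphic_diff:
  assumes "slice_holomorphic f p" "slice_holomorphic g p"
  shows "slice_holomorphic (\<lambda>q. f q - g q) p"
  using assms unfolding slice_holomorphic_def by eventually_elim (auto intro!: continuous_intros derivative_intros)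

lemma slice_holomorphic_mult:
  assumes "slice_holomorphic f p" "slice_holomorphic g p"
  shows "slice_holomorphic (\<lambda>q. f q * g q) p"
  using assms unfolding slice_holomorphic_def by eventually_elim (auto intro!: continuous_intros derivative_intros)

lemma slice_holomorphic_power:
  assumes "slice_holomorphic f p"
  shows "slice_holomorphic (\<lambda>q. f q ^ n) p"
  using assms unfolding slice_holomorphic_def by eventually_elim (auto intro!: continuous_intros derivative_intros)

lemma slice_holomorphic_eventually_in_open:
  assumes "slice_holomorphic f p" "open A" "f p \<in> A"
  shows "\<forall>\<^sub>F q in nhds p. f q \<in> A"
proof -
  have "filterlim f (nhds (f p)) (nhds p)"
    using slice_holomorphic_isCont[OF assms(1)] unfolding isCont_def by (rule tendsto_at_iff_tendsto_nhds[THEN iffD1])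
  then show ?thesis
    using assms by (intro eventually_compose_filterlim[OF eventually_nhds_in_open])
qed

lemma slice_holomorphic_divide:
  assumes "slice_holomorphic f p" "slice_holomorphic g p" "g p \<noteq> 0"
  shows "slice_holomorphic (\<lambda>q. f q / g q) p"
proof -
  have "\<forall>\<^sub>F q in nhds p. g q \<in> - {0}"
    using assms by (intro slice_holomorphic_eventually_in_open) auto
  with assms(1,2) show ?thesis
    unfolding slice_holomorphic_def by eventually_elim (auto intro!: continuous_intros derivative_intros)
qed

lemma slice_holomorphic_csqrt:
  assumes "slice_holomorphic f p" "f p \<notin> \<real>\<^sub>\<le>\<^sub>0"
  shows "slice_holomorphic (\<lambda>q. csqrt (f q)) p"
proof -
  have "\<forall>\<^sub>F q in nhds p. f q \<in> - \<real>\<^sub>\<le>\<^sub>0"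
    using assms by (intro slice_holomorphic_eventually_in_open) auto
  with assms(1) show ?thesis unfolding slice_holomorphic_def
  proof eventually_elim
    case (elim q)
    have "(csqrt \<circ> (\<lambda>w. f (w, snd q))) field_differentiable at (fst q)"
      using elim by (intro field_differentiable_compose field_differentiable_at_csqrt) auto
    moreover have "isCont (\<lambda>q. csqrt (f q)) q"
      using elim by (intro continuous_at_compose[of q f csqrt, unfolded o_def] continuous_at_csqrt) auto
    ultimately show ?case by (simp add: o_def)
  qed
qed

lemmas slice_holomorphic_intros = slice_holomorphic_const slice_holomorphic_fst slice_holomorphic_add slice_holomorphic_diff slice_holomorphic_mult slice_holomorphic_power

lemma slice_holomorphic_rad:
  assumes "\<And>j. j < i \<Longrightarrow> rad k j (f p) (g p) \<notin> \<real>\<^sub>\<le>\<^sub>0" "slice_holomorphic f p" "slice_holomorphic g p"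
  shows "slice_holomorphic (\<lambda>q. rad k i (f q) (g q)) p"
  using assms(1)
proof (induction i)
  case (Suc i)
  then show ?case unfolding rad.simps using assms(2,3) by (intro slice_holomorphic_intros slice_holomorphic_csqrt) auto
qed (simp add: slice_holomorphic_const)

lemma Re_csqrt_pos:
  assumes "z \<notin> \<real>\<^sub>\<le>\<^sub>0"
  shows "Re (csqrt z) > 0"
proof (rule ccontr)
  assume "\<not> ?thesis"
  then have "cmod z + Re z = 0" using abs_Re_le_cmod[of z] by simp
  then have "(cmod z)\<^sup>2 = (Re z)\<^sup>2" "Re z \<le> 0"
    using norm_ge_zero[of z] by (auto simp: eq_neg_iff_add_eq_0[symmetric] simp del: norm_ge_zero)
  then show False using assms by (simp add: cmod_power2 complex_nonpos_Reals_iff)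
qed

lemma csqrt_add_nonzero: "Re (csqrt b) > 0 \<Longrightarrow> csqrt a + csqrt b \<noteq> 0"
proof
  assume "Re (csqrt b) > 0" "csqrt a + csqrt b = 0"
  then show False using Re_csqrt[of a] arg_cong[of "csqrt a + csqrt b" 0 Re]
    unfolding plus_complex.sel zero_complex.sel by linarith
qed

text \<open>\<open>dd k i c x u\<close> is the divided difference \<open>(rad k i (c * x) u - rad k i c u) / (1 - x)\<close>, in a form
  that remains meaningful at \<open>x = 1\<close>.\<close>

fun dd :: "nat \<Rightarrow> nat \<Rightarrow> complex \<Rightarrow> complex \<Rightarrow> complex \<Rightarrow> complex" where
  "dd k 0 c x u = 0"
| "dd k (Suc i) c x u = 4 * of_nat (k - i) * c\<^sup>2 * u * (1 + x) + 2 * c * (1 - csqrt (rad k i c u))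
     + 2 * c * x * dd k i c x u / (csqrt (rad k i (c * x) u) + csqrt (rad k i c u))"

text \<open>Rationalise the difference of two roots by their sum; this is where the sum must not
  vanish.\<close>

lemma dd_eq:
  assumes "\<And>j. j < i \<Longrightarrow> csqrt (rad k j (c * x) u) + csqrt (rad k j c u) \<noteq> 0"
  shows "rad k i (c * x) u - rad k i c u = (1 - x) * dd k i c x u"
  using assms
proof (induction i)
  case (Suc i)
  define s t where "s = csqrt (rad k i (c * x) u)" and "t = csqrt (rad k i c u)"
  have nz: "s + t \<noteq> 0" using Suc.prems[of i] by (simp add: s_def t_def)
  have "(s - t) * (s + t) = s\<^sup>2 - t\<^sup>2" by (simp add: power2_eq_square algebra_simps)
  also have "\<dots> = (1 - x) * dd k i c x u" using Suc by (simp add: s_def t_def)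
  finally have st: "s - t = (1 - x) * dd k i c x u / (s + t)" using nz by (simp add: field_simps)
  have "rad k (Suc i) (c * x) u - rad k (Suc i) c u =
    (1 - x) * (4 * of_nat (k - i) * c\<^sup>2 * u * (1 + x) + 2 * c * (1 - t)) + 2 * c * x * (s - t)"
    by (simp add: s_def t_def power2_eq_square algebra_simps)
  also have "\<dots> = (1 - x) * dd k (Suc i) c x u"
    unfolding st by (simp add: s_def t_def distrib_left)
  finally show ?case .
qed simp

text \<open>With \<open>x = 1 - w\<^sup>2\<close>, this continues \<open>csqrt (rad k (J + j) (c * x) u)\<close> holomorphically across the
  branch point \<open>w = 0\<close> when \<open>rad k J c u = 0\<close>.\<close>

fun psi :: "nat \<Rightarrow> nat \<Rightarrow> nat \<Rightarrow> complex \<Rightarrow> complex \<Rightarrow> complex \<Rightarrow> complex" where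
  "psi k J 0 c u w = w * csqrt (dd k J c (1 - w\<^sup>2) u)"
| "psi k J (Suc j) c u w = csqrt (1 - 4 * of_nat (k - (J + j)) * (c * (1 - w\<^sup>2))\<^sup>2 * u
     - 2 * (c * (1 - w\<^sup>2)) + 2 * (c * (1 - w\<^sup>2)) * psi k J j c u w)"

lemma psi_eq_csqrt_rad:
  assumes "psi k J 0 c u w = csqrt (rad k J (c * (1 - w\<^sup>2)) u)"
  shows "psi k J j c u w = csqrt (rad k (J + j) (c * (1 - w\<^sup>2)) u)"
  by (induction j) (use assms in simp_all)

lemma Re_less_1: "norm (x::complex) \<le> 1 \<Longrightarrow> x \<noteq> 1 \<Longrightarrow> Re x < 1"
  using complex_Re_le_cmod[of x] by (smt (verit) cmod_eq_Re complex_eqI norm_one one_complex.sel cmod_power2 power2_eq_square zero_eq_power2 power_mono one_power2 norm_ge_zero)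

lemma Re_gt_Im:
  assumes "Re (b\<^sup>2) > 0" "Re b \<ge> 0"
  shows "Re b > \<bar>Im b\<bar>"
proof -
  have "(Im b)\<^sup>2 < (Re b)\<^sup>2" using assms(1) by (simp add: power2_eq_square)
  then show ?thesis using assms(2) by (metis abs_of_nonneg power2_abs power2_less_imp_less abs_ge_zero)
qed

section \<open>Branches and nonvanishing at \<open>u = 1\<close> on the lobe\<close>

locale dominant = positive_radius k 1 r for k r +
  fixes J :: nat and \<rho> :: "complex \<Rightarrow> complex"
  assumes J2: "2 \<le> J" and JSk: "J \<le> Suc k" and \<rho>1: "\<rho> 1 = of_real r"
    and zeroJ: "rrad k J r 1 = 0" and posr: "\<And>i. i \<le> Suc k \<Longrightarrow> i \<noteq> J \<Longrightarrow> rrad k i r 1 > 0"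
    and zero_near: "\<forall>\<^sub>F u in nhds 1. rad k J (\<rho> u) u = 0" and analytic: "\<rho> analytic_on {1}"
begin

lemma sig_pos: "i \<le> Suc k \<Longrightarrow> i \<noteq> J \<Longrightarrow> sig k i 1 r > 0"
  using posr[of i] rrad_eq[of i] sig_nonneg_r[of i] by (auto simp: less_le)

lemma sig_J: "sig k J 1 r = 0"
  using zeroJ rrad_eq[OF JSk] by simp

lemma sig_nonzero: "i \<le> Suc k \<Longrightarrow> i \<noteq> J \<Longrightarrow> norm z \<le> r \<Longrightarrow> sig k i (1::complex) z \<noteq> 0"
  using sig_disc_nonzero[of i z] sig_pos[of i] by simp

lemma rad1_notin: "i \<le> Suc k \<Longrightarrow> i \<noteq> J \<Longrightarrow> norm z \<le> r \<Longrightarrow> rad k i z 1 \<notin> \<real>\<^sub>\<le>\<^sub>0"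
  using rad_notin_nonpos[of i z] sig_nonzero[of i z] by simp

text \<open>At \<open>x = 1\<close> the divided difference is \<open>- r\<close> times the
  \<open>z\<close>-derivative of the radicand. Positivity for \<open>i = J\<close> therefore says
  that \<open>r\<close> is a simple zero of \<open>R_J\<close>.\<close>

lemma dd_1_pos: "i \<le> J \<Longrightarrow> \<exists>d\<ge>0. dd k i (of_real r) 1 1 = of_real d \<and> (1 \<le> i \<longrightarrow> d > 0)"
proof (induction i)
  case (Suc i)
  then obtain d where d: "d \<ge> 0" "dd k i (of_real r) 1 1 = of_real d" "1 \<le> i \<longrightarrow> d > 0" by auto
  define s where "s = sig k i 1 r"
  have s: "0 < s" "s \<le> 1" using sig_pos[of i] sig_le_1[of i] Suc.prems JSk by (auto simp: s_def)
  have cs: "csqrt (rad k i (of_real r) 1) = of_real s"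
    using rad_of_real[of i] sqrt_rrad[of i] rrad_nonneg[of i] Suc.prems JSk by (simp add: s_def csqrt_of_real)
  define e where "e = 8 * real (k - i) * r\<^sup>2 + 2 * r * (1 - s) + r * d / s"
  have "dd k (Suc i) (of_real r) 1 1 = of_real e"
    unfolding dd.simps mult_1_right cs d(2) e_def using s by (simp add: field_simps)
  moreover have "e > 0"
  \<comment> \<open>At \<open>i = 0\<close> strictness comes from the variable term, as
    \<open>k > 0\<close>; afterwards it is inherited through \<open>d\<close>.\<close>
  proof (cases "i = 0")
    case True
    then have "real (k - i) > 0" using J2 JSk by simp
    then show ?thesis unfolding e_def using s d r_pos
      by (intro add_pos_nonneg) auto
  next
    case False
    then show ?thesis unfolding e_def using s d r_pos by (intro add_nonneg_pos) auto
  qed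
  ultimately show ?case by (intro exI[of _ e]) auto
qed auto

lemma dd_eq1:
  assumes "norm x \<le> 1"
  shows "rad k J (of_real r * x) 1 = (1 - x) * dd k J (of_real r) x 1"
proof -
  have "csqrt (rad k j (of_real r * x) 1) + csqrt (rad k j (of_real r) 1) \<noteq> 0" if "j < J" for j
  proof -
    have "Re (csqrt (rad k j (of_real r) 1)) > 0"
      using rad_of_real[of j] posr[of j] rrad_nonneg[of j] that JSk by (simp add: csqrt_of_real)
    then show ?thesis by (rule csqrt_add_nonzero)
  qed
  then have "rad k J (of_real r * x) 1 - rad k J (of_real r) 1 = (1 - x) * dd k J (of_real r) x 1"
    by (rule dd_eq)
  then show ?thesis using rad_of_real[OF JSk] zeroJ by simp
qed

text \<open>The value lies in the closed disc of radius 1 around 1, which touches the imaginary axis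
  only at 0; that value is excluded by uniqueness of the zero.\<close>

lemma Re_rad_J:
  assumes "norm x \<le> 1" "x \<noteq> 1"
  shows "Re (rad k J (of_real r * x) 1) > 0"
proof -
  let ?z = "of_real r * x"
  have z: "norm ?z \<le> r" using assms r_pos by (simp add: norm_mult)
  have "sig k J 1 ?z \<noteq> 0"
    using sig_zero_unique[OF J2 JSk _ z] sig_J assms r_pos by auto
  then have nz: "rad k J ?z 1 \<noteq> 0" using rad_eq[OF JSk z] by simp
  define R where "R = rad k J ?z 1"
  have "norm (1 - R) \<le> 1" using norm_one_minus_rad[OF JSk z] zeroJ by (simp add: R_def)
  then have "(1 - Re R)\<^sup>2 + (Im R)\<^sup>2 \<le> 1" by (simp add: cmod_def)
  then have "2 * Re R \<ge> (Re R)\<^sup>2 + (Im R)\<^sup>2" by (simp add: power2_eq_square algebra_simps)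
  moreover have "(Re R)\<^sup>2 + (Im R)\<^sup>2 > 0" using nz by (simp add: R_def sum_power2_gt_zero_iff complex_eq_iff)
  ultimately show ?thesis by (simp add: R_def)
qed

text \<open>A value \<open>t \<le> 0\<close> would make \<open>Re (R_J)\<close> equal to
  \<open>(1 - Re x) * t \<le> 0\<close>. The case \<open>x = 1\<close> is the simplicity of the
  zero.\<close>

lemma dd_notin:
  assumes "norm x \<le> 1"
  shows "dd k J (of_real r) x 1 \<notin> \<real>\<^sub>\<le>\<^sub>0"
proof (cases "x = 1")
  case True
  then show ?thesis using dd_1_pos[of J] J2 by auto
next
  case False
  show ?thesis
  proof
    assume "dd k J (of_real r) x 1 \<in> \<real>\<^sub>\<le>\<^sub>0"
    then obtain t where t: "dd k J (of_real r) x 1 = of_real t" "t \<le> 0" by (auto elim: nonpos_Reals_cases)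
    have "Re (rad k J (of_real r * x) 1) = (1 - Re x) * t" unfolding dd_eq1[OF assms] t by simp
    also have "\<dots> \<le> 0" using t Re_less_1[OF assms False] by (simp add: mult_nonneg_nonpos)
    finally show False using Re_rad_J[OF assms False] by simp
  qed
qed

text \<open>Both \<open>w\<close> and the principal root \<open>b\<close> of \<open>R_J\<close> have
  squares in the right half-plane, so each has argument less than pi/4 in modulus. Hence
  \<open>b / w\<close> has positive real part and is the principal root of its square
  \<open>dd\<close>.\<close>

lemma psi_1:
  assumes w: "w \<in> lobe"
  shows "psi k J j (of_real r) 1 w = csqrt (rad k (J + j) (of_real r * (1 - w\<^sup>2)) 1)"
proof (rule psi_eq_csqrt_rad)
  define x where "x = 1 - w\<^sup>2"
  have x: "norm x \<le> 1" using w by (simp add: lobe_def x_def)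
  have eq: "rad k J (of_real r * x) 1 = w\<^sup>2 * dd k J (of_real r) x 1"
    using dd_eq1[OF x] by (simp add: x_def)
  show "psi k J 0 (of_real r) 1 w = csqrt (rad k J (of_real r * (1 - w\<^sup>2)) 1)"
  proof (cases "w = 0")
    case True
    then show ?thesis using rad_of_real[OF JSk] zeroJ by simp
  next
    case False
    define b where "b = csqrt (rad k J (of_real r * x) 1)"
    have x1: "x \<noteq> 1" using False by (simp add: x_def)
    have "Re b > \<bar>Im b\<bar>"
      using Re_rad_J[OF x x1] by (intro Re_gt_Im) (auto simp: b_def Re_csqrt)
    moreover have "Re w > \<bar>Im w\<bar>"
      using w Re_less_1[OF x x1] by (intro Re_gt_Im) (auto simp: lobe_def x_def)
    ultimately have "\<bar>Im b\<bar> * \<bar>Im w\<bar> < Re b * Re w"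
      by (intro mult_strict_mono) auto
    then have "Re b * Re w + Im b * Im w > 0"
      using abs_ge_minus_self[of "Im b * Im w"] by (simp add: abs_mult)
    then have "Re (b / w) > 0"
      using False by (simp add: Re_divide complex_eq_iff sum_power2_gt_zero_iff)
    moreover have "(b / w)\<^sup>2 = dd k J (of_real r) x 1"
      using eq False by (simp add: b_def power_divide)
    ultimately have "csqrt (dd k J (of_real r) x 1) = b / w"
      by (intro csqrt_unique) auto
    then show ?thesis using False by (simp add: b_def x_def)
  qed
qed

lemma slice_holomorphic_z: "slice_holomorphic (\<lambda>q. \<rho> (snd q) * (1 - (fst q)\<^sup>2)) (w, 1)"
  using analytic by (intro slice_holomorphic_intros slice_holomorphic_snd) auto

lemma slice_holomorphic_u: "slice_holomorphic (\<lambda>q. snd q) (w, 1)"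
  by (rule slice_holomorphic_snd) auto

lemma slice_holomorphic_dd:
  assumes x: "norm (1 - w\<^sup>2) \<le> 1" and i: "i \<le> J"
  shows "slice_holomorphic (\<lambda>q. dd k i (\<rho> (snd q)) (1 - (fst q)\<^sup>2) (snd q)) (w, 1)"
  using i
proof (induction i)
  case (Suc i)
  have rad: "rad k j (of_real r * (1 - w\<^sup>2)) 1 \<notin> \<real>\<^sub>\<le>\<^sub>0" "rad k j (of_real r) 1 \<notin> \<real>\<^sub>\<le>\<^sub>0" if "j \<le> i" for j
    by (rule rad1_notin; use that Suc.prems JSk x r_pos in \<open>simp add: norm_mult\<close>)+
  have "Re (csqrt (rad k i (of_real r) 1)) > 0"
    using rad_of_real[of i] posr[of i] rrad_nonneg[of i] Suc.prems JSk by (simp add: csqrt_of_real)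
  then have "csqrt (rad k i (of_real r * (1 - w\<^sup>2)) 1) + csqrt (rad k i (of_real r) 1) \<noteq> 0"
    by (rule csqrt_add_nonzero)
  then show ?case unfolding dd.simps using Suc rad analytic
    by (intro slice_holomorphic_intros slice_holomorphic_divide slice_holomorphic_csqrt slice_holomorphic_rad slice_holomorphic_z slice_holomorphic_u slice_holomorphic_snd[of \<rho>]) (auto simp: \<rho>1)
qed (simp add: slice_holomorphic_const)

lemma slice_holomorphic_psi:
  assumes w: "w \<in> lobe" and j: "J + j \<le> Suc k"
  shows "slice_holomorphic (\<lambda>q. psi k J j (\<rho> (snd q)) (snd q) (fst q)) (w, 1)"
  using j
proof (induction j)
  case 0
  have x: "norm (1 - w\<^sup>2) \<le> 1" using w by (simp add: lobe_def)
  show ?case unfolding psi.simps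
    by (intro slice_holomorphic_intros slice_holomorphic_csqrt slice_holomorphic_dd x order_refl) (use dd_notin[OF x] in \<open>simp add: \<rho>1\<close>)
next
  case (Suc j)
  have z: "norm (of_real r * (1 - w\<^sup>2)) \<le> r" using w r_pos by (simp add: lobe_def norm_mult)
  have "rad k (Suc (J + j)) (of_real r * (1 - w\<^sup>2)) 1 \<notin> \<real>\<^sub>\<le>\<^sub>0"
    using Suc.prems z by (intro rad1_notin) auto
  then show ?case unfolding psi.simps using Suc
    by (intro slice_holomorphic_intros slice_holomorphic_csqrt slice_holomorphic_z slice_holomorphic_u) (auto simp: \<rho>1 psi_1[OF w])
qed

definition \<Phi> :: "complex \<Rightarrow> complex \<Rightarrow> complex" where
  "\<Phi> u w = psi k J (Suc k - J) (\<rho> u) u w"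

lemma slice_holomorphic_\<Phi>: "w \<in> lobe \<Longrightarrow> slice_holomorphic (\<lambda>q. \<Phi> (snd q) (fst q)) (w, 1)"
  unfolding \<Phi>_def using JSk by (intro slice_holomorphic_psi) auto

text \<open>\<open>lobe\<close> times \<open>{1}\<close> is compact and contained in the open set of
  good points, so a tube of fixed width around it is too. Half the width goes to each
  coordinate.\<close>

lemma \<Phi>_uniform:
  obtains d M where "d > 0" "\<And>u. u \<in> ball 1 d \<Longrightarrow> \<Phi> u holomorphic_on lobe_nhd d"
    "\<And>u w. u \<in> ball 1 d \<Longrightarrow> w \<in> lobe_nhd d \<Longrightarrow> norm (\<Phi> u w) \<le> M"
proof -
  define f where "f = (\<lambda>q. \<Phi> (snd q) (fst q))"
  define K where "K = lobe \<times> {1::complex}"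
  have K: "compact K" unfolding K_def by (intro compact_Times compact_lobe) auto
  have nice: "slice_holomorphic f q" if "q \<in> K" for q
    using that slice_holomorphic_\<Phi> by (auto simp: K_def f_def)
  have "continuous_on K f"
    using slice_holomorphic_isCont[OF nice] continuous_at_imp_continuous_on by blast
  then have "compact (f ` K)" using K compact_continuous_image by blast
  then obtain M where M: "\<And>q. q \<in> K \<Longrightarrow> norm (f q) < M"
    using compact_imp_bounded bounded_pos_less by (metis imageI)
  define S where "S = interior {q. isCont f q \<and> (\<lambda>w. f (w, snd q)) field_differentiable at (fst q) \<and> norm (f q) < M}"
  have "K \<subseteq> S"
  proof
    fix q assume q: "q \<in> K"
    have "\<forall>\<^sub>F p in nhds q. f p \<in> ball 0 M"
      using nice[OF q] M[OF q] by (intro slice_holomorphic_eventually_in_open) auto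
    with nice[OF q] have "\<forall>\<^sub>F p in nhds q. isCont f p \<and> (\<lambda>w. f (w, snd p)) field_differentiable at (fst p) \<and> norm (f p) < M"
      unfolding slice_holomorphic_def by eventually_elim auto
    then show "q \<in> S" by (auto simp: S_def eventually_nhds interior_def)
  qed
  then obtain e where e: "e > 0" "(\<Union>q\<in>K. ball q e) \<subseteq> S"
    using compact_subset_open_imp_ball_epsilon_subset[OF K, of S] by (auto simp: S_def)
  have S: "(w, u) \<in> S" if "u \<in> ball 1 (e/2)" "w \<in> lobe_nhd (e/2)" for u w
  proof -
    obtain v where v: "v \<in> lobe" "infdist w lobe = dist w v"
      using infdist_attains_inf[OF compact_imp_closed[OF compact_lobe], of w] zero_in_lobe by blast
    have "dist (v, 1) (w, u) \<le> dist v w + dist 1 u"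
      unfolding dist_Pair_Pair by (rule sqrt_sum_squares_le_sum) auto
    also have "\<dots> < e/2 + e/2"
      using that v by (intro add_strict_mono) (auto simp: lobe_nhd_def dist_commute)
    finally have "(w, u) \<in> ball (v, 1) e" by simp
    moreover have "(v, 1) \<in> K" using v by (simp add: K_def)
    ultimately show ?thesis using e(2) by blast
  qed
  have props: "(\<lambda>w. f (w, snd q)) field_differentiable at (fst q) \<and> norm (f q) < M" if "q \<in> S" for q
    using that interior_subset unfolding S_def by fastforce
  show ?thesis
  proof (rule that[of "e/2" M])
    show "\<Phi> u holomorphic_on lobe_nhd (e/2)" if "u \<in> ball 1 (e/2)" for u
      unfolding holomorphic_on_def
      using props[OF S[OF that]] by (auto simp: f_def intro: field_differentiable_at_within)
    show "norm (\<Phi> u w) \<le> M" if "u \<in> ball 1 (e/2)" "w \<in> lobe_nhd (e/2)" for u w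
      using props[OF S[OF that]] by (simp add: f_def)
  qed (use e in auto)
qed

text \<open>At \<open>w = 0\<close> the derivative of \<open>psi\<close> for \<open>j = 0\<close> is
  the root of the nonzero \<open>dd\<close> at \<open>x = 1\<close>. Each outer root multiplies it
  by a nonzero factor, since \<open>w^2\<close> has derivative 0 there. So the square-root
  singularity survives up to the outermost level.\<close>

lemma psi_deriv_nonzero:
  assumes "J + j \<le> Suc k"
  shows "\<exists>D. D \<noteq> 0 \<and> ((\<lambda>w. psi k J j (of_real r) 1 w) has_field_derivative D) (at 0)"
  using assms
proof (induction j)
  case 0
  let ?g = "\<lambda>w. csqrt (dd k J (of_real r) (1 - w\<^sup>2) 1)"
  have "slice_holomorphic (\<lambda>q. csqrt (dd k J (\<rho> (snd q)) (1 - (fst q)\<^sup>2) (snd q))) (0, 1)"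
    using dd_notin[of 1] by (intro slice_holomorphic_csqrt slice_holomorphic_dd) (auto simp: \<rho>1)
  from slice_holomorphic_differentiable[OF this] obtain D where D: "(?g has_field_derivative D) (at 0)"
    by (auto simp: field_differentiable_def \<rho>1)
  have "((\<lambda>w. w * ?g w) has_field_derivative (1 * ?g 0 + D * 0)) (at 0)"
    by (rule DERIV_mult[OF DERIV_ident D])
  moreover have "?g 0 \<noteq> 0" using dd_notin[of 1] by auto
  ultimately show ?case by (intro exI[of _ "?g 0"]) simp
next
  case (Suc j)
  then obtain D where D: "D \<noteq> 0" "((\<lambda>w. psi k J j (of_real r) 1 w) has_field_derivative D) (at 0)" by auto
  let ?R = "\<lambda>w. 1 - 4 * of_nat (k - (J + j)) * (of_real r * (1 - w\<^sup>2))\<^sup>2 * 1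
     - 2 * (of_real r * (1 - w\<^sup>2)) + 2 * (of_real r * (1 - w\<^sup>2)) * psi k J j (of_real r) 1 w"
  have R0: "?R 0 = rad k (Suc (J + j)) (of_real r) 1"
    using psi_1[OF zero_in_lobe, of j] by simp
  have notin: "?R 0 \<notin> \<real>\<^sub>\<le>\<^sub>0"
    unfolding R0 using Suc.prems r_pos by (intro rad1_notin) auto
  have "(?R has_field_derivative 2 * of_real r * D) (at 0)"
    by (rule derivative_eq_intros D refl | simp)+
  from has_field_derivative_csqrt'[OF this notin]
  have "((\<lambda>w. csqrt (?R w)) has_field_derivative (2 * of_real r * D / (2 * csqrt (?R 0)))) (at 0)"
    by (simp only: divide_inverse mult_ac)
  moreover have "2 * of_real r * D / (2 * csqrt (?R 0)) \<noteq> 0"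
    using D(1) r_pos notin by (auto simp del: power_Suc)
  ultimately show ?case by (auto simp only: psi.simps)
qed

lemma deriv_\<Phi>_nonzero: "deriv (\<Phi> 1) 0 \<noteq> 0"
  using psi_deriv_nonzero[of "Suc k - J"] JSk DERIV_imp_deriv by (auto simp: \<Phi>_def[abs_def] \<rho>1)

end

section \<open>Matching the continued function with the series for complex \<open>u\<close>\<close>

lemma gf_conv_radius: "fps_conv_radius (gf k i u) > 0"
  using gf_has_fps_expansion by (simp add: has_fps_expansion_def)

lemma sq_conv_radius: "fps_conv_radius (sq k i u) > 0"
proof -
  have "eval_fps (gf k i u) has_fps_expansion gf k i u"
    by (rule eval_fps_has_fps_expansion[OF gf_conv_radius])
  then have "(\<lambda>z. 1 - 2 * z * eval_fps (gf k i u) z) has_fps_expansion sq k i u"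
    unfolding sq_def by (intro fps_expansion_intros)
  then show ?thesis by (simp add: has_fps_expansion_def)
qed

text \<open>The constant term 1 keeps the real part positive near 0, which selects the principal
  root.\<close>

lemma sq_eval_near:
  "i \<le> Suc k \<Longrightarrow> \<forall>\<^sub>F z in nhds 0. eval_fps (sq k i u) z = csqrt (rad k i z u)"
proof (induction i)
  case (Suc i)
  let ?s = "\<lambda>i. eval_fps (sq k i u)"
  have s: "?s i has_fps_expansion sq k i u" for i
    by (rule eval_fps_has_fps_expansion[OF sq_conv_radius])
  have "(\<lambda>z. ?s (Suc i) z ^ 2) has_fps_expansion sq k (Suc i) u ^ 2"
    by (intro fps_expansion_intros s)
  moreover have "(\<lambda>z. 1 - 4 * (of_nat (k - i) * u) * z ^ 2 - 2 * z + 2 * z * ?s i z) has_fps_expansion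
      1 - 4 * fps_const (of_nat (k - i) * u) * fps_X ^ 2 - 2 * fps_X + 2 * fps_X * sq k i u"
    by (intro fps_expansion_intros s)
  ultimately have "\<forall>\<^sub>F z in nhds 0. ?s (Suc i) z ^ 2 = 1 - 4 * (of_nat (k - i) * u) * z ^ 2 - 2 * z + 2 * z * ?s i z"
    using Suc.prems sq_Suc[of i k u] unfolding has_fps_expansion_def
    by (auto elim: eventually_elim2)
  moreover have "isCont (?s (Suc i)) 0"
    using has_fps_expansion_imp_continuous[OF s[of "Suc i"], of UNIV] by simp
  then have "(?s (Suc i) \<longlongrightarrow> ?s (Suc i) 0) (nhds 0)"
    unfolding isCont_def by (rule tendsto_at_iff_tendsto_nhds[THEN iffD1])
  then have "(?s (Suc i) \<longlongrightarrow> 1) (nhds 0)" by (simp add: eval_fps_at_0 sq_nth)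
  from tendsto_Re[OF this] have "\<forall>\<^sub>F z in nhds 0. Re (?s (Suc i) z) > 0"
    by (rule order_tendstoD) simp
  moreover have "\<forall>\<^sub>F z in nhds 0. ?s i z = csqrt (rad k i z u)" using Suc by simp
  ultimately show ?case
    by eventually_elim (auto intro!: csqrt_unique[symmetric] simp: mult_ac)
qed simp

lemma rad_0: "rad k i 0 u = 1"
  by (cases i) auto

context dominant
begin

text \<open>With \<open>z = \<rho> u * x\<close> the branch point sits at \<open>x = 1\<close> for
  every \<open>u\<close>. Agreement has to be checked only near \<open>x = 0\<close>, where
  \<open>w * csqrt (dd ...)\<close> is close to 1 and is thus the principal root.\<close>

lemma \<Phi>_expansion:
  "\<forall>\<^sub>F u in nhds 1. (\<lambda>x. \<Phi> u (csqrt (1 - x))) has_fps_expansion Abs_fps (\<lambda>n. sq k (Suc k) u $ n * \<rho> u ^ n)"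
proof -
  have "\<forall>\<^sub>F u in nhds 1. \<forall>j\<in>{..<J}. rad k j (\<rho> u) u \<in> - \<real>\<^sub>\<le>\<^sub>0"
  proof (rule eventually_ball_finite)
    show "\<forall>j\<in>{..<J}. \<forall>\<^sub>F u in nhds 1. rad k j (\<rho> u) u \<in> - \<real>\<^sub>\<le>\<^sub>0"
    proof
      fix j assume j: "j \<in> {..<J}"
      have notin: "rad k i (\<rho> 1) 1 \<notin> \<real>\<^sub>\<le>\<^sub>0" if "i < J" for i
        unfolding \<rho>1 by (rule rad1_notin) (use that JSk r_pos in auto)
      have "(\<lambda>u. rad k j (\<rho> u) u) analytic_on {1}"
        by (rule analytic_on_rad) (use notin j analytic in \<open>auto intro: analytic_intros\<close>)
      then have "isCont (\<lambda>u. rad k j (\<rho> u) u) 1" by (rule analytic_at_imp_isCont)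
      then have "((\<lambda>u. rad k j (\<rho> u) u) \<longlongrightarrow> rad k j (\<rho> 1) 1) (nhds 1)"
        using tendsto_at_iff_tendsto_nhds[of "\<lambda>u. rad k j (\<rho> u) u" 1] by (simp only: isCont_def)
      then show "\<forall>\<^sub>F u in nhds 1. rad k j (\<rho> u) u \<in> - \<real>\<^sub>\<le>\<^sub>0"
        by (rule topological_tendstoD) (use notin j in auto)
    qed
  qed auto
  with zero_near show ?thesis
  proof eventually_elim
    case (elim u)
    define c where "c = \<rho> u"
    have dd: "rad k J (c * x) u = (1 - x) * dd k J c x u" for x
    proof -
      have "csqrt (rad k j (c * x) u) + csqrt (rad k j c u) \<noteq> 0" if "j < J" for j
      proof -
        have "Re (csqrt (rad k j c u)) > 0" using elim(2) that by (intro Re_csqrt_pos) (simp add: c_def)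
        then show ?thesis by (rule csqrt_add_nonzero)
      qed
      then have "rad k J (c * x) u - rad k J c u = (1 - x) * dd k J c x u" by (rule dd_eq)
      then show ?thesis using elim(1) by (simp add: c_def)
    qed
    have "((\<lambda>x. c * x) \<longlongrightarrow> c * 0) (nhds 0)"
      by (intro tendsto_mult tendsto_const filterlim_ident)
    then have lim0: "((\<lambda>x. c * x) \<longlongrightarrow> 0) (nhds 0)" by simp
    have "(\<lambda>x. rad k J (c * x) u) analytic_on {0}"
      by (rule analytic_on_rad) (auto intro: analytic_intros simp: rad_0)
    then have "(\<lambda>x. csqrt (1 - x) * csqrt (rad k J (c * x) u / (1 - x))) analytic_on {0}"
      by (intro analytic_intros) (auto simp: rad_0)
    then have "isCont (\<lambda>x. csqrt (1 - x) * csqrt (rad k J (c * x) u / (1 - x))) 0"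
      by (rule analytic_at_imp_isCont)
    then have "((\<lambda>x. csqrt (1 - x) * csqrt (rad k J (c * x) u / (1 - x))) \<longlongrightarrow> 1) (nhds 0)"
      using tendsto_at_iff_tendsto_nhds[of "\<lambda>x. csqrt (1 - x) * csqrt (rad k J (c * x) u / (1 - x))" 0]
      by (simp add: isCont_def rad_0)
    from tendsto_Re[OF this] have "\<forall>\<^sub>F x in nhds 0. Re (csqrt (1 - x) * csqrt (rad k J (c * x) u / (1 - x))) > 0"
      by (rule order_tendstoD) simp
    moreover have "\<forall>\<^sub>F x in nhds 0. x \<in> - {1::complex}"
      by (rule eventually_nhds_in_open) auto
    moreover have "\<forall>\<^sub>F x in nhds 0. eval_fps (sq k (Suc k) u) (c * x) = csqrt (rad k (Suc k) (c * x) u)"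
      using sq_eval_near[of "Suc k" k u] lim0 by (rule eventually_compose_filterlim) simp
    moreover have "\<forall>\<^sub>F x in nhds 0. c * x \<in> eball 0 (fps_conv_radius (sq k (Suc k) u))"
      using lim0 by (rule topological_tendstoD) (use sq_conv_radius in \<open>auto simp: zero_ereal_def\<close>)
    ultimately have "\<forall>\<^sub>F x in nhds 0. (\<lambda>n. Abs_fps (\<lambda>n. sq k (Suc k) u $ n * c ^ n) $ n * x ^ n) sums \<Phi> u (csqrt (1 - x))"
    proof eventually_elim
      case (elim x)
      define w where "w = csqrt (1 - x)"
      have w: "1 - w\<^sup>2 = x" by (simp add: w_def)
      have D: "dd k J c x u = rad k J (c * x) u / (1 - x)" using dd[of x] elim(2) by simp
      have "psi k J 0 c u w = csqrt (rad k J (c * (1 - w\<^sup>2)) u)"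
        unfolding psi.simps w
      proof (rule csqrt_unique[symmetric])
        show "(w * csqrt (dd k J c x u))\<^sup>2 = rad k J (c * x) u"
          using dd[of x] by (simp add: power_mult_distrib w_def)
        show "0 < Re (w * csqrt (dd k J c x u)) \<or> Re (w * csqrt (dd k J c x u)) = 0 \<and> 0 \<le> Im (w * csqrt (dd k J c x u))"
          using elim(1) unfolding D w_def by blast
      qed
      from psi_eq_csqrt_rad[OF this, of "Suc k - J"] have "\<Phi> u w = csqrt (rad k (Suc k) (c * x) u)"
        using JSk by (simp add: \<Phi>_def w c_def[symmetric] del: rad.simps)
      also have "\<dots> = eval_fps (sq k (Suc k) u) (c * x)" using elim(3) by simp
      finally have "\<Phi> u w = eval_fps (sq k (Suc k) u) (c * x)" .
      moreover have "(\<lambda>n. sq k (Suc k) u $ n * (c * x) ^ n) sums eval_fps (sq k (Suc k) u) (c * x)"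
        using elim(4) by (intro sums_eval_fps) auto
      ultimately show ?case by (simp add: w_def power_mult_distrib mult_ac)
    qed
    then show ?case unfolding c_def by (rule has_fps_expansionI)
  qed
qed

end

section \<open>Quasi-powers\<close>

lemma deriv_mult_power:
  fixes f b :: "complex \<Rightarrow> complex"
  assumes hol: "f holomorphic_on S" "b holomorphic_on S" and S: "open S" "a \<in> S" and 1: "f a = 1" "b a = 1"
  shows "deriv (\<lambda>u. f u * b u ^ N) a = deriv f a + of_nat N * deriv b a"
    and "deriv (deriv (\<lambda>u. f u * b u ^ N)) a = deriv (deriv f) a + 2 * of_nat N * deriv f a * deriv b a
      + of_nat N * (of_nat N - 1) * (deriv b a)\<^sup>2 + of_nat N * deriv (deriv b) a"
proof -
  have D: "(g has_field_derivative deriv g u) (at u)" if "g holomorphic_on S" "u \<in> S" for g u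
    using that S by (intro holomorphic_derivI)
  have 1: "((\<lambda>u. f u * b u ^ N) has_field_derivative
      deriv f u * b u ^ N + of_nat N * (deriv b u * b u ^ (N - Suc 0)) * f u) (at u)" if "u \<in> S" for u
    by (rule DERIV_mult[OF D[OF hol(1) that] DERIV_power[OF D[OF hol(2) that]]])
  note eq = DERIV_imp_deriv[OF 1]
  show "deriv (\<lambda>u. f u * b u ^ N) a = deriv f a + of_nat N * deriv b a"
    using eq[OF S(2)] assms by simp
  have "deriv (deriv (\<lambda>u. f u * b u ^ N)) a =
      deriv (\<lambda>u. deriv f u * b u ^ N + of_nat N * (deriv b u * b u ^ (N - Suc 0)) * f u) a"
    using S by (intro deriv_cong_ev refl eventually_mono[OF eventually_nhds_in_open[OF S]] eq)
  also have "\<dots> = deriv (deriv f) a + 2 * of_nat N * deriv f a * deriv b a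
      + of_nat N * (of_nat N - 1) * (deriv b a)\<^sup>2 + of_nat N * deriv (deriv b) a"
  proof (rule DERIV_imp_deriv)
    note D' = D[OF holomorphic_deriv[OF hol(1) S(1)] S(2)] D[OF holomorphic_deriv[OF hol(2) S(1)] S(2)]
      D[OF hol(1) S(2)] D[OF hol(2) S(2)]
    have "((\<lambda>u. deriv f u * b u ^ N + of_nat N * (deriv b u * b u ^ (N - Suc 0)) * f u) has_field_derivative
       (deriv (deriv f) a * b a ^ N + of_nat N * (deriv b a * b a ^ (N - Suc 0)) * deriv f a) +
       ((0 * (deriv b a * b a ^ (N - Suc 0)) + (deriv (deriv b) a * b a ^ (N - Suc 0) +
          of_nat (N - Suc 0) * (deriv b a * b a ^ (N - Suc 0 - Suc 0)) * deriv b a) * of_nat N) * f a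
        + deriv f a * (of_nat N * (deriv b a * b a ^ (N - Suc 0))))) (at a)"
      by (intro DERIV_add DERIV_mult DERIV_power DERIV_const D')
    then show "((\<lambda>u. deriv f u * b u ^ N + of_nat N * (deriv b u * b u ^ (N - Suc 0)) * f u) has_field_derivative
      deriv (deriv f) a + 2 * of_nat N * deriv f a * deriv b a
      + of_nat N * (of_nat N - 1) * (deriv b a)\<^sup>2 + of_nat N * deriv (deriv b) a) (at a)"
      by (rule DERIV_cong) (use assms in \<open>cases N; simp add: algebra_simps power2_eq_square\<close>)
  qed
  finally show "deriv (deriv (\<lambda>u. f u * b u ^ N)) a = deriv (deriv f) a + 2 * of_nat N * deriv f a * deriv b a
      + of_nat N * (of_nat N - 1) * (deriv b a)\<^sup>2 + of_nat N * deriv (deriv b) a" .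
qed

text \<open>Factor \<open>s^2\<close> out of the power series; the limit is the coefficient of order
  two.\<close>

lemma second_order_limit:
  fixes f :: "complex \<Rightarrow> complex"
  assumes an: "f analytic_on {0}" and 0: "f 0 = 0" "deriv f 0 = 0"
  shows "((\<lambda>s. f s / s\<^sup>2) \<longlongrightarrow> deriv (deriv f) 0 / 2) (at 0)"
proof -
  define F where "F = fps_expansion f 0"
  have F: "f has_fps_expansion F" unfolding F_def by (rule analytic_at_imp_has_fps_expansion_0[OF an])
  have nth: "F $ 0 = 0" "F $ Suc 0 = 0" "F $ 2 = deriv (deriv f) 0 / 2"
    using 0 fps_nth_fps_expansion[OF F] by (simp_all add: numeral_2_eq_2)
  define G where "G = fps_shift 2 F"
  have FG: "F = fps_X ^ 2 * G"
    unfolding G_def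
  proof (rule fps_ext)
    fix n show "F $ n = (fps_X ^ 2 * fps_shift 2 F) $ n"
    proof (cases "n < 2")
      case True
      then have "n = 0 \<or> n = 1" by auto
      then show ?thesis using nth by (auto simp: fps_X_power_mult_nth)
    next
      case False
      then have "n = Suc (Suc (n - 2))" by simp
      with False show ?thesis by (auto simp: fps_X_power_mult_nth)
    qed
  qed
  have G: "eval_fps G has_fps_expansion G"
    using F by (intro eval_fps_has_fps_expansion) (simp add: G_def has_fps_expansion_def)
  have "(\<lambda>s. s ^ 2 * eval_fps G s) has_fps_expansion fps_X ^ 2 * G"
    by (intro fps_expansion_intros G)
  then have "\<forall>\<^sub>F s in nhds 0. f s = s ^ 2 * eval_fps G s"
    using F unfolding FG[symmetric] has_fps_expansion_def by (auto elim: eventually_elim2)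
  then have ev: "\<forall>\<^sub>F s in at 0. f s / s\<^sup>2 = eval_fps G s"
    unfolding eventually_at_filter by eventually_elim auto
  have "isCont (eval_fps G) 0"
    using has_fps_expansion_imp_continuous[OF G, of UNIV] by simp
  moreover have "eval_fps G 0 = deriv (deriv f) 0 / 2"
    using nth(3) unfolding G_def eval_fps_at_0 by (simp add: numeral_2_eq_2)
  ultimately have "((eval_fps G) \<longlongrightarrow> deriv (deriv f) 0 / 2) (at 0)"
    by (simp only: isCont_def)
  then show ?thesis by (subst tendsto_cong[OF ev])
qed

lemma tendsto_Suc_over_n: "(\<lambda>n. of_nat (Suc n) / of_nat n :: complex) \<longlonglongrightarrow> 1"
proof -
  have "(\<lambda>n. 1 + 1 / of_nat n :: complex) \<longlonglongrightarrow> 1 + 0"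
    by (intro tendsto_intros lim_const_over_n)
  moreover have "\<forall>\<^sub>F n in sequentially. (1 + 1 / of_nat n :: complex) = of_nat (Suc n) / of_nat n"
    using eventually_gt_at_top[of 0] by eventually_elim (simp add: field_simps)
  ultimately show ?thesis using Lim_transform_eventually by force
qed

text \<open>The normalisation \<open>s\<close> does not depend on \<open>u\<close> and cancels in
  the probability generating function. The exponent \<open>Suc n\<close> stems from the index shift
  between \<open>sq\<close> and the sizes.\<close>

locale quasi_powers =
  fixes T :: "nat \<Rightarrow> 'a set" and X :: "'a \<Rightarrow> nat" and \<rho> c :: "complex \<Rightarrow> complex"
    and s :: "nat \<Rightarrow> complex" and d \<epsilon> :: real
  assumes fin: "finite (T n)" and d: "d > 0" and \<rho>_hol: "\<rho> holomorphic_on ball 1 d"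
    and \<rho>_nz: "u \<in> ball 1 d \<Longrightarrow> \<rho> u \<noteq> 0"
    and lim: "uniform_limit (ball 1 d) (\<lambda>n u. (\<Sum>t\<in>T n. u ^ X t) * \<rho> u ^ Suc n / s n) c sequentially"
    and c1: "c 1 \<noteq> 0" and \<epsilon>: "\<epsilon> > 0" and X_ge: "t \<in> T n \<Longrightarrow> \<epsilon> * real n \<le> real (X t)"
begin

definition P where "P n u = (\<Sum>t\<in>T n. u ^ X t)" for n and u :: complex
definition A where "A n u = inverse (s n) * (P n u * \<rho> u ^ Suc n)"
definition B where "B u = \<rho> 1 / \<rho> u"
definition G where "G n u = inverse (A n 1) * A n u"
definition var where "var = deriv (deriv B) 1 + deriv B 1 - (deriv B 1)\<^sup>2"

lemma one_in: "1 \<in> ball (1::complex) d"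
  using d by simp

lemma A_lim: "uniform_limit (ball 1 d) A c sequentially"
proof -
  have "A = (\<lambda>n u. (\<Sum>t\<in>T n. u ^ X t) * \<rho> u ^ Suc n / s n)"
    by (intro ext) (simp add: A_def P_def divide_inverse mult_ac)
  then show ?thesis using lim by simp
qed

lemma A_hol: "A n holomorphic_on ball 1 d"
  unfolding A_def P_def by (intro holomorphic_intros \<rho>_hol)

lemma B_hol: "B holomorphic_on ball 1 d"
  unfolding B_def using \<rho>_nz by (intro holomorphic_intros \<rho>_hol) auto

lemma B_1: "B 1 = 1"
  using \<rho>_nz[OF one_in] by (simp add: B_def)

lemma c_hol: "c holomorphic_on ball 1 d"
proof (rule holomorphic_uniform_sequence[OF _ A_hol])
  fix x :: complex assume "x \<in> ball 1 d"
  then obtain e where "e > 0" "cball x e \<subseteq> ball 1 d" using open_contains_cball open_ball by metis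
  then show "\<exists>e>0. cball x e \<subseteq> ball 1 d \<and> uniform_limit (cball x e) A c sequentially"
    using uniform_limit_on_subset[OF A_lim] by blast
qed auto

lemma A_lim_1: "(\<lambda>n. A n 1) \<longlonglongrightarrow> c 1"
  using tendsto_uniform_limitI[OF A_lim one_in] .

lemma A_nz: "\<forall>\<^sub>F n in sequentially. A n 1 \<noteq> 0"
  using tendsto_imp_eventually_ne[OF A_lim_1 c1] .

text \<open>Locally uniform limits of holomorphic functions may be differentiated, so the
  corrections from \<open>G\<close> stay bounded.\<close>

lemma deriv_G_lim: "(\<lambda>n. deriv (G n) 1) \<longlonglongrightarrow> inverse (c 1) * deriv c 1"
  and deriv2_G_lim: "(\<lambda>n. deriv (deriv (G n)) 1) \<longlonglongrightarrow> inverse (c 1) * deriv (deriv c) 1"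
proof -
  have l: "(\<lambda>n. (deriv ^^ m) (A n) 1) \<longlonglongrightarrow> (deriv ^^ m) c 1" for m
    by (rule higher_deriv_complex_uniform_limit[OF A_lim]) (use A_hol d in auto)
  have 1: "deriv (G n) u = inverse (A n 1) * deriv (A n) u" if "u \<in> ball 1 d" for n u
    unfolding G_def using holomorphic_derivI[OF A_hol _ that, of n]
    by (intro DERIV_imp_deriv DERIV_cmult) auto
  have 2: "deriv (deriv (G n)) 1 = inverse (A n 1) * deriv (deriv (A n)) 1" for n
  proof -
    have "deriv (deriv (G n)) 1 = deriv (\<lambda>u. inverse (A n 1) * deriv (A n) u) 1"
      by (intro deriv_cong_ev refl eventually_mono[OF eventually_nhds_in_open[OF _ one_in]] 1) auto
    also have "\<dots> = inverse (A n 1) * deriv (deriv (A n)) 1"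
      using holomorphic_derivI[OF holomorphic_deriv[OF A_hol] _ one_in, of n]
      by (intro DERIV_imp_deriv DERIV_cmult) auto
    finally show ?thesis .
  qed
  show "(\<lambda>n. deriv (G n) 1) \<longlonglongrightarrow> inverse (c 1) * deriv c 1"
    unfolding 1[OF one_in] using l[of 1] by (intro tendsto_intros A_lim_1 c1) simp
  show "(\<lambda>n. deriv (deriv (G n)) 1) \<longlonglongrightarrow> inverse (c 1) * deriv (deriv c) 1"
    unfolding 2 using l[of 2] by (intro tendsto_intros A_lim_1 c1) (simp add: numeral_2_eq_2)
qed

lemma G_hol: "G n holomorphic_on ball 1 d"
  unfolding G_def by (intro holomorphic_intros A_hol)

lemma nonempty: "A n 1 \<noteq> 0 \<Longrightarrow> T n \<noteq> {}"
  by (auto simp: A_def P_def)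

lemma card_pos: "A n 1 \<noteq> 0 \<Longrightarrow> card (T n) > 0"
  using nonempty fin by (simp add: card_gt_0_iff)

lemma P_1: "P n 1 = of_nat (card (T n))"
  by (simp add: P_def)

lemma pgf:
  assumes "A n 1 \<noteq> 0" "u \<in> ball 1 d"
  shows "P n u / of_nat (card (T n)) = G n u * B u ^ Suc n"
proof -
  have nz: "P n 1 \<noteq> 0" "s n \<noteq> 0" "\<rho> 1 \<noteq> 0" "\<rho> u \<noteq> 0"
    using assms \<rho>_nz[OF one_in] \<rho>_nz[OF assms(2)] by (auto simp: A_def)
  then show ?thesis
    unfolding P_1[symmetric] G_def A_def B_def
    by (simp add: power_divide field_simps del: power_Suc)
qed

lemma G_1: "A n 1 \<noteq> 0 \<Longrightarrow> G n 1 = 1"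
  by (simp add: G_def)

definition mean where "mean n = (\<Sum>t\<in>T n. real (X t)) / real (card (T n))"
definition fact2 where "fact2 n = (\<Sum>t\<in>T n. real (X t) * (real (X t) - 1)) / real (card (T n))"

lemma deriv_P: "deriv (P n) u = (\<Sum>t\<in>T n. of_nat (X t) * u ^ (X t - 1))"
  unfolding P_def by (rule DERIV_imp_deriv) (auto intro!: derivative_eq_intros)

lemma deriv2_P: "deriv (deriv (P n)) 1 = (\<Sum>t\<in>T n. of_nat (X t) * (of_nat (X t) - 1))"
proof -
  have *: "of_nat m + of_nat m * of_nat (m - Suc 0) = (of_nat m * of_nat m :: complex)" for m
    by (cases m) (auto simp: algebra_simps)
  have "deriv (\<lambda>u. \<Sum>t\<in>T n. of_nat (X t) * u ^ (X t - 1)) (1::complex) = (\<Sum>t\<in>T n. of_nat (X t) * (of_nat (X t) - 1))"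
    by (rule DERIV_imp_deriv) (auto intro!: derivative_eq_intros sum.cong simp: * algebra_simps)
  then show ?thesis by (simp add: deriv_P[abs_def])
qed

text \<open>Factorial moments are the derivatives at 1 of the probability generating function
  \<open>G n u * B u ^ Suc n\<close>.\<close>

lemma mean_fact2:
  assumes "A n 1 \<noteq> 0"
  shows "of_real (mean n) = deriv (G n) 1 + of_nat (Suc n) * deriv B 1"
    and "of_real (fact2 n) = deriv (deriv (G n)) 1 + 2 * of_nat (Suc n) * deriv (G n) 1 * deriv B 1
      + of_nat (Suc n) * (of_nat (Suc n) - 1) * (deriv B 1)\<^sup>2 + of_nat (Suc n) * deriv (deriv B) 1"
proof -
  let ?C = "inverse (of_nat (card (T n))) :: complex"
  have ev: "\<forall>\<^sub>F u in nhds 1. ?C * P n u = G n u * B u ^ Suc n"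
    using eventually_nhds_in_open[OF _ one_in]
    by (rule eventually_mono) (use pgf[OF assms] in \<open>auto simp: divide_inverse mult_ac\<close>)
  have P: "P n holomorphic_on UNIV" unfolding P_def by (intro holomorphic_intros)
  have 1: "deriv (\<lambda>u. ?C * P n u) u = ?C * deriv (P n) u" for u
    using holomorphic_derivI[OF P] by (intro DERIV_imp_deriv DERIV_cmult) auto
  have 2: "deriv (deriv (\<lambda>u. ?C * P n u)) 1 = ?C * deriv (deriv (P n)) 1"
    unfolding 1[abs_def] using holomorphic_derivI[OF holomorphic_deriv[OF P]]
    by (intro DERIV_imp_deriv DERIV_cmult) auto
  note dmp = deriv_mult_power[OF G_hol[of n] B_hol _ one_in G_1[OF assms] B_1, of "Suc n"]
  have "of_real (mean n) = ?C * deriv (P n) 1"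
    unfolding mean_def deriv_P by (simp add: divide_inverse mult_ac)
  also have "\<dots> = deriv (\<lambda>u. G n u * B u ^ Suc n) 1"
    unfolding 1[symmetric] by (rule deriv_cong_ev[OF ev refl])
  finally show "of_real (mean n) = deriv (G n) 1 + of_nat (Suc n) * deriv B 1" using dmp(1) by simp
  have "of_real (fact2 n) = ?C * deriv (deriv (P n)) 1"
    unfolding fact2_def deriv2_P by (simp add: divide_inverse mult_ac)
  also have "\<dots> = deriv (deriv (\<lambda>u. G n u * B u ^ Suc n)) 1"
    unfolding 2[symmetric] using higher_deriv_cong_ev[OF ev refl, of 2] by (simp add: numeral_2_eq_2)
  finally show "of_real (fact2 n) = deriv (deriv (G n)) 1 + 2 * of_nat (Suc n) * deriv (G n) 1 * deriv B 1
      + of_nat (Suc n) * (of_nat (Suc n) - 1) * (deriv B 1)\<^sup>2 + of_nat (Suc n) * deriv (deriv B) 1"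
    using dmp(2) by simp
qed

lemma mean_lim: "(\<lambda>n. complex_of_real (mean n / real n)) \<longlonglongrightarrow> deriv B 1"
proof -
  have "(\<lambda>n. deriv (G n) 1 * (1 / of_nat n) + of_nat (Suc n) / of_nat n * deriv B 1) \<longlonglongrightarrow>
      inverse (c 1) * deriv c 1 * 0 + 1 * deriv B 1"
    by (intro tendsto_intros deriv_G_lim lim_const_over_n tendsto_Suc_over_n)
  moreover have "\<forall>\<^sub>F n in sequentially. deriv (G n) 1 * (1 / of_nat n) + of_nat (Suc n) / of_nat n * deriv B 1
      = complex_of_real (mean n / real n)"
    using A_nz by eventually_elim (simp add: mean_fact2 add_divide_distrib del: of_nat_Suc)
  ultimately show ?thesis using Lim_transform_eventually by force
qed

definition variance where "variance n = fact2 n + mean n - (mean n)\<^sup>2"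

lemma variance_lim: "(\<lambda>n. complex_of_real (variance n / real n)) \<longlonglongrightarrow> var"
proof -
  let ?g1 = "\<lambda>n. deriv (G n) 1" and ?g2 = "\<lambda>n. deriv (deriv (G n)) 1"
  have "(\<lambda>n. (?g2 n + ?g1 n - ?g1 n ^ 2) * (1 / of_nat n) + of_nat (Suc n) / of_nat n * var) \<longlonglongrightarrow>
      (inverse (c 1) * deriv (deriv c) 1 + inverse (c 1) * deriv c 1 - (inverse (c 1) * deriv c 1) ^ 2) * 0 + 1 * var"
    by (intro tendsto_intros deriv_G_lim deriv2_G_lim lim_const_over_n tendsto_Suc_over_n)
  moreover have "\<forall>\<^sub>F n in sequentially. (?g2 n + ?g1 n - ?g1 n ^ 2) * (1 / of_nat n) + of_nat (Suc n) / of_nat n * var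
      = complex_of_real (variance n / real n)"
    using A_nz
  proof eventually_elim
    case (elim n)
    \<comment> \<open>The terms quadratic in \<open>n\<close> and the mixed terms
      \<open>n * deriv (G n) 1 * deriv B 1\<close> cancel exactly, leaving a linear term plus a
      bounded one.\<close>
    have "complex_of_real (variance n) = ?g2 n + ?g1 n - ?g1 n ^ 2 + of_nat (Suc n) * var"
      unfolding variance_def of_real_add of_real_diff of_real_power mean_fact2[OF elim] var_def
      by (simp add: power2_eq_square algebra_simps)
    then show ?case by (simp add: add_divide_distrib del: of_nat_Suc)
  qed
  ultimately show ?thesis using Lim_transform_eventually by force
qed

lemma mean_ge: "T n \<noteq> {} \<Longrightarrow> \<epsilon> * real n \<le> mean n"
proof -
  assume "T n \<noteq> {}"
  then have "card (T n) > 0" using fin by (simp add: card_gt_0_iff)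
  moreover have "(\<Sum>t\<in>T n. \<epsilon> * real n) \<le> (\<Sum>t\<in>T n. real (X t))" by (intro sum_mono X_ge)
  ultimately show ?thesis by (simp add: mean_def field_simps)
qed

definition \<mu> where "\<mu> = Re (deriv B 1)"
definition v where "v = Re var"

lemma mean_lim': "(\<lambda>n. mean n / real n) \<longlonglongrightarrow> \<mu>"
  using tendsto_Re[OF mean_lim] by (simp add: \<mu>_def)

lemma variance_lim': "(\<lambda>n. variance n / real n) \<longlonglongrightarrow> v"
  using tendsto_Re[OF variance_lim] by (simp add: v_def)

text \<open>The constant is a limit of real numbers, hence real.\<close>

lemma \<mu>_eq: "of_real \<mu> = deriv B 1"
  using tendsto_Im[OF mean_lim] LIMSEQ_unique[of "\<lambda>n. 0" "Im (deriv B 1)" 0] by (simp add: complex_eq_iff \<mu>_def)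

lemma v_eq: "of_real v = var"
  using tendsto_Im[OF variance_lim] LIMSEQ_unique[of "\<lambda>n. 0" "Im var" 0] by (simp add: complex_eq_iff v_def)

text \<open>Follows from the linear lower bound on \<open>X\<close>; a nonzero constant is required
  for the asymptotic equivalence of the means.\<close>

lemma \<mu>_pos: "\<mu> > 0"
proof -
  have "\<forall>\<^sub>F n in sequentially. \<epsilon> \<le> mean n / real n"
    using A_nz eventually_gt_at_top[of 0]
    by eventually_elim (use mean_ge nonempty in \<open>auto simp: field_simps\<close>)
  then have "\<epsilon> \<le> \<mu>" by (intro tendsto_lowerbound[OF mean_lim']) auto
  then show ?thesis using \<epsilon> by simp
qed

lemma expectation_eq:
  assumes "A n 1 \<noteq> 0"
  shows "measure_pmf.expectation (pmf_of_set (T n)) f = (\<Sum>t\<in>T n. f t) / real (card (T n))" 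
  using integral_pmf_of_set[OF nonempty[OF assms] fin] .

lemma variance_eq:
  assumes "A n 1 \<noteq> 0"
  shows "measure_pmf.variance (pmf_of_set (T n)) (\<lambda>t. real (X t)) = variance n"
proof -
  have card: "real (card (T n)) \<noteq> 0" using card_pos[OF assms] by simp
  have "measure_pmf.variance (pmf_of_set (T n)) (\<lambda>t. real (X t)) = (\<Sum>t\<in>T n. (real (X t) - mean n)\<^sup>2) / real (card (T n))"
    by (simp only: expectation_eq[OF assms] mean_def)
  also have "(\<Sum>t\<in>T n. (real (X t) - mean n)\<^sup>2) =
      (\<Sum>t\<in>T n. real (X t) * (real (X t) - 1) + real (X t) - 2 * mean n * real (X t) + (mean n)\<^sup>2)"
    by (intro sum.cong) (auto simp: power2_eq_square algebra_simps)
  also have "\<dots> = (\<Sum>t\<in>T n. real (X t) * (real (X t) - 1)) + (\<Sum>t\<in>T n. real (X t))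
     - 2 * mean n * (\<Sum>t\<in>T n. real (X t)) + real (card (T n)) * (mean n)\<^sup>2"
    by (simp only: sum.distrib sum_subtractf sum_distrib_left sum_constant)
  also have "\<dots> / real (card (T n)) = fact2 n + mean n - 2 * mean n * mean n + (mean n)\<^sup>2"
    using card unfolding fact2_def mean_def by (simp add: add_divide_distrib diff_divide_distrib)
  finally show ?thesis by (simp add: variance_def power2_eq_square)
qed

lemma v_nonneg: "v \<ge> 0"
proof -
  have "\<forall>\<^sub>F n in sequentially. 0 \<le> variance n / real n"
    using A_nz
  proof eventually_elim
    case (elim n)
    have "0 \<le> measure_pmf.variance (pmf_of_set (T n)) (\<lambda>t. real (X t))"
      by (intro integral_nonneg_AE) auto
    then show ?case using variance_eq[OF elim] by simp
  qed
  then show ?thesis by (intro tendsto_lowerbound[OF variance_lim']) auto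
qed

lemma G_lim_seq:
  assumes "u \<longlonglongrightarrow> 1"
  shows "(\<lambda>n. G n (u n)) \<longlonglongrightarrow> 1"
proof -
  have ball: "\<forall>\<^sub>F n in sequentially. u n \<in> ball 1 d"
    using topological_tendstoD[OF assms open_ball one_in] .
  have "isCont c 1" using c_hol one_in holomorphic_on_imp_continuous_on continuous_on_eq_continuous_at[OF open_ball] by blast
  then have c: "(\<lambda>n. c (u n)) \<longlonglongrightarrow> c 1" using assms by (rule isCont_tendsto_compose)
  have "(\<lambda>n. A n (u n) - c (u n)) \<longlonglongrightarrow> 0"
  proof (rule tendstoI)
    fix e :: real assume "e > 0"
    from uniform_limitD[OF A_lim this] ball show "\<forall>\<^sub>F n in sequentially. dist (A n (u n) - c (u n)) 0 < e"
      by eventually_elim (auto simp: dist_norm)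
  qed
  from tendsto_add[OF this c] have "(\<lambda>n. A n (u n)) \<longlonglongrightarrow> c 1" by simp
  then have "(\<lambda>n. inverse (A n 1) * A n (u n)) \<longlonglongrightarrow> inverse (c 1) * c 1"
    by (intro tendsto_intros A_lim_1 c1)
  then show ?thesis using c1 by (simp add: G_def)
qed

text \<open>The logarithm of \<open>B\<close> along the unit circle with the drift removed, so that
  it starts at order two; its second derivative at 0 is \<open>- var\<close>.\<close>

definition L where "L z = Ln (B (exp (\<i> * z))) - \<i> * deriv B 1 * z"

lemma L_props: "L analytic_on {0}" "L 0 = 0" "deriv L 0 = 0" "deriv (deriv L) 0 = - var"
  "\<forall>\<^sub>F z in nhds 0. exp (L z) = B (exp (\<i> * z)) * exp (- (\<i> * deriv B 1 * z))"
proof -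
  let ?e = "\<lambda>z. exp (\<i> * z)"
  have Ban: "B analytic_on {1}" using B_hol d by (auto simp: analytic_on_def)
  have "(B \<circ> ?e) analytic_on {0}"
    using Ban by (intro analytic_on_compose analytic_intros) auto
  then have Be: "(\<lambda>z. B (?e z)) analytic_on {0}" by (simp add: o_def)
  show L: "L analytic_on {0}"
    unfolding L_def using Be B_1 by (intro analytic_intros) auto
  show "L 0 = 0" by (simp add: L_def B_1)
  have "isCont (\<lambda>z. B (?e z)) 0" using analytic_at_imp_isCont[OF Be] .
  then have "((\<lambda>z. B (?e z)) \<longlongrightarrow> 1) (nhds 0)"
    using tendsto_at_iff_tendsto_nhds[of "\<lambda>z. B (?e z)" 0] by (simp add: isCont_def B_1)
  then have "\<forall>\<^sub>F z in nhds 0. B (?e z) \<in> - \<real>\<^sub>\<le>\<^sub>0"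
    by (rule topological_tendstoD) auto
  moreover have "((\<lambda>z. ?e z) \<longlongrightarrow> ?e 0) (nhds 0)"
  proof -
    have "isCont ?e 0" by (intro continuous_intros)
    then show ?thesis using tendsto_at_iff_tendsto_nhds[of ?e 0] by (simp only: isCont_def)
  qed
  then have "\<forall>\<^sub>F z in nhds 0. ?e z \<in> ball 1 d"
    by (rule topological_tendstoD) (use d in auto)
  ultimately have ev: "\<forall>\<^sub>F z in nhds 0. B (?e z) \<notin> \<real>\<^sub>\<le>\<^sub>0 \<and> ?e z \<in> ball 1 d" by eventually_elim auto
  show "\<forall>\<^sub>F z in nhds 0. exp (L z) = B (?e z) * exp (- (\<i> * deriv B 1 * z))"
    using ev
  proof eventually_elim
    case (elim z)
    then have "B (?e z) \<noteq> 0" by (auto simp: complex_nonpos_Reals_iff)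
    then show ?case by (simp add: L_def exp_diff exp_minus divide_inverse)
  qed
  have DB: "(B has_field_derivative deriv B u) (at u)" "(deriv B has_field_derivative deriv (deriv B) u) (at u)"
    if "u \<in> ball 1 d" for u
    using that by (auto intro!: holomorphic_derivI[OF B_hol] holomorphic_derivI[OF holomorphic_deriv[OF B_hol]])
  have De: "(?e has_field_derivative \<i> * ?e z) (at z)" for z
    by (auto intro!: derivative_eq_intros)
  have D1: "(L has_field_derivative deriv B (?e z) * (\<i> * ?e z) / B (?e z) - \<i> * deriv B 1) (at z)"
    if "B (?e z) \<notin> \<real>\<^sub>\<le>\<^sub>0" "?e z \<in> ball 1 d" for z
  proof -
    have "((\<lambda>z. B (?e z)) has_field_derivative deriv B (?e z) * (\<i> * ?e z)) (at z)"
      by (rule DERIV_chain2[OF DB(1) De]) (use that in auto)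
    from DERIV_chain2[OF has_field_derivative_Ln[OF that(1)] this]
    have "((\<lambda>z. Ln (B (?e z))) has_field_derivative inverse (B (?e z)) * (deriv B (?e z) * (\<i> * ?e z))) (at z)" .
    from DERIV_diff[OF this DERIV_cmult[OF DERIV_ident, of "\<i> * deriv B 1"]]
    show ?thesis unfolding L_def by (rule DERIV_cong) (simp add: divide_inverse mult_ac)
  qed
  have "deriv L 0 = deriv B (?e 0) * (\<i> * ?e 0) / B (?e 0) - \<i> * deriv B 1"
    by (rule DERIV_imp_deriv, rule D1) (use B_1 d in auto)
  then show "deriv L 0 = 0" by (simp add: B_1)
  have "deriv (deriv L) 0 = deriv (\<lambda>z. deriv B (?e z) * (\<i> * ?e z) / B (?e z) - \<i> * deriv B 1) 0"
    by (rule deriv_cong_ev[OF eventually_mono[OF ev] refl]) (auto intro!: DERIV_imp_deriv D1)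
  also have "\<dots> = - var"
  proof (rule DERIV_imp_deriv)
    have D0: "((\<lambda>z. deriv B (?e z)) has_field_derivative deriv (deriv B) 1 * \<i>) (at 0)"
      "((\<lambda>z. B (?e z)) has_field_derivative deriv B 1 * \<i>) (at 0)"
      using DB[OF one_in] by (auto intro!: DERIV_chain2[OF _ De, THEN DERIV_cong])
    show "((\<lambda>z. deriv B (?e z) * (\<i> * ?e z) / B (?e z) - \<i> * deriv B 1) has_field_derivative - var) (at 0)"
      by (rule derivative_eq_intros D0 De refl | simp add: B_1)+
         (simp add: var_def B_1 power2_eq_square algebra_simps)
  qed
  finally show "deriv (deriv L) 0 = - var" .
qed

lemma char_fun_eq:
  assumes "A n 1 \<noteq> 0" 
  shows "char (distr (measure_pmf (pmf_of_set (T n))) borel (\<lambda>t. (real (X t) - \<mu> * real n) / sqrt (v * real n))) x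
    = exp (- (\<i> * deriv B 1 * of_real (x / sqrt (v * real n)) * of_nat n)) *
        (P n (exp (\<i> * of_real (x / sqrt (v * real n)))) / of_nat (card (T n)))"
proof -
  define \<theta> where "\<theta> = x / sqrt (v * real n)"
  let ?Y = "\<lambda>t. (real (X t) - \<mu> * real n) / sqrt (v * real n)"
  have "char (distr (measure_pmf (pmf_of_set (T n))) borel ?Y) x = (LINT t|measure_pmf (pmf_of_set (T n)). iexp (x * ?Y t))"
    unfolding char_def by (subst integral_distr) auto
  also have "\<dots> = (\<Sum>t\<in>T n. pmf (pmf_of_set (T n)) t *\<^sub>R iexp (x * ?Y t))"
    using nonempty[OF assms] fin by (intro integral_measure_pmf) auto
  also have "\<dots> = (\<Sum>t\<in>T n. exp (- (\<i> * deriv B 1 * of_real \<theta> * of_nat n)) * (exp (\<i> * of_real \<theta>) ^ X t / of_nat (card (T n))))"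
  proof (intro sum.cong refl)
    fix t assume t: "t \<in> T n"
    have "iexp (x * ?Y t) = exp (- (\<i> * of_real \<mu> * of_real \<theta> * of_nat n) + of_nat (X t) * (\<i> * of_real \<theta>))"
      by (rule arg_cong[of _ _ exp]) (simp add: \<theta>_def algebra_simps diff_divide_distrib)
    also have "\<dots> = exp (- (\<i> * deriv B 1 * of_real \<theta> * of_nat n)) * exp (\<i> * of_real \<theta>) ^ X t"
      by (simp only: exp_add exp_of_nat_mult \<mu>_eq)
    finally show "pmf (pmf_of_set (T n)) t *\<^sub>R iexp (x * ?Y t) =
       exp (- (\<i> * deriv B 1 * of_real \<theta> * of_nat n)) * (exp (\<i> * of_real \<theta>) ^ X t / of_nat (card (T n)))"
      using nonempty[OF assms] fin t by (simp add: scaleR_conv_of_real divide_inverse mult_ac)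
  qed
  finally show ?thesis by (simp add: P_def \<theta>_def sum_distrib_left sum_divide_distrib)
qed

text \<open>With \<open>\<theta> n = x / sqrt (v * n)\<close>, the characteristic function is
  \<open>G n * B * exp (n * L (\<theta> n))\<close>, where \<open>n * L (\<theta> n)\<close> tends
  to \<open>- x^2 / 2\<close>. The single factor \<open>B\<close> is left over from the exponent
  \<open>Suc n\<close> and tends to 1. The case \<open>x = 0\<close> is separate because the
  quotient by the square of \<open>\<theta> n\<close> requires
  \<open>\<theta> n \<noteq> 0\<close>.\<close>

lemma char_fun_lim:
  assumes v: "v > 0"
  shows "(\<lambda>n. char (distr (measure_pmf (pmf_of_set (T n))) borel
      (\<lambda>t. (real (X t) - \<mu> * real n) / sqrt (v * real n))) x) \<longlonglongrightarrow> of_real (exp (- x\<^sup>2 / 2))"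
proof (cases "x = 0")
  case True
  interpret D: real_distribution "distr (measure_pmf (pmf_of_set (T n))) borel (\<lambda>t. (real (X t) - \<mu> * real n) / sqrt (v * real n))" for n
    by (rule prob_space.real_distribution_distr[OF prob_space_measure_pmf]) auto
  show ?thesis using True by (simp add: D.char_zero)
next
  case False
  define \<theta> where "\<theta> = (\<lambda>n. complex_of_real (x / sqrt (v * real n)))"
  have "(\<lambda>n. x / sqrt v * (1 / sqrt (real n))) \<longlonglongrightarrow> x / sqrt v * 0"
    by (intro tendsto_intros tendsto_divide_0[OF tendsto_const] filterlim_at_top_imp_at_infinity
          filterlim_compose[OF sqrt_at_top filterlim_real_sequentially])
  then have "(\<lambda>n. x / sqrt (v * real n)) \<longlonglongrightarrow> 0" by (simp add: real_sqrt_mult)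
  from tendsto_of_real[OF this] have \<theta>0: "\<theta> \<longlonglongrightarrow> 0" unfolding \<theta>_def of_real_0 .
  have \<theta>_nz: "\<forall>\<^sub>F n in sequentially. \<theta> n \<noteq> 0"
    using eventually_gt_at_top[of 0] by eventually_elim (use False v in \<open>auto simp: \<theta>_def\<close>)
  have e1: "(\<lambda>n. exp (\<i> * \<theta> n)) \<longlonglongrightarrow> 1" using tendsto_exp[OF tendsto_mult[OF tendsto_const[of \<i>] \<theta>0]] by simp
  have "isCont B 1" using B_hol one_in holomorphic_on_imp_continuous_on continuous_on_eq_continuous_at[OF open_ball] by blast
  from isCont_tendsto_compose[OF this e1] have B1: "(\<lambda>n. B (exp (\<i> * \<theta> n))) \<longlonglongrightarrow> 1" by (simp add: B_1)
  have "filterlim \<theta> (at 0) sequentially" using \<theta>0 \<theta>_nz by (rule filterlim_atI)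
  from filterlim_compose[OF second_order_limit[OF L_props(1-3)] this]
  have "(\<lambda>n. L (\<theta> n) / (\<theta> n)\<^sup>2) \<longlonglongrightarrow> - var / 2" by (simp add: L_props(4))
  then have "(\<lambda>n. of_real (x\<^sup>2 / v) * (L (\<theta> n) / (\<theta> n)\<^sup>2)) \<longlonglongrightarrow> of_real (x\<^sup>2 / v) * (- var / 2)"
    by (rule tendsto_mult[OF tendsto_const])
  moreover have "\<forall>\<^sub>F n in sequentially. of_real (x\<^sup>2 / v) * (L (\<theta> n) / (\<theta> n)\<^sup>2) = of_nat n * L (\<theta> n)"
    using eventually_gt_at_top[of 0]
  proof eventually_elim
    case (elim n)
    have "(\<theta> n)\<^sup>2 = of_real (x\<^sup>2 / (v * real n))"
      using v elim unfolding \<theta>_def of_real_power[symmetric] by (simp add: power_divide)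
    then show ?case using elim v False by simp
  qed
  ultimately have "(\<lambda>n. of_nat n * L (\<theta> n)) \<longlonglongrightarrow> of_real (x\<^sup>2 / v) * (- var / 2)"
    using Lim_transform_eventually by force
  also have "of_real (x\<^sup>2 / v) * (- var / 2) = of_real (- x\<^sup>2 / 2)"
    using v by (simp add: v_eq[symmetric])
  finally have "(\<lambda>n. G n (exp (\<i> * \<theta> n)) * B (exp (\<i> * \<theta> n)) * exp (of_nat n * L (\<theta> n))) \<longlonglongrightarrow> 1 * 1 * exp (of_real (- x\<^sup>2 / 2))"
    by (intro tendsto_intros G_lim_seq e1 B1)
  then have lim: "(\<lambda>n. G n (exp (\<i> * \<theta> n)) * B (exp (\<i> * \<theta> n)) * exp (of_nat n * L (\<theta> n))) \<longlonglongrightarrow> of_real (exp (- x\<^sup>2 / 2))"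
    by (simp add: exp_of_real[symmetric])
  have L_ev: "\<forall>\<^sub>F n in sequentially. exp (L (\<theta> n)) = B (exp (\<i> * \<theta> n)) * exp (- (\<i> * deriv B 1 * \<theta> n))"
    using L_props(5) \<theta>0 by (rule eventually_compose_filterlim)
  have "\<forall>\<^sub>F n in sequentially. exp (\<i> * \<theta> n) \<in> ball 1 d"
    using topological_tendstoD[OF e1 open_ball one_in] .
  with A_nz L_ev have "\<forall>\<^sub>F n in sequentially. G n (exp (\<i> * \<theta> n)) * B (exp (\<i> * \<theta> n)) * exp (of_nat n * L (\<theta> n)) =
    char (distr (measure_pmf (pmf_of_set (T n))) borel (\<lambda>t. (real (X t) - \<mu> * real n) / sqrt (v * real n))) x"
  proof eventually_elim
    case (elim n)
    have "exp (of_nat n * L (\<theta> n)) = (B (exp (\<i> * \<theta> n)) * exp (- (\<i> * deriv B 1 * \<theta> n))) ^ n"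
      by (simp only: exp_of_nat_mult elim(2))
    also have "\<dots> = B (exp (\<i> * \<theta> n)) ^ n * exp (- (\<i> * deriv B 1 * \<theta> n * of_nat n))"
      by (simp add: power_mult_distrib exp_of_nat_mult[symmetric] mult_ac)
    finally show ?case
      unfolding char_fun_eq[OF elim(1)] \<theta>_def[symmetric] pgf[OF elim(1,3), unfolded \<theta>_def]
      by (simp add: \<theta>_def mult_ac)
  qed
  with lim show ?thesis by (rule Lim_transform_eventually)
qed

lemma asymptotically_normal_pmf_of_set:
  assumes "var \<noteq> 0"
  shows "v > 0" "asymptotically_normal (\<lambda>n. pmf_of_set (T n)) (\<lambda>t. real (X t)) \<mu> v"
proof -
  show v: "v > 0" using v_nonneg v_eq assms by (cases "v = 0") auto
  have "(\<lambda>n. measure_pmf.expectation (pmf_of_set (T n)) (\<lambda>t. real (X t))) \<sim>[sequentially] (\<lambda>n. \<mu> * real n)"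
  proof (rule asymp_equivI'_const)
    have "\<forall>\<^sub>F n in sequentially. mean n / real n = measure_pmf.expectation (pmf_of_set (T n)) (\<lambda>t. real (X t)) / real n"
      using A_nz by eventually_elim (simp add: expectation_eq mean_def)
    with mean_lim' show "(\<lambda>n. measure_pmf.expectation (pmf_of_set (T n)) (\<lambda>t. real (X t)) / real n) \<longlonglongrightarrow> \<mu>"
      by (rule Lim_transform_eventually)
  qed (use \<mu>_pos in simp)
  moreover have "(\<lambda>n. measure_pmf.variance (pmf_of_set (T n)) (\<lambda>t. real (X t))) \<sim>[sequentially] (\<lambda>n. v * real n)"
  proof (rule asymp_equivI'_const)
    have "\<forall>\<^sub>F n in sequentially. variance n / real n = measure_pmf.variance (pmf_of_set (T n)) (\<lambda>t. real (X t)) / real n"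
      using A_nz
    proof eventually_elim
      case (elim n)
      show ?case unfolding variance_eq[OF elim] ..
    qed
    with variance_lim' show "(\<lambda>n. measure_pmf.variance (pmf_of_set (T n)) (\<lambda>t. real (X t)) / real n) \<longlonglongrightarrow> v"
      by (rule Lim_transform_eventually)
  qed (use v in simp)
  moreover have "weak_conv_m (\<lambda>n. distr (measure_pmf (pmf_of_set (T n))) borel
      (\<lambda>t. (real (X t) - \<mu> * real n) / sqrt (v * real n))) std_normal_distribution"
    using char_fun_lim[OF v]
    by (intro levy_continuity real_dist_normal_dist prob_space.real_distribution_distr[OF prob_space_measure_pmf])
       (auto simp: char_std_normal_distribution)
  ultimately show "asymptotically_normal (\<lambda>n. pmf_of_set (T n)) (\<lambda>t. real (X t)) \<mu> v"
    unfolding asymptotically_normal_def by blast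
qed

end

section \<open>Uniform coefficient asymptotics and the limit law\<close>

lemma inverse_csqrt_fps_le:
  assumes "n \<ge> 2"
  shows "1 / (norm (csqrt_fps $ n) * real n ^ 2) \<le> 4 / sqrt (real n)"
proof -
  define a where "a = norm (csqrt_fps $ n)"
  have n: "real n > 0" using assms by simp
  have "1 / 16 \<le> a\<^sup>2 * (real n ^ 2 * (real n - 1))"
    using norm_csqrt_fps_ge[OF assms] by (simp add: a_def)
  also have "\<dots> \<le> a\<^sup>2 * (real n ^ 2 * real n)" by (intro mult_left_mono) auto
  finally have "1 / 16 \<le> (a * real n * sqrt (real n))\<^sup>2" by (simp add: power_mult_distrib)
  then have "(1 / 4)\<^sup>2 \<le> (a * real n * sqrt (real n))\<^sup>2" by (simp add: power2_eq_square)
  then have 1: "1 / 4 \<le> a * real n * sqrt (real n)"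
    by (rule power2_le_imp_le) (simp add: a_def)
  then have a: "a > 0" using n by (cases "a = 0") (auto simp: a_def)
  have "sqrt (real n) * sqrt (real n) = real n" by simp
  with 1 have "sqrt (real n) \<le> 4 * (a * real n ^ 2)"
    using mult_left_mono[OF 1, of "sqrt (real n)"] by (simp add: power2_eq_square mult_ac)
  then show ?thesis using a n by (simp add: a_def[symmetric] field_simps)
qed

context dominant
begin

text \<open>\<open>lobe_coeff\<close> applies with \<open>d1\<close> and \<open>M\<close>
  independent of \<open>u\<close>. Dividing its error \<open>K / n^2\<close> by the coefficient of
  the square root leaves order \<open>n\<close> to the power -1/2, uniformly in
  \<open>u\<close>.\<close>

lemma term_poly_uniform_limit:
  obtains d c where "d > 0" "\<rho> holomorphic_on ball 1 d" "\<And>u. u \<in> ball 1 d \<Longrightarrow> \<rho> u \<noteq> 0" "c 1 \<noteq> 0"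
    "uniform_limit (ball 1 d) (\<lambda>n u. term_poly k 0 n u * \<rho> u ^ Suc n / csqrt_fps $ Suc n) c sequentially"
proof -
  obtain d1 M where d1: "d1 > 0" "\<And>u. u \<in> ball 1 d1 \<Longrightarrow> \<Phi> u holomorphic_on lobe_nhd d1"
    "\<And>u w. u \<in> ball 1 d1 \<Longrightarrow> w \<in> lobe_nhd d1 \<Longrightarrow> norm (\<Phi> u w) \<le> M"
    by (rule \<Phi>_uniform) (assumption | rule that)+
  obtain d2 where d2: "d2 > 0" "\<rho> holomorphic_on ball 1 d2"
    using analytic by (auto simp: analytic_on_def)
  have "isCont \<rho> 1" using analytic_at_imp_isCont[OF analytic] .
  then have "(\<rho> \<longlongrightarrow> \<rho> 1) (nhds 1)"
    using tendsto_at_iff_tendsto_nhds[of \<rho> 1] by (simp only: isCont_def)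
  then have "\<forall>\<^sub>F u in nhds 1. \<rho> u \<in> - {0}"
    by (rule topological_tendstoD) (use r_pos \<rho>1 in auto)
  from eventually_conj[OF this \<Phi>_expansion] obtain d3 where d3: "d3 > 0" "\<And>u. u \<in> ball 1 d3 \<Longrightarrow> \<rho> u \<noteq> 0"
    "\<And>u. u \<in> ball 1 d3 \<Longrightarrow>
      (\<lambda>x. \<Phi> u (csqrt (1 - x))) has_fps_expansion Abs_fps (\<lambda>n. sq k (Suc k) u $ n * \<rho> u ^ n)"
    unfolding eventually_nhds_metric by (auto simp: dist_commute)
  define d where "d = min d1 (min d2 d3)"
  define K where "K = 2 * (step_const (d1/2) + 8 / d1) * step_const d1 * M"
  \<comment> \<open>The factor -1/2 undoes \<open>sq = 1 - 2 * z * gf\<close>.\<close>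
  define c where "c = (\<lambda>u. - deriv (\<Phi> u) 0 / 2)"
  have "K \<ge> 0"
  proof -
    have "0 \<in> lobe_nhd d1" using lobe_subset_nhd[OF d1(1)] zero_in_lobe by blast
    then have "norm (\<Phi> 1 0) \<le> M" using d1 by simp
    then have "M \<ge> 0" using norm_ge_zero order.trans by blast
    then show ?thesis using d1(1) step_const_nonneg[of d1] step_const_nonneg[of "d1/2"] by (simp add: K_def)
  qed
  have bound: "norm (term_poly k 0 n u * \<rho> u ^ Suc n / csqrt_fps $ Suc n - c u) \<le> 2 * K / sqrt (real (Suc n))"
    if u: "u \<in> ball 1 d" and n: "n \<ge> 1" for u n
  proof -
    let ?a = "csqrt_fps $ Suc n"
    have a: "?a \<noteq> 0" using norm_csqrt_fps_ge[of "Suc n"] n by auto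
    have "norm (Abs_fps (\<lambda>n. sq k (Suc k) u $ n * \<rho> u ^ n) $ Suc n - deriv (\<Phi> u) 0 * ?a) \<le> K / real (Suc n) ^ 2"
      unfolding K_def using u n by (intro lobe_coeff d1 d3) (auto simp: d_def)
    also have "Abs_fps (\<lambda>n. sq k (Suc k) u $ n * \<rho> u ^ n) $ Suc n - deriv (\<Phi> u) 0 * ?a
        = - 2 * ?a * (term_poly k 0 n u * \<rho> u ^ Suc n / ?a - c u)"
      using a by (simp add: sq_nth c_def field_simps del: power_Suc)
    finally have "2 * norm ?a * norm (term_poly k 0 n u * \<rho> u ^ Suc n / ?a - c u) \<le> K / real (Suc n) ^ 2"
      by (simp only: norm_mult norm_minus_cancel) simp
    then have "norm (term_poly k 0 n u * \<rho> u ^ Suc n / ?a - c u) \<le> K / 2 * (1 / (norm ?a * real (Suc n) ^ 2))"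
      using a by (simp add: field_simps del: of_nat_Suc)
    also have "\<dots> \<le> K / 2 * (4 / sqrt (real (Suc n)))"
      using inverse_csqrt_fps_le[of "Suc n"] n \<open>K \<ge> 0\<close> by (intro mult_left_mono) auto
    finally show ?thesis by simp
  qed
  have lim0: "(\<lambda>n. 2 * K / sqrt (real (Suc n))) \<longlonglongrightarrow> 0"
    by (intro tendsto_divide_0[OF tendsto_const] filterlim_at_top_imp_at_infinity
          filterlim_compose[OF sqrt_at_top] filterlim_compose[OF filterlim_real_sequentially filterlim_Suc])
  show ?thesis
  proof (rule that[of d c])
    show "d > 0" using d1 d2 d3 by (simp add: d_def)
    show "\<rho> holomorphic_on ball 1 d" using d2(2) by (rule holomorphic_on_subset) (auto simp: d_def)
    show "\<rho> u \<noteq> 0" if "u \<in> ball 1 d" for u using that d3(2) by (auto simp: d_def)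
    show "c 1 \<noteq> 0" using deriv_\<Phi>_nonzero by (simp add: c_def)
    show "uniform_limit (ball 1 d) (\<lambda>n u. term_poly k 0 n u * \<rho> u ^ Suc n / csqrt_fps $ Suc n) c sequentially"
    proof (rule uniform_limitI)
      fix e :: real assume "e > 0"
      with lim0 have "\<forall>\<^sub>F n in sequentially. 2 * K / sqrt (real (Suc n)) < e" by (rule order_tendstoD)
      then show "\<forall>\<^sub>F n in sequentially. \<forall>u\<in>ball 1 d.
          dist (term_poly k 0 n u * \<rho> u ^ Suc n / csqrt_fps $ Suc n) (c u) < e"
        using eventually_ge_at_top[of 1]
      proof eventually_elim
        case (elim n)
        then show ?case using bound[OF _ elim(2)] unfolding dist_norm by (blast intro: le_less_trans)
      qed
    qed
  qed
qed

end

lemma leaves_ge: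
  assumes "t \<in> terms_of_size k 0 n"
  shows "1 / (real k + 2) * real n \<le> real (leaves t)"
proof -
  have "n + 1 \<le> (max_level t + 2) * leaves t"
    using size_le_leaves[of t] assms by (simp add: terms_of_size_def)
  also have "\<dots> \<le> (k + 2) * leaves t"
    using assms by (intro mult_right_mono) (auto simp: terms_of_size_def terms_def)
  finally have "n \<le> (k + 2) * leaves t" by simp
  then have "real n \<le> (real k + 2) * real (leaves t)"
    by (metis of_nat_le_iff of_nat_mult of_nat_add of_nat_numeral)
  then show ?thesis by (simp add: field_simps)
qed

lemma random_term_eq: "random_term k = (\<lambda>n. pmf_of_set (terms_of_size k 0 n))"
  by (simp add: random_term_def[abs_def] terms_of_size_def closed_terms_eq)

theorem theorem2p3:
  fixes k :: nat and \<rho> B :: "complex \<Rightarrow> complex"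
  assumes "k \<ge> 1"
    and "\<forall>\<^sub>F u in nhds 1. dominant_singularity (\<lambda>z. H k z u) (\<rho> u)"
    and "\<rho> analytic_on {1}"
  defines "B \<equiv> \<lambda>u. \<rho> 1 / \<rho> u"
  assumes "deriv (deriv B) 1 + deriv B 1 - (deriv B 1)\<^sup>2 \<noteq> 0"
  shows "\<exists>\<mu> v :: real.
    complex_of_real \<mu> = deriv B 1 \<and>
    complex_of_real v = deriv (deriv B) 1 + deriv B 1 - (deriv B 1)\<^sup>2 \<and>
    v > 0 \<and>
    asymptotically_normal (random_term k) (\<lambda>t. real (leaves t)) \<mu> v"
proof -
  obtain J r where loc: "2 \<le> J" "J \<le> Suc k" "positive_radius k 1 r" "\<rho> 1 = of_real r" "rrad k J r 1 = 0"
    "\<And>i. i \<le> Suc k \<Longrightarrow> i \<noteq> J \<Longrightarrow> rrad k i r 1 > 0" "\<forall>\<^sub>F u in nhds 1. rad k J (\<rho> u) u = 0"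
    by (rule dominant_location[OF assms(1-3)]) (assumption | rule that)+
  interpret positive_radius k 1 r by (rule loc)
  interpret dominant k r J \<rho>
    by unfold_locales (use loc assms(3) in auto)
  obtain d c where dc: "d > 0" "\<rho> holomorphic_on ball 1 d" "\<And>u. u \<in> ball 1 d \<Longrightarrow> \<rho> u \<noteq> 0" "c 1 \<noteq> 0"
    "uniform_limit (ball 1 d) (\<lambda>n u. term_poly k 0 n u * \<rho> u ^ Suc n / csqrt_fps $ Suc n) c sequentially"
    by (rule term_poly_uniform_limit) (assumption | rule that)+
  \<comment> \<open>\<open>1 / (k + 2)\<close> is the least proportion of leaves, from
    \<open>leaves_ge\<close>.\<close>
  interpret Q: quasi_powers "terms_of_size k 0" leaves \<rho> c "\<lambda>n. csqrt_fps $ Suc n" d "1 / (real k + 2)"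
    by unfold_locales (use dc leaves_ge in \<open>auto simp: term_poly_def\<close>)
  have B: "Q.B = B" by (simp add: B_def Q.B_def[abs_def])
  have var: "Q.var \<noteq> 0" using assms(5) by (simp add: Q.var_def B)
  show ?thesis
    using Q.\<mu>_eq Q.v_eq Q.asymptotically_normal_pmf_of_set[OF var] unfolding B Q.var_def random_term_eq by blast
qed

end
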